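(* Let $\mathbb M\subset\mathbb R^d$ be a bounded Lipschitz domain, $\mathcal X$ a Banach space, $\mathcal Y=L^1(\mathbb M)$, and let $F:D(F)\subset\mathcal X\to L^1(\mathbb M)$ and $\mathcal R:\mathcal X\to(-\infty,\infty]$ satisfy the well-posedness assumption stated in the context. Let $f^\dagger\in\mathrm{dom}\,\mathcal R$, $g^\dagger=F(f^\dagger)$, $f^*\in\partial\mathcal R(f^\dagger)$, and $\mathcal D(f,f^\dagger)=\mathcal R(f)-\mathcal R(f^\dagger)-\langle f^*,f-f^\dagger\rangle$. Suppose: (i) there are $\beta>0$ and a concave index function $\varphi\not\equiv0$ such that $\beta\,\mathcal D(f,f^\dagger)\le \mathcal R(f)-\mathcal R(f^\dagger)+\varphi\big(\|F(f)-g^\dagger\|_{L^1(\mathbb M)}\big)$ for all $f\in\mathrm{dom}\,\mathcal R$; (ii) there are $k\in\mathbb N_0$, $p\in[1,\infty]$, $q\in(1,\infty)$ and $C_{F,k,p}>0$ such that $F(\mathrm{dom}\,\mathcal R)\subset W^{k,p}(\mathbb M)$ and $|F(f)-g^\dagger|_{W^{k,p}(\mathbb M)}\le C_{F,k,p}\,\mathcal D(f,f^\dagger)^{1/q}$ for all $f\in\mathrm{dom}\,\mathcal R$, where either $k=0$ and $p=\infty$, or $k>d/p$. Let $\frac1q+\frac1{q'}=1$ and $\gamma:=\frac{q'k}{d}+\frac{q'(p-1)}{p}$. For $\varepsilon,\eta>0$ let $g^{\rm obs}=g^\dagger+\xi$ with $\xi\in L^1(\mathbb M)$ such that there is a Borel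 set $\mathbb P\subset\mathbb M$ with $\|\xi\|_{L^1(\mathbb M\setminus\mathbb P)}\le\varepsilon$, $|\mathbb P|\le\eta$, and let $\widehat f_\alpha\in\operatorname{argmin}_{f\in D(F)}\big[\frac1\alpha\|F(f)-g^{\rm obs}\|_{L^1(\mathbb M)}+\mathcal R(f)\big]$. Case 1: Suppose $\varphi^{1+\delta}$ is concave for some $\delta>0$. Put $\theta(\alpha):=\alpha\,\psi(\alpha)$ and $\tilde\theta(\alpha):=\alpha^{q'}\psi(\alpha)$. If $\alpha$ is chosen such that $$\underline c\,\alpha\le\theta^{-1}(\varepsilon)+\tilde\theta^{-1}(\eta^\gamma)\le\overline c\,\alpha$$ for some constants $\underline c,\overline c>0$ (independent of $\varepsilon,\eta$), then, as $\max\{\varepsilon,\eta\}\searrow0$, $$\mathcal D(\widehat f_\alpha,f^\dagger)=\mathcal O\Big(\psi\big(\theta^{-1}(\varepsilon)+\tilde\theta^{-1}(\eta^\gamma)\big)\Big),\qquad \|F(\widehat f_\alpha)-g^\dagger\|_{L^1(\mathbb M)}=\mathcal O\Big(\varepsilon+\theta\big(\tilde\theta^{-1}(\eta^\gamma)\big)\Big).$$ Case 2: Suppose $\varphi(t)=ct$ for some $c>0$. Let $C_{\rm err}=1$ if $k=0$ and $p=\infty$, and let $C_{\rm err}>1$ be an arbitrary fixed number if $k>d/p$. If $\alpha$ is fixed with $0<\alpha\le\frac1{2C_{\rm err}c}$, then, as $\max\{\varepsilon,\eta\}\searrow0$, $$\mathcal D(\widehat f_\alpha,f^\dagger)+\|F(\widehat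 f_\alpha)-g^\dagger\|_{L^1(\mathbb M)}=\mathcal O(\varepsilon+\eta^\gamma).$$
   Context: Well-posedness assumption: $\mathcal X,\mathcal Y$ are Banach spaces with topologies $\tau_{\mathcal X},\tau_{\mathcal Y}$ weaker than the norm topologies; $\mathcal R:\mathcal X\to(-\infty,\infty]$ is convex, lower semicontinuous, with nonempty essential domain $\mathrm{dom}\,\mathcal R=\{f:\mathcal R(f)<\infty\}\subset D(F)$; all sublevel sets $\{f\in D(F):\mathcal R(f)\le R\}$, $R\in\mathbb R$, are sequentially compact w.r.t. $\tau_{\mathcal X}$; $\|\cdot\|_{\mathcal Y}$ is sequentially lower semicontinuous w.r.t. $\tau_{\mathcal Y}$; and $F:\mathrm{dom}\,\mathcal R\to\mathcal Y$ is sequentially continuous w.r.t. $\tau_{\mathcal X}$ and $\tau_{\mathcal Y}$. A concave index function is a concave, continuous, monotonically increasing function $\varphi:[0,\infty)\to[0,\infty)$ with $\varphi(0)=0$. For $\alpha>0$, $$\psi(\alpha):=(-\varphi)^*\left(-\tfrac1\alpha\right)=\sup_{\tau\ge0}\left(\varphi(\tau)-\tfrac{\tau}{\alpha}\right)\in[0,\infty].$$ $\theta^{-1},\tilde\theta^{-1}$ are the inverse functions of $\theta,\tilde\theta:(0,\infty)\to(0,\infty)$. $|\mathbb P|$ is Lebesgue measure. $|g|_{W^{k,p}(\mathbb M)}=\big(\sum_{|\alpha|=k}\|D^\alpha g\|_{L^p(\mathbb M)}^p\big)^{1/p}$ (maximum of the $L^\infty$ norms if $p=\infty$). Conventions for $p=\infty$: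 $d/p=0$ and $\frac{q'(p-1)}{p}=q'$. Meaning of $\mathcal O$ as $\max\{\varepsilon,\eta\}\searrow0$: there are constants $C,t_0>0$ such that the bound holds with constant $C$ for all $\varepsilon,\eta>0$ with $\max\{\varepsilon,\eta\}\le t_0$, all admissible $\xi$, all admissible $\alpha$ (in Case 2, $C$ may depend on the fixed $\alpha$) and all minimizers $\widehat f_\alpha$; everything else ($\mathbb M,F,\mathcal R,f^\dagger,f^*,\beta,\varphi,k,p,q,\delta,\underline c,\overline c$) is fixed. *)

theory Defs
  imports "HOL-Analysis.Analysis" "HOL-Probability.Essential_Supremum"
begin

section \<open>Lipschitz domains\<close>

text \<open>
  Near each boundary point the domain is the strict epigraph of a Lipschitz function in some
  orthogonal coordinate system.  The coordinates are given by a unit vector \<open>e\<close> (the vertical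
  axis) and its orthogonal complement, so \<open>y\<close> has height \<open>y \<bullet> e\<close> and base point
  \<open>y - (y \<bullet> e) *\<^sub>R e\<close>.
\<close>

definition bounded_lipschitz_domain :: "'a::euclidean_space set \<Rightarrow> bool" where
  "bounded_lipschitz_domain M \<longleftrightarrow>
     open M \<and> connected M \<and> M \<noteq> {} \<and> bounded M \<and>
     (\<forall>x\<in>frontier M. \<exists>e r L h. norm e = 1 \<and> 0 < r \<and> L-lipschitz_on {z. z \<bullet> e = 0} h \<and>
        M \<inter> ball x r = {y \<in> ball x r. (h :: 'a \<Rightarrow> real) (y - (y \<bullet> e) *\<^sub>R e) < y \<bullet> e})"

section \<open>Lebesgue spaces\<close>

text \<open>
  Elements of \<open>L\<^sup>p(S)\<close> are represented by functions, not by classes modulo equality almost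
  everywhere.  The exponent ranges over \<open>[1,\<infinity>]\<close>.
\<close>

definition Lp :: "'a::euclidean_space set \<Rightarrow> ereal \<Rightarrow> ('a \<Rightarrow> real) set" where
  "Lp S p = {u \<in> borel_measurable (lebesgue_on S).
     if p = \<infinity> then \<exists>B. AE x in lebesgue_on S. \<bar>u x\<bar> \<le> B
     else integrable (lebesgue_on S) (\<lambda>x. \<bar>u x\<bar> powr real_of_ereal p)}"

definition Lp_norm :: "'a::euclidean_space set \<Rightarrow> ereal \<Rightarrow> ('a \<Rightarrow> real) \<Rightarrow> real" where
  "Lp_norm S p u =
     (if p = \<infinity> then real_of_ereal (esssup (lebesgue_on S) (\<lambda>x. ereal \<bar>u x\<bar>))
      else (\<integral>x. \<bar>u x\<bar> powr real_of_ereal p \<partial>lebesgue_on S) powr (1 / real_of_ereal p))"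

section \<open>Weak derivatives and Sobolev spaces\<close>

definition partial_deriv :: "'n \<Rightarrow> (real^'n \<Rightarrow> real) \<Rightarrow> real^'n \<Rightarrow> real" where
  "partial_deriv i f = (\<lambda>x. frechet_derivative f (at x) (axis i 1))"

definition iter_partial :: "'n list \<Rightarrow> (real^'n \<Rightarrow> real) \<Rightarrow> real^'n \<Rightarrow> real" where
  "iter_partial is f = foldr partial_deriv is f"

definition smooth :: "(real^'n \<Rightarrow> real) \<Rightarrow> bool" where
  "smooth f \<longleftrightarrow> (\<forall>is x. iter_partial is f differentiable (at x))"

text \<open>
  A multi-index is a function \<open>a :: 'n \<Rightarrow> nat\<close> of order \<open>\<Sum>i. a i\<close>.  The derivative
  \<open>D\<^sup>a\<close> is only applied to smooth functions, for which the order in which the partial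
  derivatives are taken is immaterial; so any list with the right multiplicities will do.
\<close>

definition multi_deriv :: "('n \<Rightarrow> nat) \<Rightarrow> (real^'n \<Rightarrow> real) \<Rightarrow> real^'n \<Rightarrow> real" where
  "multi_deriv a f = iter_partial (SOME is. \<forall>i. count_list is i = a i) f"

definition test_function :: "(real^'n) set \<Rightarrow> (real^'n \<Rightarrow> real) \<Rightarrow> bool" where
  "test_function M w \<longleftrightarrow>
     smooth w \<and> compact (closure {x. w x \<noteq> 0}) \<and> closure {x. w x \<noteq> 0} \<subseteq> M"

definition locally_integrable :: "'a::euclidean_space set \<Rightarrow> ('a \<Rightarrow> real) \<Rightarrow> bool" where
  "locally_integrable M u \<longleftrightarrow> (\<forall>K. compact K \<and> K \<subseteq> M \<longrightarrow> set_integrable lebesgue K u)"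

definition has_weak_deriv ::
  "(real^'n::finite) set \<Rightarrow> ('n \<Rightarrow> nat) \<Rightarrow> (real^'n \<Rightarrow> real) \<Rightarrow> (real^'n \<Rightarrow> real) \<Rightarrow> bool" where
  "has_weak_deriv M a u v \<longleftrightarrow>
     locally_integrable M u \<and> locally_integrable M v \<and>
     (\<forall>w. test_function M w \<longrightarrow>
        (\<integral>x. u x * multi_deriv a w x \<partial>lebesgue_on M) =
        (-1) ^ (\<Sum>i\<in>UNIV. a i) * (\<integral>x. v x * w x \<partial>lebesgue_on M))"

definition sobolev :: "(real^'n::finite) set \<Rightarrow> nat \<Rightarrow> ereal \<Rightarrow> (real^'n \<Rightarrow> real) set" where
  "sobolev M k p =
     {u. u \<in> Lp M p \<and> (\<forall>a. (\<Sum>i\<in>UNIV. a i) \<le> k \<longrightarrow> (\<exists>v\<in>Lp M p. has_weak_deriv M a u v))}"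

text \<open>The weak derivative is unique up to null sets, hence its norm does not depend on the choice.\<close>

definition weak_deriv ::
  "(real^'n::finite) set \<Rightarrow> ('n \<Rightarrow> nat) \<Rightarrow> (real^'n \<Rightarrow> real) \<Rightarrow> real^'n \<Rightarrow> real" where
  "weak_deriv M a u = (SOME v. has_weak_deriv M a u v)"

definition sobolev_seminorm ::
  "(real^'n::finite) set \<Rightarrow> nat \<Rightarrow> ereal \<Rightarrow> (real^'n \<Rightarrow> real) \<Rightarrow> real" where
  "sobolev_seminorm M k p u =
     (if p = \<infinity> then Max ((\<lambda>a. Lp_norm M \<infinity> (weak_deriv M a u)) ` {a. (\<Sum>i\<in>UNIV. a i) = k})
      else (\<Sum>a | (\<Sum>i\<in>UNIV. a i) = k. Lp_norm M p (weak_deriv M a u) powr real_of_ereal p)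
             powr (1 / real_of_ereal p))"

section \<open>Convex functionals\<close>

definition ess_dom :: "('x \<Rightarrow> ereal) \<Rightarrow> 'x set" where
  "ess_dom R = {f. R f < \<infinity>}"

definition convex_functional :: "('x::real_vector \<Rightarrow> ereal) \<Rightarrow> bool" where
  "convex_functional R \<longleftrightarrow>
     (\<forall>f g t. 0 < t \<and> t < 1 \<longrightarrow>
        R ((1 - t) *\<^sub>R f + t *\<^sub>R g) \<le> ereal (1 - t) * R f + ereal t * R g)"

definition lower_semicontinuous :: "('x::topological_space \<Rightarrow> ereal) \<Rightarrow> bool" where
  "lower_semicontinuous R \<longleftrightarrow> (\<forall>f c. c < R f \<longrightarrow> (\<forall>\<^sub>F g in nhds f. c < R g))"

definition subdifferential :: "('x::real_normed_vector \<Rightarrow> ereal) \<Rightarrow> 'x \<Rightarrow> ('x \<Rightarrow>\<^sub>L real) set" where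
  "subdifferential R f = {fs. \<forall>g. R f + ereal (blinfun_apply fs (g - f)) \<le> R g}"

definition bregman ::
  "('x::real_normed_vector \<Rightarrow> ereal) \<Rightarrow> ('x \<Rightarrow>\<^sub>L real) \<Rightarrow> 'x \<Rightarrow> 'x \<Rightarrow> ereal" where
  "bregman R fs f g = R f - R g - ereal (blinfun_apply fs (f - g))"

section \<open>Well-posedness\<close>

definition seq_compactin :: "'a topology \<Rightarrow> 'a set \<Rightarrow> bool" where
  "seq_compactin T S \<longleftrightarrow>
     (\<forall>s. (\<forall>n::nat. s n \<in> S) \<longrightarrow>
        (\<exists>l\<in>S. \<exists>r. strict_mono r \<and> limitin T (s \<circ> r) l sequentially))"

text \<open>
  A set of representatives that is open for the \<open>L\<^sup>1\<close> seminorm is saturated under equality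
  almost everywhere.  Hence the topologies below, on functions, correspond one-to-one to the
  topologies on the Banach space \<open>L\<^sup>1(M)\<close> of classes that are weaker than the norm topology.
\<close>

definition weaker_than_L1_topology ::
  "'a::euclidean_space set \<Rightarrow> ('a \<Rightarrow> real) topology \<Rightarrow> bool" where
  "weaker_than_L1_topology M T \<longleftrightarrow>
     topspace T = Lp M 1 \<and>
     (\<forall>U. openin T U \<longrightarrow>
        (\<forall>u\<in>U. \<exists>r>0. \<forall>v\<in>Lp M 1. Lp_norm M 1 (\<lambda>x. v x - u x) < r \<longrightarrow> v \<in> U))"

definition weaker_than_norm_topology :: "'x::real_normed_vector topology \<Rightarrow> bool" where
  "weaker_than_norm_topology T \<longleftrightarrow> topspace T = UNIV \<and> (\<forall>U. openin T U \<longrightarrow> open U)"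

definition well_posed ::
  "'a::euclidean_space set \<Rightarrow> 'x::banach topology \<Rightarrow> ('a \<Rightarrow> real) topology \<Rightarrow>
   'x set \<Rightarrow> ('x \<Rightarrow> 'a \<Rightarrow> real) \<Rightarrow> ('x \<Rightarrow> ereal) \<Rightarrow> bool" where
  "well_posed M TX TY DF F R \<longleftrightarrow>
     weaker_than_norm_topology TX \<and> weaker_than_L1_topology M TY \<and>
     (\<forall>f\<in>DF. F f \<in> Lp M 1) \<and>
     (\<forall>f. R f \<noteq> -\<infinity>) \<and> convex_functional R \<and> lower_semicontinuous R \<and>
     ess_dom R \<noteq> {} \<and> ess_dom R \<subseteq> DF \<and>
     (\<forall>c::real. seq_compactin TX {f \<in> DF. R f \<le> ereal c}) \<and>
     (\<forall>u l. (\<forall>n. u n \<in> Lp M 1) \<and> limitin TY u l sequentially \<longrightarrow>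
        ereal (Lp_norm M 1 l) \<le> liminf (\<lambda>n. ereal (Lp_norm M 1 (u n)))) \<and>
     (\<forall>s f. (\<forall>n. s n \<in> ess_dom R) \<and> f \<in> ess_dom R \<and> limitin TX s f sequentially \<longrightarrow>
        limitin TY (\<lambda>n. F (s n)) (F f) sequentially)"

section \<open>Index functions\<close>

definition concave_index_function :: "(real \<Rightarrow> real) \<Rightarrow> bool" where
  "concave_index_function \<phi> \<longleftrightarrow>
     (\<forall>t\<ge>0. 0 \<le> \<phi> t) \<and> concave_on {0..} \<phi> \<and> continuous_on {0..} \<phi> \<and>
     mono_on {0..} \<phi> \<and> \<phi> 0 = 0"

definition psi :: "(real \<Rightarrow> real) \<Rightarrow> real \<Rightarrow> ereal" where
  "psi \<phi> \<alpha> = (SUP \<tau>\<in>{0..}. ereal (\<phi> \<tau> - \<tau> / \<alpha>))"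

definition theta :: "(real \<Rightarrow> real) \<Rightarrow> real \<Rightarrow> ereal" where
  "theta \<phi> \<alpha> = ereal \<alpha> * psi \<phi> \<alpha>"

definition theta_tilde :: "real \<Rightarrow> (real \<Rightarrow> real) \<Rightarrow> real \<Rightarrow> ereal" where
  "theta_tilde q' \<phi> \<alpha> = ereal (\<alpha> powr q') * psi \<phi> \<alpha>"

text \<open>
  Inverse of a function \<open>(0,\<infinity>) \<rightarrow> (0,\<infinity>)\<close>; \<open>theta\<close> and \<open>theta_tilde\<close> are such bijections
  whenever \<open>\<phi>\<close> is a nonzero concave index function with \<open>\<phi>\<close> to some power greater than one
  still concave.
\<close>

definition inv_pos :: "(real \<Rightarrow> ereal) \<Rightarrow> real \<Rightarrow> real" where
  "inv_pos \<Theta> t = inv_into {0<..} \<Theta> (ereal t)"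

section \<open>Data and reconstruction\<close>

definition impulsive_noise ::
  "'a::euclidean_space set \<Rightarrow> real \<Rightarrow> real \<Rightarrow> ('a \<Rightarrow> real) \<Rightarrow> bool" where
  "impulsive_noise M \<epsilon> \<eta> \<xi> \<longleftrightarrow>
     \<xi> \<in> Lp M 1 \<and>
     (\<exists>P. P \<in> sets borel \<and> P \<subseteq> M \<and> Lp_norm (M - P) 1 \<xi> \<le> \<epsilon> \<and> measure lebesgue P \<le> \<eta>)"

definition tikhonov_minimizer ::
  "'a::euclidean_space set \<Rightarrow> 'x set \<Rightarrow> ('x \<Rightarrow> 'a \<Rightarrow> real) \<Rightarrow> ('x \<Rightarrow> ereal) \<Rightarrow>
   real \<Rightarrow> ('a \<Rightarrow> real) \<Rightarrow> 'x \<Rightarrow> bool" where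
  "tikhonov_minimizer M DF F R \<alpha> gobs =
     is_arg_min (\<lambda>f. ereal (1 / \<alpha> * Lp_norm M 1 (\<lambda>x. F f x - gobs x)) + R f) (\<lambda>f. f \<in> DF)"

end

theory Submission
  imports Defs
begin

text \<open>
  A minimiser is compared with \<open>f\<^sup>\<dagger>\<close>; with \<open>g = F(f\<^sub>\<alpha>) - g\<^sup>\<dagger>\<close> this gives
  \<open>\<alpha>\<^sup>-\<^sup>1 (\<parallel>g\<parallel> - 2 \<parallel>g\<parallel>\<^sub>P - 2\<epsilon>) + R(f\<^sub>\<alpha>) - R(f\<^sup>\<dagger>) \<le> 0\<close>, where \<open>\<parallel>g\<parallel>\<^sub>P\<close> is the \<open>L\<^sup>1\<close> norm on the small set
  \<open>P\<close>.  By \<open>\<parallel>g\<parallel>\<^sub>P \<le> \<eta> \<parallel>g\<parallel>\<^sub>\<infinity>\<close> and the scaled Sobolev inequality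
  \<open>\<parallel>g\<parallel>\<^sub>\<infinity> \<le> C (\<rho>\<^sup>-\<^sup>d \<parallel>g\<parallel>\<^sub>1 + \<rho>\<^sup>k\<^sup>-\<^sup>d\<^sup>/\<^sup>p |g|\<^sub>k\<^sub>,\<^sub>p)\<close> with \<open>\<rho>\<^sup>d\<close> a large multiple of \<open>\<eta>\<close>, the term \<open>\<parallel>g\<parallel>\<^sub>P\<close> is at most
  \<open>\<parallel>g\<parallel> / 8\<close> plus a multiple of \<open>\<eta>\<^sup>\<gamma>\<^sup>/\<^sup>q\<^sup>' D\<^sup>1\<^sup>/\<^sup>q\<close>; Young's inequality absorbs the latter in \<open>\<beta> D\<close>.  What
  remains is \<open>\<beta> D / 2 \<le> \<phi>(\<tau>) - 3\<tau> / (4\<alpha>) + 2\<epsilon> / \<alpha> + K \<eta>\<^sup>\<gamma> / \<alpha>\<^sup>q\<^sup>'\<close> with \<open>\<tau> = \<parallel>g\<parallel>\<close>, and \<open>\<psi>\<close> bounds the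
  first two terms.

  The Sobolev inequality is read off the weak formulation without approximation by smooth functions:
  averages of \<open>g\<close> over a cone at \<open>x\<close> at two consecutive scales \<open>s\<close> and \<open>l s\<close> differ by an integral of
  \<open>k\<close>-th weak derivatives of \<open>g\<close> against test functions.
\<close>

section \<open>Smooth functions of one variable\<close>

text \<open>Weak derivatives of g can be tested only inside M, so near the boundary averages must be
  taken to one side of x. The kernel therefore sits around the axis c of a cone rather than around
  0, and dilating it also moves its support; this is why l has to be close to 1 and why supports are
  tracked by a centre and a radius. Kernels are products of functions of one variable. Replacing the
  scale s by l s in one coordinate at a time makes only pure derivatives of order k appear, and k -
  d/p > 0 makes the errors summable over the scales. From averages one returns to values through
  weak convergence, which suffices for a bound almost everywhere. \<open>deriv_seq\<close> carries
  all derivatives of a function along as data, so that derivatives of products and dilations are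
  explicit formulas. The fraction 1/8 of the L^1 norm left by the small-set bound is doubled and
  leaves 3/4 of \<tau>/\<alpha>. One half of \<tau>/\<alpha> pays for \<phi>(\<tau>), through
  \<psi>(2\<alpha>) in Case 1 and c \<le> 1/(2\<alpha>) in Case 2; the last quarter bounds \<tau>
  itself.\<close>

definition deriv_seq :: "(nat \<Rightarrow> real \<Rightarrow> real) \<Rightarrow> bool" where
  "deriv_seq D \<longleftrightarrow> (\<forall>n x. (D n has_real_derivative D (Suc n) x) (at x))"

text \<open>With t = 1/x one has dt/dx = -t^2, so the derivative of p(t) exp(-t) in x is t^2 (p(t) -
  p'(t)) exp(-t). These are the polynomial factors in the derivatives of exp(-1/x) on x > 0.\<close>

primrec exp_poly :: "nat \<Rightarrow> real poly" where
  "exp_poly 0 = 1"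
| "exp_poly (Suc n) = [:0, 0, 1:] * (exp_poly n - pderiv (exp_poly n))"

definition flat :: "nat \<Rightarrow> real \<Rightarrow> real" where
  "flat n x = (if x \<le> 0 then 0 else poly (exp_poly n) (1 / x) * exp (- (1 / x)))"

lemma poly_times_exp_neg_tendsto_0:
  "((\<lambda>t. poly p t * exp (- t)) \<longlongrightarrow> (0::real)) at_top"
proof -
  \<comment> \<open>The factor t ^ m is for the induction: splitting off the constant coefficient
    leaves the tail multiplied by one more t.\<close>
  have *: "((\<lambda>t. t ^ m * poly p t * exp (- t)) \<longlongrightarrow> (0::real)) at_top" for m
  proof (induction p arbitrary: m)
    case 0
    then show ?case by simp
  next
    case (pCons a p)
    have "((\<lambda>t. a * (t ^ m / exp t) + t ^ Suc m * poly p t * exp (- t)) \<longlongrightarrow> a * 0 + 0) at_top"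
      by (intro tendsto_intros tendsto_power_div_exp_0 pCons.IH)
    then show ?case
      by (simp add: algebra_simps exp_minus field_class.field_divide_inverse)
  qed
  show ?thesis using *[of 0] by simp
qed

lemma flat_deriv_seq: "deriv_seq flat"
  unfolding deriv_seq_def
proof (intro allI)
  fix n and x :: real
  consider "x < 0" | "x > 0" | "x = 0" by linarith
  then show "(flat n has_real_derivative flat (Suc n) x) (at x)"
  proof cases
    case 1
    have "((\<lambda>_. 0) has_real_derivative 0) (at x)" by simp
    moreover have "\<forall>\<^sub>F y in nhds x. flat n y = 0"
      using eventually_nhds_in_open[of "{..<0}" x] 1
      by (auto simp: flat_def elim: eventually_mono)
    ultimately show ?thesis
      using 1 by (subst DERIV_cong_ev[OF refl _ refl, where g = "\<lambda>_. 0"]) (auto simp: flat_def)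
  next
    case 2
    let ?P = "exp_poly n"
    have inv: "((\<lambda>x. 1 / x) has_real_derivative - (1 / x\<^sup>2)) (at x)"
      using 2 by (auto intro!: derivative_eq_intros simp: power2_eq_square)
    have "((\<lambda>x. poly ?P (1 / x) * exp (- (1 / x))) has_real_derivative
        (poly (pderiv ?P) (1 / x) * - (1 / x\<^sup>2)) * exp (- (1 / x)) +
        (exp (- (1 / x)) * - (- (1 / x\<^sup>2))) * poly ?P (1 / x)) (at x)"
      by (intro DERIV_mult DERIV_chain2[OF poly_DERIV inv] DERIV_chain2[OF DERIV_exp] DERIV_minus inv)
    also have "(poly (pderiv ?P) (1 / x) * - (1 / x\<^sup>2)) * exp (- (1 / x)) +
        (exp (- (1 / x)) * - (- (1 / x\<^sup>2))) * poly ?P (1 / x) =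
        poly ([:0, 0, 1:] * (?P - pderiv ?P)) (1 / x) * exp (- (1 / x))"
      using 2 by (simp add: power2_eq_square algebra_simps)
    finally have "((\<lambda>x. poly ?P (1 / x) * exp (- (1 / x))) has_real_derivative
        poly ([:0, 0, 1:] * (?P - pderiv ?P)) (1 / x) * exp (- (1 / x))) (at x)" .
    moreover have "\<forall>\<^sub>F y in nhds x. flat n y = poly ?P (1 / y) * exp (- (1 / y))"
      using eventually_nhds_in_open[of "{0<..}" x] 2
      by (auto simp: flat_def elim: eventually_mono)
    ultimately show ?thesis
      using 2 by (subst DERIV_cong_ev[OF refl _ refl,
            where g = "\<lambda>x. poly ?P (1 / x) * exp (- (1 / x))"]) (auto simp: flat_def)
  next
    case 3
    have "((\<lambda>h. flat n h / h) \<longlongrightarrow> 0) (at_left 0)"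
      by (rule tendsto_eventually) (auto simp: flat_def eventually_at_left_field intro: exI[of _ "-1"])
    \<comment> \<open>Dividing by h multiplies the polynomial in 1/h by its variable, hence
      \<open>pCons 0\<close>; the difference quotient has the same form as \<open>flat\<close>
      itself.\<close>
    moreover have "((\<lambda>h. poly (pCons 0 (exp_poly n)) (inverse h) * exp (- inverse h)) \<longlongrightarrow> 0) (at_right 0)"
      by (rule filterlim_compose[OF poly_times_exp_neg_tendsto_0 filterlim_inverse_at_top_right])
    then have "((\<lambda>h. flat n h / h) \<longlongrightarrow> 0) (at_right 0)"
      by (rule Lim_transform_eventually)
         (auto simp: flat_def eventually_at_right_field field_simps intro!: exI[of _ 1])
    ultimately have "((\<lambda>h. flat n h / h) \<longlongrightarrow> 0) (at 0)"
      by (simp add: filterlim_split_at)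
    then show ?thesis
      using 3 by (simp add: DERIV_def flat_def)
  qed
qed

definition leibniz :: "(nat \<Rightarrow> real \<Rightarrow> real) \<Rightarrow> (nat \<Rightarrow> real \<Rightarrow> real) \<Rightarrow> nat \<Rightarrow> real \<Rightarrow> real" where
  "leibniz D E n x = (\<Sum>i\<le>n. of_nat (n choose i) * D i x * E (n - i) x)"

lemma deriv_seq_leibniz:
  assumes "deriv_seq D" "deriv_seq E"
  shows "deriv_seq (leibniz D E)"
  unfolding deriv_seq_def
proof (intro allI)
  fix n x
  have D: "(D n has_real_derivative D (Suc n) x) (at x)"
    and E: "(E n has_real_derivative E (Suc n) x) (at x)" for n
    using assms by (auto simp: deriv_seq_def)
  have "(leibniz D E n has_real_derivative
      (\<Sum>i\<le>n. of_nat (n choose i) * (D (Suc i) x * E (n - i) x + D i x * E (Suc n - i) x))) (at x)"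
    unfolding leibniz_def
    by (auto intro!: derivative_eq_intros D E sum.cong simp: algebra_simps Suc_diff_le)
  also have "(\<Sum>i\<le>n. of_nat (n choose i) * (D (Suc i) x * E (n - i) x + D i x * E (Suc n - i) x)) =
      (\<Sum>i\<le>n. of_nat (n choose i) * D (Suc i) x * E (n - i) x) +
      (\<Sum>i\<le>Suc n. of_nat (n choose i) * D i x * E (Suc n - i) x)"
    by (simp add: sum.distrib algebra_simps)
  also have "(\<Sum>i\<le>Suc n. of_nat (n choose i) * D i x * E (Suc n - i) x) =
      D 0 x * E (Suc n) x + (\<Sum>i\<le>n. of_nat (n choose Suc i) * D (Suc i) x * E (n - i) x)"
    by (subst sum.atMost_Suc_shift) simp
  also have "(\<Sum>i\<le>n. of_nat (n choose i) * D (Suc i) x * E (n - i) x) + \<dots> = leibniz D E (Suc n) x"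
    unfolding leibniz_def
    by (subst sum.atMost_Suc_shift) (simp add: sum.distrib algebra_simps)
  finally show "(leibniz D E n has_real_derivative leibniz D E (Suc n) x) (at x)" .
qed

lemma deriv_seq_affine:
  assumes "deriv_seq D"
  shows "deriv_seq (\<lambda>n x. r * m ^ n * D n (m * x + t))"
  unfolding deriv_seq_def
proof (intro allI)
  fix n x
  have "((\<lambda>x. D n (m * x + t)) has_real_derivative D (Suc n) (m * x + t) * m) (at x)"
    by (rule DERIV_chain2[where f = "D n"])
       (use assms in \<open>auto simp: deriv_seq_def intro!: derivative_eq_intros\<close>)
  then show "((\<lambda>x. r * m ^ n * D n (m * x + t)) has_real_derivative
      r * m ^ Suc n * D (Suc n) (m * x + t)) (at x)"
    by (auto intro!: derivative_eq_intros)
qed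

lemma deriv_seq_lincomb:
  assumes "deriv_seq D" "deriv_seq E"
  shows "deriv_seq (\<lambda>n x. r * D n x + s * E n x)"
  using assms unfolding deriv_seq_def by (auto intro!: derivative_eq_intros)

lemma deriv_seq_continuous:
  assumes "deriv_seq D"
  shows "continuous_on S (D n)"
  by (rule continuous_on_subset[of UNIV])
     (use assms in \<open>auto simp: deriv_seq_def continuous_on_eq_continuous_at intro: DERIV_isCont\<close>)

lemma continuous_compact_support_integrable:
  fixes f :: "'a::euclidean_space \<Rightarrow> real"
  assumes "continuous_on UNIV f" "\<And>x. x \<notin> K \<Longrightarrow> f x = 0" "compact K"
  shows "integrable lborel f"
proof -
  have "set_integrable lborel K f"
    unfolding set_integrable_def
    by (rule borel_integrable_compact[OF assms(3)]) (use assms in \<open>auto intro: continuous_on_subset\<close>)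
  moreover have "(\<lambda>x. indicator K x *\<^sub>R f x) = f"
    using assms(2) by (auto simp: fun_eq_iff indicator_def)
  ultimately show ?thesis by (simp add: set_integrable_def)
qed

text \<open>The product of \<open>flat 0 (x - a)\<close> and \<open>flat 0 (b - x)\<close> is
  positive exactly on (a, b); Leibniz' rule makes every derivative vanish outside [a, b], and
  division by the integral normalises.\<close>

lemma ex_bump:
  assumes "a < b"
  shows "\<exists>D. deriv_seq D \<and> (\<forall>n x. x \<notin> {a..b} \<longrightarrow> D n x = 0) \<and> integral\<^sup>L lborel (D 0) = 1"
proof -
  \<comment> \<open>The factors 1 and 1 ^ n here, and the summand 0 * E n x in D below, turn these
    into literal instances of \<open>deriv_seq_affine\<close> and
    \<open>deriv_seq_lincomb\<close>.\<close>
  define F where "F n x = 1 * 1 ^ n * flat n (1 * x + (- a))" for n x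
  define G where "G n x = 1 * (-1) ^ n * flat n ((-1) * x + b)" for n x
  define E where "E = leibniz F G"
  have E: "deriv_seq E"
    unfolding E_def F_def G_def by (intro deriv_seq_leibniz deriv_seq_affine flat_deriv_seq)
  have supp: "E n x = 0" if "x \<notin> {a..b}" for n x
  proof -
    from that consider "x < a" | "x > b" by fastforce
    then show ?thesis
    proof cases
      case 1
      then have "F i x = 0" for i by (simp add: F_def flat_def)
      then show ?thesis by (simp add: E_def leibniz_def)
    next
      case 2
      then have "G i x = 0" for i by (simp add: G_def flat_def)
      then show ?thesis by (simp add: E_def leibniz_def)
    qed
  qed
  have E0: "E 0 x = flat 0 (x - a) * flat 0 (b - x)" for x
    by (simp add: E_def leibniz_def F_def G_def)
  have nonneg: "E 0 x \<ge> 0" for x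
    unfolding E0 by (simp add: flat_def)
  have pos: "E 0 x > 0" if "x \<in> {a<..<b}" for x
    using that unfolding E0 by (simp add: flat_def)
  have int: "integrable lborel (E 0)"
    by (rule continuous_compact_support_integrable[where K = "{a..b}"])
       (use E supp in \<open>auto intro: deriv_seq_continuous\<close>)
  define I where "I = integral\<^sup>L lborel (E 0)"
  have "I \<noteq> 0"
  proof
    assume "I = 0"
    then have "AE x in lborel. E 0 x = 0"
      using int nonneg by (simp add: I_def integral_nonneg_eq_0_iff_AE)
    then have "AE x in lborel. x \<notin> {a<..<b}"
      by eventually_elim (use pos in force)
    then have "{a<..<b} \<in> null_sets lborel"
      by (subst AE_iff_null_sets) auto
    then show False using assms by (simp add: null_sets_def)
  qed
  then have "I > 0" using nonneg by (simp add: I_def integral_nonneg less_le)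
  define D where "D n x = (1 / I) * E n x + 0 * E n x" for n x
  show ?thesis
  proof (intro exI[of _ D] conjI allI impI)
    show "deriv_seq D" unfolding D_def by (intro deriv_seq_lincomb E)
    show "integral\<^sup>L lborel (D 0) = 1"
      using \<open>I > 0\<close> by (simp add: D_def[abs_def] I_def[symmetric])
  qed (use supp in \<open>auto simp: D_def\<close>)
qed

lemma ex_antiderivative:
  fixes f :: "real \<Rightarrow> real"
  assumes "continuous_on UNIV f"
  obtains U where "\<And>x. (U has_real_derivative f x) (at x)"
proof -
  define U where "U u = (LBINT y=ereal 0..ereal u. f y)" for u :: real
  have "(U has_real_derivative f x) (at x)" for x
  proof -
    define r where "r = \<bar>x\<bar> + 1"
    have cont: "continuous_on {-r..r} f" and le: "-r \<le> 0" "0 \<le> r" "-r \<le> x" "x \<le> r"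
      using continuous_on_subset[OF assms] by (auto simp: r_def)
    have "(U has_vector_derivative f x) (at x within {-r..r})"
      unfolding U_def by (rule interval_integral_FTC2[OF le(1,2) cont le(3,4)])
    moreover have "at x within {-r..r} = at x"
      by (rule at_within_interior) (auto simp: r_def)
    ultimately show ?thesis
      by (simp add: has_real_derivative_iff_has_vector_derivative)
  qed
  then show thesis by (rule that)
qed

section \<open>Local means\<close>

lemma lborel_integral_affine:
  fixes f :: "'a::euclidean_space \<Rightarrow> real"
  assumes [measurable]: "f \<in> borel_measurable borel" and c: "c \<noteq> 0"
  shows "(\<integral>x. f x \<partial>lborel) = \<bar>c\<bar> ^ DIM('a) * (\<integral>x. f (t + c *\<^sub>R x) \<partial>lborel)"
  by (subst lborel_affine[OF c, of t]) (simp add: integral_density integral_distr)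

text \<open>The majorant |C| |w(x)| |g(y)| has separated variables. This is the licence for Fubini
  in \<open>integral_mult_local_mean\<close>.\<close>

lemma integrable_scaled_product:
  fixes g w :: "'a::euclidean_space \<Rightarrow> real" and h :: "'a \<Rightarrow> 'a \<Rightarrow> real"
  assumes [measurable]: "integrable lborel g" "integrable lborel w"
    and h[measurable]: "(\<lambda>(x, y). h x y) \<in> borel_measurable (lborel \<Otimes>\<^sub>M lborel)"
    and C: "\<And>x y. \<bar>h x y\<bar> \<le> C"
  shows "integrable (lborel \<Otimes>\<^sub>M lborel) (\<lambda>(x, y). w x * h x y * g y)"
proof (rule Bochner_Integration.integrable_bound)
  show "integrable (lborel \<Otimes>\<^sub>M lborel) (\<lambda>p. C * (w (fst p) * g (snd p)))"
  proof (intro integrable_mult_right lborel_pair.Fubini_integrable)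
    show "(\<lambda>p. w (fst p) * g (snd p)) \<in> borel_measurable (lborel \<Otimes>\<^sub>M lborel)"
      by measurable
    show "integrable lborel (\<lambda>x. \<integral>y. norm (w (fst (x, y)) * g (snd (x, y))) \<partial>lborel)"
      using assms by (simp add: abs_mult)
    show "AE x in lborel. integrable lborel (\<lambda>y. w (fst (x, y)) * g (snd (x, y)))"
      using assms by simp
  qed
  show "(\<lambda>(x, y). w x * h x y * g y) \<in> borel_measurable (lborel \<Otimes>\<^sub>M lborel)"
    using h unfolding split_beta' by measurable
  have "\<bar>w x * h x y * g y\<bar> \<le> \<bar>C\<bar> * (\<bar>w x\<bar> * \<bar>g y\<bar>)" for x y
    using mult_right_mono[OF order_trans[OF C[of x y] abs_ge_self], of "\<bar>w x\<bar> * \<bar>g y\<bar>"]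
    by (simp add: abs_mult mult_ac)
  then show "AE p in lborel \<Otimes>\<^sub>M lborel. norm (case p of (x, y) \<Rightarrow> w x * h x y * g y)
      \<le> norm (C * (w (fst p) * g (snd p)))"
    by (auto simp: abs_mult)
qed

text \<open>For \<kappa> supported near c this weights the values of g near x + s c, not near x; the
  division by s^d keeps the total weight equal to the integral of \<kappa>.\<close>

definition local_mean :: "('a::euclidean_space \<Rightarrow> real) \<Rightarrow> real \<Rightarrow> ('a \<Rightarrow> real) \<Rightarrow> 'a \<Rightarrow> real" where
  "local_mean \<kappa> s g x = (\<integral>y. \<kappa> ((1 / s) *\<^sub>R (y - x)) * g y \<partial>lborel) / s ^ DIM('a)"

lemma bounded_continuous_compact_support:
  fixes f :: "'a::euclidean_space \<Rightarrow> real"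
  assumes "continuous_on UNIV f" "\<And>x. x \<notin> K \<Longrightarrow> f x = 0" "compact K"
  obtains C where "C > 0" "\<And>x. \<bar>f x\<bar> \<le> C"
proof -
  have "bounded (f ` K)"
    using assms by (intro compact_imp_bounded compact_continuous_image) (auto intro: continuous_on_subset)
  then obtain C where C: "C > 0" "\<And>x. x \<in> K \<Longrightarrow> \<bar>f x\<bar> \<le> C"
    by (auto simp: bounded_pos)
  then have "\<bar>f x\<bar> \<le> C" for x
    using assms(2)[of x] by (cases "x \<in> K") auto
  with C show thesis using that by blast
qed

text \<open>Fubini and the substitution x = y - s z move the averaging from g, which is merely
  integrable, to w, which can be chosen continuous.\<close>

lemma integral_mult_local_mean:
  fixes g w \<kappa> :: "'a::euclidean_space \<Rightarrow> real"
  assumes g: "integrable lborel g" and w: "integrable lborel w"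
    and [measurable]: "\<kappa> \<in> borel_measurable borel" and C: "\<And>z. \<bar>\<kappa> z\<bar> \<le> C" and "s > 0"
  shows "(\<integral>x. w x * local_mean \<kappa> s g x \<partial>lborel) = (\<integral>y. g y * (\<integral>z. w (y - s *\<^sub>R z) * \<kappa> z \<partial>lborel) \<partial>lborel)"
    and "integrable lborel (\<lambda>x. w x * local_mean \<kappa> s g x)"
proof -
  note [measurable] = borel_measurable_integrable[OF g] borel_measurable_integrable[OF w]
  let ?h = "\<lambda>x y. \<kappa> ((1 / s) *\<^sub>R (y - x))"
  have int: "integrable (lborel \<Otimes>\<^sub>M lborel) (\<lambda>(x, y). w x * ?h x y * g y)"
    by (rule integrable_scaled_product[OF g w _ C]) simp
  have 1: "(\<integral>y. w x * ?h x y * g y \<partial>lborel) = s ^ DIM('a) * (w x * local_mean \<kappa> s g x)" for x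
    using \<open>s > 0\<close> by (simp add: local_mean_def mult.assoc)
  have "integrable lborel (\<lambda>x. \<integral>y. w x * ?h x y * g y \<partial>lborel)"
    using lborel_pair.integrable_fst[OF int] .
  then show "integrable lborel (\<lambda>x. w x * local_mean \<kappa> s g x)"
    using \<open>s > 0\<close> unfolding 1 by simp
  have "s ^ DIM('a) * (\<integral>x. w x * local_mean \<kappa> s g x \<partial>lborel) = (\<integral>x. (\<integral>y. w x * ?h x y * g y \<partial>lborel) \<partial>lborel)"
    by (simp add: 1)
  also have "\<dots> = (\<integral>y. (\<integral>x. w x * ?h x y * g y \<partial>lborel) \<partial>lborel)"
    using lborel_pair.Fubini_integral[OF int] by simp
  also have "(\<lambda>y. \<integral>x. w x * ?h x y * g y \<partial>lborel) = (\<lambda>y. s ^ DIM('a) * (g y * (\<integral>z. w (y - s *\<^sub>R z) * \<kappa> z \<partial>lborel)))"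
  proof
    fix y
    have "(\<integral>x. w x * ?h x y * g y \<partial>lborel) = \<bar>-s\<bar> ^ DIM('a) * (\<integral>z. w (y + (-s) *\<^sub>R z) * ?h (y + (-s) *\<^sub>R z) y * g y \<partial>lborel)"
      by (rule lborel_integral_affine) (use \<open>s > 0\<close> in auto)
    then show "(\<integral>x. w x * ?h x y * g y \<partial>lborel) = s ^ DIM('a) * (g y * (\<integral>z. w (y - s *\<^sub>R z) * \<kappa> z \<partial>lborel))"
      using \<open>s > 0\<close> by simp
  qed
  finally show "(\<integral>x. w x * local_mean \<kappa> s g x \<partial>lborel) = (\<integral>y. g y * (\<integral>z. w (y - s *\<^sub>R z) * \<kappa> z \<partial>lborel) \<partial>lborel)"
    using \<open>s > 0\<close> by simp
qed

text \<open>Once the averaging acts on w, continuity gives pointwise convergence, and dominated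
  convergence is used twice: |\<kappa>| dominates in z, and |g| times the integral of |\<kappa>| in
  y. The absolute values matter because \<kappa> may change sign.\<close>

lemma local_mean_tendsto_weakly:
  fixes g w \<kappa> :: "'a::euclidean_space \<Rightarrow> real"
  assumes g: "integrable lborel g"
    and w: "continuous_on UNIV w" "\<And>x. \<bar>w x\<bar> \<le> 1" "integrable lborel w"
    and \<kappa>: "integrable lborel \<kappa>" "\<And>z. \<bar>\<kappa> z\<bar> \<le> C" "integral\<^sup>L lborel \<kappa> = 1"
    and s: "\<And>n. s n > 0" "s \<longlonglongrightarrow> 0"
  shows "(\<lambda>n. \<integral>x. w x * local_mean \<kappa> (s n) g x \<partial>lborel) \<longlonglongrightarrow> (\<integral>y. g y * w y \<partial>lborel)"
proof -
  note [measurable] = borel_measurable_integrable[OF g] borel_measurable_integrable[OF w(3)]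
    borel_measurable_integrable[OF \<kappa>(1)]
  have inner: "(\<lambda>n. \<integral>z. w (y - s n *\<^sub>R z) * \<kappa> z \<partial>lborel) \<longlonglongrightarrow> w y" for y
  proof -
    have "(\<lambda>n. \<integral>z. w (y - s n *\<^sub>R z) * \<kappa> z \<partial>lborel) \<longlonglongrightarrow> (\<integral>z. w y * \<kappa> z \<partial>lborel)"
    proof (rule integral_dominated_convergence[where w = "\<lambda>z. \<bar>\<kappa> z\<bar>"])
      have "(\<lambda>n. w (y - s n *\<^sub>R z)) \<longlonglongrightarrow> w (y - 0 *\<^sub>R z)" for z
        by (intro isCont_tendsto_compose[of _ w] tendsto_intros s(2))
           (use w(1) in \<open>simp add: continuous_on_eq_continuous_at\<close>)
      then show "AE z in lborel. (\<lambda>n. w (y - s n *\<^sub>R z) * \<kappa> z) \<longlonglongrightarrow> w y * \<kappa> z"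
        by (auto intro!: tendsto_mult_right)
      show "AE z in lborel. norm (w (y - s n *\<^sub>R z) * \<kappa> z) \<le> \<bar>\<kappa> z\<bar>" for n
        using mult_right_mono[OF w(2)] by (auto simp: abs_mult)
    qed (use \<kappa> in auto)
    then show ?thesis using \<kappa>(3) by simp
  qed
  have bnd: "\<bar>\<integral>z. w (y - s n *\<^sub>R z) * \<kappa> z \<partial>lborel\<bar> \<le> (\<integral>z. \<bar>\<kappa> z\<bar> \<partial>lborel)" for n y
  proof -
    have "\<bar>w (y - s n *\<^sub>R z) * \<kappa> z\<bar> \<le> \<bar>\<kappa> z\<bar>" for z
      using mult_right_mono[OF w(2)] by (auto simp: abs_mult)
    moreover from this have "integrable lborel (\<lambda>z. w (y - s n *\<^sub>R z) * \<kappa> z)"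
      by (intro Bochner_Integration.integrable_bound[OF \<kappa>(1)]) auto
    ultimately have "(\<integral>z. \<bar>w (y - s n *\<^sub>R z) * \<kappa> z\<bar> \<partial>lborel) \<le> (\<integral>z. \<bar>\<kappa> z\<bar> \<partial>lborel)"
      using \<kappa>(1) by (intro integral_mono) auto
    then show ?thesis by (rule order_trans[OF integral_abs_bound])
  qed
  have "(\<lambda>n. \<integral>y. g y * (\<integral>z. w (y - s n *\<^sub>R z) * \<kappa> z \<partial>lborel) \<partial>lborel) \<longlonglongrightarrow> (\<integral>y. g y * w y \<partial>lborel)"
  proof (rule integral_dominated_convergence[where w = "\<lambda>y. \<bar>g y\<bar> * (\<integral>z. \<bar>\<kappa> z\<bar> \<partial>lborel)"])
    show "AE y in lborel. (\<lambda>n. g y * (\<integral>z. w (y - s n *\<^sub>R z) * \<kappa> z \<partial>lborel)) \<longlonglongrightarrow> g y * w y"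
      by (auto intro!: tendsto_mult_left inner)
    show "AE y in lborel. norm (g y * (\<integral>z. w (y - s n *\<^sub>R z) * \<kappa> z \<partial>lborel)) \<le> \<bar>g y\<bar> * (\<integral>z. \<bar>\<kappa> z\<bar> \<partial>lborel)" for n
      using mult_left_mono[OF bnd] by (auto simp: abs_mult)
  qed (use g in auto)
  then show ?thesis
    by (subst integral_mult_local_mean[OF g w(3) _ \<kappa>(2) s(1)]) auto
qed

text \<open>Up to a null set, the part of U where g > B is a countable union of compact sets. On
  each of them g - B is positive while its integral is at most 0, so the set is null.\<close>

lemma AE_le_of_compact_integrals:
  fixes g :: "'a::euclidean_space \<Rightarrow> real"
  assumes g: "integrable lborel g" and U: "open U"
    and le: "\<And>K. compact K \<Longrightarrow> K \<subseteq> U \<Longrightarrow> (\<integral>x. indicator K x * g x \<partial>lborel) \<le> B * measure lborel K"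
  shows "AE x in lborel. x \<in> U \<longrightarrow> g x \<le> B"
proof -
  have [measurable]: "g \<in> borel_measurable borel" "U \<in> sets borel"
    using g U by auto
  define E where "E = {x \<in> space borel. x \<in> U \<and> B < g x}"
  have E[measurable]: "E \<in> sets borel" unfolding E_def by measurable
  have K: "K \<in> null_sets lebesgue" if K: "compact K" "K \<subseteq> E" for K
  proof -
    have fin: "emeasure lborel K < \<infinity>"
      by (rule emeasure_compact_finite[OF K(1)])
    have K'[measurable]: "K \<in> sets borel" using K(1) by (simp add: borel_compact)
    have iK: "integrable lborel (\<lambda>x. indicator K x :: real)"
      using fin by simp
    have ig: "integrable lborel (\<lambda>x. indicator K x * g x)"
      by (rule Bochner_Integration.integrable_bound[OF g]) (auto simp: indicator_def)
    have int: "integrable lborel (\<lambda>x. indicator K x * (g x - B))"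
      using Bochner_Integration.integrable_diff[OF ig integrable_mult_right[OF iK, of B]] by (simp add: algebra_simps)
    have nn: "0 \<le> indicator K x * (g x - B)" for x
      using K(2) by (auto simp: indicator_def E_def)
    have "(\<integral>x. indicator K x * (g x - B) \<partial>lborel) = (\<integral>x. indicator K x * g x \<partial>lborel) - B * measure lborel K"
      using ig iK fin by (subst right_diff_distrib, subst Bochner_Integration.integral_diff) (auto simp: mult.commute)
    also have "\<dots> \<le> 0" using le[OF K(1)] K(2) by (auto simp: E_def)
    finally have "(\<integral>x. indicator K x * (g x - B) \<partial>lborel) = 0"
      using nn by (intro antisym integral_nonneg) auto
    then have "AE x in lborel. indicator K x * (g x - B) = 0"
      using int nn by (subst (asm) integral_nonneg_eq_0_iff_AE) auto
    then have "AE x in lborel. x \<notin> K"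
      by eventually_elim (use K(2) in \<open>auto simp: indicator_def E_def split: if_splits\<close>)
    then show ?thesis
      by (subst (asm) AE_iff_null_sets[symmetric]) (auto intro: null_sets_completionI)
  qed
  obtain C T where CT: "fsigma C" "T \<in> null_sets lebesgue" "C \<union> T = E" "disjnt C T"
    using lebesgue_set_almost_fsigma[of E] E by (metis sets_completionI_sets sets_lborel)
  from CT(1) obtain F :: "nat \<Rightarrow> 'a set" where F: "\<And>n. compact (F n)" "C = \<Union>(range F)"
    by (auto simp: fsigma_Union_compact image_subset_iff)
  have "F n \<in> null_sets lebesgue" for n
    using F CT by (intro K) auto
  then have "C \<in> null_sets lebesgue" unfolding F(2) by auto
  then have "E \<in> null_sets lebesgue" using CT by (metis null_sets.Un)
  then have "E \<in> null_sets lborel"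
    using E by (simp add: null_sets_def)
  then have "AE x in lborel. x \<notin> E" by (rule AE_not_in)
  then show ?thesis by eventually_elim (auto simp: E_def)
qed

text \<open>This plays the role of Lebesgue differentiation: the bound is integrated against a
  continuous w \<ge> 0 supported in U, passes to the weak limit, and w is then shrunk to the
  indicator of a compact set.\<close>

lemma AE_bounded_by_local_mean_le:
  fixes g \<kappa> :: "'a::euclidean_space \<Rightarrow> real"
  assumes g: "integrable lborel g" and U: "open U"
    and \<kappa>: "integrable lborel \<kappa>" "\<And>z. \<bar>\<kappa> z\<bar> \<le> C" "integral\<^sup>L lborel \<kappa> = 1"
    and s: "\<And>n. s n > 0" "s \<longlonglongrightarrow> 0"
    and bound: "\<And>n x. x \<in> U \<Longrightarrow> local_mean \<kappa> (s n) g x \<le> B"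
  shows "AE x in lborel. x \<in> U \<longrightarrow> g x \<le> B"
proof (rule AE_le_of_compact_integrals[OF g U])
  fix K assume K: "compact K" "K \<subseteq> U"
  note [measurable] = borel_measurable_integrable[OF g] borel_measurable_integrable[OF \<kappa>(1)]
  show "(\<integral>x. indicator K x * g x \<partial>lborel) \<le> B * measure lborel K"
  proof (cases "K = {}")
    case False
    obtain e where e: "e > 0" "{x. infdist x K \<le> e} \<subseteq> U"
      using compact_in_open_separated[OF False K(1) U K(2)] by auto
    have cK: "compact {x. infdist x K \<le> e}"
      using compact_infdist_le[OF False K(1) e(1)] .
    \<comment> \<open>Equal to 1 on K and to 0 at distance e / (n + 1) or more, so every w n lives
      in the e-neighbourhood inside U, where \<open>bound\<close> applies.\<close>
    define w where "w n x = max 0 (1 - (real n + 1) / e * infdist x K)" for n x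
    have cont: "continuous_on UNIV (w n)" for n
      unfolding w_def by (intro continuous_intros)
    then have [measurable]: "w n \<in> borel_measurable borel" for n
      by (rule borel_measurable_continuous_onI)
    have w01: "0 \<le> w n x" "w n x \<le> 1" for n x
      using e(1) infdist_nonneg[of x K] by (auto simp: w_def)
    have supp: "w n x = 0" if "x \<notin> {x. infdist x K \<le> e}" for n x
    proof -
      have "(real n + 1) / e * infdist x K \<ge> 1 / e * e"
        using that e(1) by (intro mult_mono divide_right_mono) auto
      then show ?thesis using e(1) by (simp add: w_def)
    qed
    have iw: "integrable lborel (w n)" for n
      by (rule continuous_compact_support_integrable[OF cont supp cK])
    have lim: "(\<lambda>n. w n x) \<longlonglongrightarrow> indicator K x" for x
    proof (cases "x \<in> K")
      case True
      then show ?thesis by (simp add: w_def)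
    next
      case notK: False
      then have pos: "infdist x K > 0"
        using in_closed_iff_infdist_zero[OF compact_imp_closed[OF K(1)] False] infdist_nonneg[of x K]
        by (simp add: less_le)
      have "\<forall>\<^sub>F n in sequentially. real n \<ge> e / infdist x K"
        using eventually_ge_at_top[of "nat \<lceil>e / infdist x K\<rceil>"] by eventually_elim linarith
      then have "\<forall>\<^sub>F n in sequentially. w n x = 0"
      proof eventually_elim
        case (elim n)
        then have "e \<le> (real n + 1) * infdist x K" using pos by (simp add: field_simps)
        then show ?case using e(1) by (simp add: w_def field_simps)
      qed
      then show ?thesis using notK by (auto intro: tendsto_eventually)
    qed
    have le: "(\<integral>x. g x * w m x \<partial>lborel) \<le> B * (\<integral>x. w m x \<partial>lborel)" for m
    proof (rule LIMSEQ_le_const2)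
      show "(\<lambda>n. \<integral>x. w m x * local_mean \<kappa> (s n) g x \<partial>lborel) \<longlonglongrightarrow> (\<integral>x. g x * w m x \<partial>lborel)"
        by (rule local_mean_tendsto_weakly[OF g cont _ iw \<kappa> s]) (use w01 in auto)
      have "(\<integral>x. w m x * local_mean \<kappa> (s n) g x \<partial>lborel) \<le> (\<integral>x. B * w m x \<partial>lborel)" for n
      proof (rule integral_mono)
        show "integrable lborel (\<lambda>x. w m x * local_mean \<kappa> (s n) g x)"
          by (rule integral_mult_local_mean(2)[OF g iw _ \<kappa>(2) s(1)]) simp
        show "w m x * local_mean \<kappa> (s n) g x \<le> B * w m x" for x
        proof (cases "x \<in> U")
          case True
          then show ?thesis
            using mult_left_mono[OF bound[of x n] w01(1)[of m x]] by (simp add: mult.commute)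
        next
          case False
          then have "w m x = 0" using e(2) by (intro supp) auto
          then show ?thesis by simp
        qed
      qed (use iw in auto)
      then show "\<exists>N. \<forall>n\<ge>N. (\<integral>x. w m x * local_mean \<kappa> (s n) g x \<partial>lborel) \<le> B * (\<integral>x. w m x \<partial>lborel)"
        by simp
    qed
    have K'[measurable]: "K \<in> sets borel" using K(1) by (simp add: borel_compact)
    have "(\<lambda>m. \<integral>x. g x * w m x \<partial>lborel) \<longlonglongrightarrow> (\<integral>x. g x * indicator K x \<partial>lborel)"
    proof (rule integral_dominated_convergence[where w = "\<lambda>x. \<bar>g x\<bar>"])
      show "AE x in lborel. norm (g x * w n x) \<le> \<bar>g x\<bar>" for n
        using mult_left_mono[OF w01(2), of "\<bar>g _\<bar>"] w01(1) by (auto simp: abs_mult)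
    qed (use g lim in \<open>auto intro!: tendsto_mult_left\<close>)
    moreover have "(\<lambda>m. \<integral>x. w m x \<partial>lborel) \<longlonglongrightarrow> (\<integral>x. indicator K x \<partial>lborel)"
    proof (rule integral_dominated_convergence[where w = "\<lambda>x. indicator {x. infdist x K \<le> e} x"])
      show "integrable lborel (\<lambda>x. indicat_real {x. infdist x K \<le> e} x)"
        using emeasure_compact_finite[OF cK] cK by (simp add: borel_compact)
      show "AE x in lborel. norm (w n x) \<le> indicat_real {x. infdist x K \<le> e} x" for n
        using w01 supp by (auto simp: indicator_def)
    qed (use lim in auto)
    ultimately have "(\<integral>x. g x * indicator K x \<partial>lborel) \<le> B * (\<integral>x. indicator K x \<partial>lborel)"
      using le by (intro LIMSEQ_le[OF _ tendsto_mult_left]) auto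
    then show ?thesis using emeasure_compact_finite[OF K(1)] by (simp add: mult.commute)
  qed simp
qed

section \<open>Kernels with vanishing moments\<close>

text \<open>A centre and a radius instead of an interval about 0: dilations drag the support towards
  0, and the radius has to absorb the drift.\<close>

definition supported_near :: "real \<Rightarrow> real \<Rightarrow> (nat \<Rightarrow> real \<Rightarrow> real) \<Rightarrow> bool" where
  "supported_near c \<rho> D \<longleftrightarrow> (\<forall>n y. \<rho> < \<bar>y - c\<bar> \<longrightarrow> D n y = 0)"

text \<open>One-sided forms of |l t - c| \<le> l |t - c| + (1 - l) |c| at t = y / l, by
  contraposition. The two sides of c are kept apart because \<open>ex_dilation_primitive\<close> has
  to know on which side y / l lies.\<close>

lemma dilation_far:
  fixes l c y \<rho> :: real
  assumes "0 < l" "l < 1" "0 \<le> \<rho>"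
  shows "c + (\<rho> + (1 - l) * \<bar>c\<bar>) < y \<Longrightarrow> c + \<rho> < y / l"
    and "y < c - (\<rho> + (1 - l) * \<bar>c\<bar>) \<Longrightarrow> y / l < c - \<rho>"
proof -
  have 1: "l * \<rho> \<le> \<rho>" "(1 - l) * c \<le> (1 - l) * \<bar>c\<bar>" "(1 - l) * (-c) \<le> (1 - l) * \<bar>c\<bar>"
    using assms mult_left_mono[of c "\<bar>c\<bar>" "1 - l"] mult_left_mono[of "- c" "\<bar>c\<bar>" "1 - l"]
    by (auto simp: mult_left_le_one_le)
  show "c + (\<rho> + (1 - l) * \<bar>c\<bar>) < y \<Longrightarrow> c + \<rho> < y / l"
    using 1 assms by (simp only: pos_less_divide_eq) (simp add: algebra_simps)
  show "y < c - (\<rho> + (1 - l) * \<bar>c\<bar>) \<Longrightarrow> y / l < c - \<rho>"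
    using 1 assms by (simp only: pos_divide_less_eq) (simp add: algebra_simps)
qed

lemma supported_near_dilation:
  assumes "supported_near c \<rho> D" "0 < l" "l < 1" "0 \<le> \<rho>"
    "\<rho> + (1 - l) * \<bar>c\<bar> < \<bar>y - c\<bar>"
  shows "D n (y / l) = 0" "D n y = 0"
proof -
  have "(1 - l) * \<bar>c\<bar> \<ge> 0" using assms by simp
  then have "\<rho> < \<bar>y - c\<bar>" using assms(5) by linarith
  then show "D n y = 0" using assms(1) by (auto simp: supported_near_def)
  have "\<rho> < \<bar>y / l - c\<bar>"
    using assms(5) dilation_far(1)[OF assms(2-4), of c y] dilation_far(2)[OF assms(2-4), of y c] by linarith
  then show "D n (y / l) = 0" using assms(1) by (auto simp: supported_near_def)
qed

text \<open>Let U' = D 0. Then U(y / l) - U(y) is an antiderivative of the dilation of D 0 minus D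
  0. U is constant to the left and to the right of the support, possibly with different constants,
  but y and y / l lie on the same side once y is far from c; this makes the antiderivative compactly
  supported.\<close>

lemma ex_dilation_primitive:
  assumes D: "deriv_seq D" and supp: "supported_near c \<rho> D" and l: "0 < l" "l < 1" and "0 \<le> \<rho>"
  obtains W where "deriv_seq W" "supported_near c (\<rho> + (1 - l) * \<bar>c\<bar>) W"
    "\<And>n y. W (Suc n) y = D n (y / l) / l ^ Suc n - D n y"
proof -
  obtain U where U: "\<And>x. (U has_real_derivative D 0 x) (at x)"
    using ex_antiderivative[OF deriv_seq_continuous[OF D]] by blast
  define E where "E n = (case n of 0 \<Rightarrow> U | Suc m \<Rightarrow> D m)" for n
  have E: "deriv_seq E"
    using U D by (auto simp: deriv_seq_def E_def split: nat.split)
  define W where "W n y = 1 * (1 * (1 / l) ^ n * E n ((1 / l) * y + 0)) + (-1) * E n y" for n y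
  have W0: "W 0 y = U (y / l) - U y" and WS: "W (Suc n) y = D n (y / l) / l ^ Suc n - D n y" for n y
    by (auto simp: W_def E_def power_one_over divide_simps)
  have const: "U x = U y" if xy: "x \<in> S" "y \<in> S" and S: "S = {c + \<rho><..} \<or> S = {..<c - \<rho>}" for x y S
  proof -
    have "(U has_real_derivative 0) (at t within S)" if "t \<in> S" for t
    proof -
      have "\<rho> < \<bar>t - c\<bar>" using that S by auto
      then have "D 0 t = 0" using supp by (auto simp: supported_near_def)
      then show ?thesis using U[of t] by (auto intro: has_field_derivative_at_within)
    qed
    moreover have "convex S" using S by auto
    ultimately obtain k where "\<And>x. x \<in> S \<Longrightarrow> U x = k"
      using has_field_derivative_zero_constant by metis
    then show ?thesis using xy by simp
  qed
  show thesis
  proof (rule that[of W])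
    show "deriv_seq W"
      unfolding W_def by (intro deriv_seq_lincomb deriv_seq_affine E)
    show "supported_near c (\<rho> + (1 - l) * \<bar>c\<bar>) W"
      unfolding supported_near_def
    proof (intro allI impI)
      fix n y assume far: "\<rho> + (1 - l) * \<bar>c\<bar> < \<bar>y - c\<bar>"
      show "W n y = 0"
      proof (cases n)
        case 0
        have nn: "(1 - l) * \<bar>c\<bar> \<ge> 0" using l by simp
        have "U (y / l) = U y"
        proof (cases "c < y")
          case True
          then have "c + (\<rho> + (1 - l) * \<bar>c\<bar>) < y" using far by linarith
          then show ?thesis
            using nn dilation_far(1)[OF l \<open>0 \<le> \<rho>\<close>, of c y] by (intro const[of _ "{c + \<rho><..}"]) auto
        next
          case False
          then have "y < c - (\<rho> + (1 - l) * \<bar>c\<bar>)" using far by linarith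
          then show ?thesis
            using nn dilation_far(2)[OF l \<open>0 \<le> \<rho>\<close>, of y c] by (intro const[of _ "{..<c - \<rho>}"]) auto
        qed
        then show ?thesis using 0 W0 by simp
      next
        case (Suc m)
        then show ?thesis
          using supported_near_dilation[OF supp l \<open>0 \<le> \<rho>\<close> far] WS by simp
      qed
    qed
  qed (rule WS)
qed

lemma supported_near_mono:
  "supported_near c \<rho> D \<Longrightarrow> \<rho> \<le> \<rho>' \<Longrightarrow> supported_near c \<rho>' D"
  by (auto simp: supported_near_def)

lemma deriv_seq_integrable:
  assumes "deriv_seq D" "supported_near c \<rho> D"
  shows "integrable lborel (D n)"
  by (rule continuous_compact_support_integrable[where K = "{c - \<rho>..c + \<rho>}"])
     (use assms in \<open>auto simp: supported_near_def intro!: deriv_seq_continuous\<close>)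

lemma lborel_integral_dilation:
  fixes f :: "real \<Rightarrow> real"
  assumes "0 < l"
  shows "(\<integral>x. f (x / l) / l \<partial>lborel) = integral\<^sup>L lborel f"
  using lborel_integral_real_affine[of "1 / l" f 0] assms by simp

text \<open>
  The dilation \<open>u \<mapsto> u (\<cdot> / l) / l\<close> multiplies the \<open>j\<close>-th moment of \<open>u\<close> by \<open>l\<^sup>j\<close>.  Each step of the induction
  removes one more moment of \<open>K\<close>, so that the difference of \<open>K\<close> and its dilation becomes the
  derivative of higher order of a compactly supported function.
\<close>

lemma ex_kernel_pair:
  assumes "0 < l" "l < 1" "0 < \<rho>"
  shows "\<exists>K Z. deriv_seq K \<and> deriv_seq Z \<and>
    supported_near c (\<rho> + real (Suc k) * ((1 - l) * \<bar>c\<bar>)) K \<and>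
    supported_near c (\<rho> + real (Suc k) * ((1 - l) * \<bar>c\<bar>)) Z \<and>
    integral\<^sup>L lborel (K 0) = 1 \<and> (\<forall>y. K 0 y - K 0 (y / l) / l = Z (Suc k) y)"
proof (induction k)
  case 0
  obtain D where D: "deriv_seq D" "\<And>n x. x \<notin> {c - \<rho>..c + \<rho>} \<Longrightarrow> D n x = 0"
    "integral\<^sup>L lborel (D 0) = 1"
    using ex_bump[of "c - \<rho>" "c + \<rho>"] assms(3) by auto
  have supp: "supported_near c \<rho> D"
    unfolding supported_near_def by (intro allI impI D(2)) auto
  obtain W where W: "deriv_seq W" "supported_near c (\<rho> + (1 - l) * \<bar>c\<bar>) W"
    "\<And>n y. W (Suc n) y = D n (y / l) / l ^ Suc n - D n y"
    using ex_dilation_primitive[OF D(1) supp assms(1,2)] assms(3) by auto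
  define Z where "Z n y = (-1) * W n y + 0 * W n y" for n y
  have "deriv_seq Z" unfolding Z_def by (intro deriv_seq_lincomb W(1))
  moreover have "supported_near c (\<rho> + (1 - l) * \<bar>c\<bar>) Z"
    using W(2) by (auto simp: supported_near_def Z_def)
  moreover have "supported_near c (\<rho> + (1 - l) * \<bar>c\<bar>) D"
    by (rule supported_near_mono[OF supp]) (use assms in auto)
  moreover have "\<forall>y. D 0 y - D 0 (y / l) / l = Z (Suc 0) y"
    using W(3) by (simp add: Z_def)
  ultimately show ?case using D(1,3) by (intro exI[of _ D] exI[of _ Z]) auto
next
  case (Suc k)
  \<comment> \<open>Each round of the induction costs one more drift (1 - l) |c| of the
    support.\<close>
  define r where "r = \<rho> + real (Suc k) * ((1 - l) * \<bar>c\<bar>)"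
  have r: "0 \<le> r" "\<rho> + real (Suc (Suc k)) * ((1 - l) * \<bar>c\<bar>) = r + (1 - l) * \<bar>c\<bar>"
    using assms unfolding r_def
    by (intro add_nonneg_nonneg mult_nonneg_nonneg; simp) (simp add: algebra_simps)
  obtain K Z where K: "deriv_seq K" and Z: "deriv_seq Z"
    and sK: "supported_near c r K" and sZ: "supported_near c r Z"
    and int: "integral\<^sup>L lborel (K 0) = 1"
    and eq: "\<And>y. K 0 y - K 0 (y / l) / l = Z (Suc k) y"
    using Suc.IH unfolding r_def by blast
  obtain W where W: "deriv_seq W" "supported_near c (r + (1 - l) * \<bar>c\<bar>) W"
    "\<And>n y. W (Suc n) y = Z n (y / l) / l ^ Suc n - Z n y"
    using ex_dilation_primitive[OF Z sZ assms(1,2) r(1)] by auto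
  \<comment> \<open>The dilation multiplies the moment of order k + 1 by m, so the dilation of K
    minus m K has none, and division by 1 - m restores the integral 1. The same m turns the factor 1
    / l ^ (k + 2) in W into the 1 / l of a dilation.\<close>
  define m where "m = l ^ Suc k"
  have m: "0 < m" "m < 1"
    using assms by (auto simp: m_def simp del: power_Suc intro: power_Suc_less_one)
  define K' where "K' n y = (1 / (1 - m)) * ((1 / l) * (1 / l) ^ n * K n ((1 / l) * y + 0)) + (- m / (1 - m)) * K n y" for n y
  define Z' where "Z' n y = (m / (1 - m)) * W n y + 0 * W n y" for n y
  have K'_eq: "K' 0 y = (K 0 (y / l) / l - m * K 0 y) / (1 - m)" for y
    by (simp add: K'_def diff_divide_distrib)
  have "deriv_seq K'"
    unfolding K'_def by (intro deriv_seq_lincomb deriv_seq_affine K)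
  moreover have "deriv_seq Z'"
    unfolding Z'_def by (intro deriv_seq_lincomb W)
  moreover have "supported_near c (r + (1 - l) * \<bar>c\<bar>) K'"
    unfolding supported_near_def K'_def
    using supported_near_dilation[OF sK assms(1,2) r(1)] by simp
  moreover have "supported_near c (r + (1 - l) * \<bar>c\<bar>) Z'"
    using W(2) by (auto simp: supported_near_def Z'_def)
  moreover have "integral\<^sup>L lborel (K' 0) = 1"
  proof -
    have iK: "integrable lborel (K 0)" by (rule deriv_seq_integrable[OF K sK])
    have iK': "integrable lborel (\<lambda>x. K 0 (x / l) / l)"
      using lborel_integrable_real_affine[OF iK, of "1 / l" 0] assms(1) by simp
    have "integral\<^sup>L lborel (K' 0) = (\<integral>y. (K 0 (y / l) / l - m * K 0 y) / (1 - m) \<partial>lborel)"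
      by (intro Bochner_Integration.integral_cong) (auto simp: K'_eq)
    also have "\<dots> = ((\<integral>y. K 0 (y / l) / l \<partial>lborel) - m * (\<integral>y. K 0 y \<partial>lborel)) / (1 - m)"
      using iK iK' by (simp del: integral_divide_zero add: Bochner_Integration.integral_diff integral_divide_zero[where c = "1 - m"])
    also have "\<dots> = 1" using m lborel_integral_dilation[OF assms(1), of "K 0"] int by simp
    finally show ?thesis .
  qed
  moreover have "\<forall>y. K' 0 y - K' 0 (y / l) / l = Z' (Suc (Suc k)) y"
  proof
    fix y
    have "K' 0 y - K' 0 (y / l) / l =
        ((K 0 (y / l) - K 0 (y / l / l) / l) / l - m * (K 0 y - K 0 (y / l) / l)) / (1 - m)"
      using m assms(1) by (simp add: K'_eq divide_simps) (simp add: algebra_simps)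
    also have "\<dots> = (Z (Suc k) (y / l) / l - m * Z (Suc k) y) / (1 - m)"
      by (simp only: eq)
    also have "\<dots> = Z' (Suc (Suc k)) y"
      unfolding Z'_def W(3) using m assms(1)
      by (simp add: m_def divide_simps)
    finally show "K' 0 y - K' 0 (y / l) / l = Z' (Suc (Suc k)) y" .
  qed
  ultimately show ?case unfolding r(2) by blast
qed

section \<open>Products of functions of one variable as test functions\<close>

text \<open>\<open>m\<close> selects one entry of the sequence \<open>D i\<close> for each
  coordinate. For sequences with \<open>deriv_seq\<close> this is the partial derivative with
  multi-index m of the product with m = 0.\<close>

definition prod_fun :: "('n \<Rightarrow> nat \<Rightarrow> real \<Rightarrow> real) \<Rightarrow> ('n \<Rightarrow> nat) \<Rightarrow> real^'n \<Rightarrow> real" where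
  "prod_fun D m x = (\<Prod>i\<in>UNIV. D i (m i) (x $ i))"

lemma prod_fun_has_derivative:
  fixes D :: "'n::finite \<Rightarrow> nat \<Rightarrow> real \<Rightarrow> real"
  assumes "\<And>i. deriv_seq (D i)"
  shows "(prod_fun D m has_derivative
    (\<lambda>y. \<Sum>i\<in>UNIV. (y $ i * D i (Suc (m i)) (x $ i)) * (\<Prod>j\<in>UNIV - {i}. D j (m j) (x $ j)))) (at x)"
  unfolding prod_fun_def[abs_def]
proof (rule has_derivative_prod)
  fix i
  have "(D i (m i) has_real_derivative D i (Suc (m i)) (x $ i)) (at (x $ i))"
    using assms by (auto simp: deriv_seq_def)
  then have "(D i (m i) has_derivative (*) (D i (Suc (m i)) (x $ i))) (at (x $ i))"
    by (simp add: has_field_derivative_def)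
  moreover have "((\<lambda>x. x $ i) has_derivative (\<lambda>y. y $ i)) (at x)"
    by (simp add: bounded_linear_imp_has_derivative bounded_linear_vec_nth)
  ultimately show "((\<lambda>x. D i (m i) (x $ i)) has_derivative (\<lambda>y. y $ i * D i (Suc (m i)) (x $ i))) (at x)"
    using has_derivative_compose[of "\<lambda>x. x $ i" "\<lambda>y. y $ i" x UNIV "D i (m i)" "(*) (D i (Suc (m i)) (x $ i))"]
    by (simp add: mult.commute)
qed

lemma partial_deriv_prod_fun:
  fixes D :: "'n::finite \<Rightarrow> nat \<Rightarrow> real \<Rightarrow> real"
  assumes "\<And>i. deriv_seq (D i)"
  shows "partial_deriv j (prod_fun D m) = prod_fun D (m(j := Suc (m j)))"
proof
  fix x
  have "partial_deriv j (prod_fun D m) x =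
      (\<Sum>i\<in>UNIV. (axis j 1 $ i * D i (Suc (m i)) (x $ i)) * (\<Prod>j\<in>UNIV - {i}. D j (m j) (x $ j)))"
    by (simp add: partial_deriv_def frechet_derivative_at[OF prod_fun_has_derivative[of D, OF assms], symmetric])
  also have "\<dots> = (\<Sum>i\<in>UNIV. if i = j then D j (Suc (m j)) (x $ j) * (\<Prod>j\<in>UNIV - {j}. D j (m j) (x $ j)) else 0)"
    by (intro sum.cong) (auto simp: axis_def)
  also have "\<dots> = D j (Suc (m j)) (x $ j) * (\<Prod>j\<in>UNIV - {j}. D j (m j) (x $ j))" by simp
  also have "\<dots> = prod_fun D (m(j := Suc (m j))) x"
    unfolding prod_fun_def by (subst prod.remove[of UNIV j]) (auto intro: prod.cong)
  finally show "partial_deriv j (prod_fun D m) x = prod_fun D (m(j := Suc (m j))) x" .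
qed

lemma iter_partial_prod_fun:
  fixes D :: "'n::finite \<Rightarrow> nat \<Rightarrow> real \<Rightarrow> real"
  assumes "\<And>i. deriv_seq (D i)"
  shows "iter_partial is (prod_fun D (\<lambda>_. 0)) = prod_fun D (count_list is)"
proof (induction "is")
  case Nil
  then show ?case by (simp add: iter_partial_def)
next
  case (Cons a "is")
  have "iter_partial (a # is) (prod_fun D (\<lambda>_. 0)) = partial_deriv a (prod_fun D (count_list is))"
    using Cons by (simp add: iter_partial_def)
  also have "\<dots> = prod_fun D ((count_list is)(a := Suc (count_list is a)))"
    by (rule partial_deriv_prod_fun[of D, OF assms])
  also have "(count_list is)(a := Suc (count_list is a)) = count_list (a # is)"
    by (auto simp: fun_eq_iff)
  finally show ?case .
qed

text \<open>\<open>multi_deriv\<close> differentiates along an unknown list chosen by SOME; for a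
  product only the multiplicities in the list matter. The second assumption exhibits one such list,
  which makes the choice legitimate.\<close>

lemma multi_deriv_prod_fun:
  fixes D :: "'n::finite \<Rightarrow> nat \<Rightarrow> real \<Rightarrow> real"
  assumes "\<And>i. deriv_seq (D i)" "\<And>i. count_list is i = a i"
  shows "multi_deriv a (prod_fun D (\<lambda>_. 0)) = prod_fun D a"
proof -
  define js where "js = (SOME is. \<forall>i. count_list is i = a i)"
  have "\<forall>i. count_list js i = a i"
    unfolding js_def by (rule someI[of _ "is"]) (use assms in auto)
  then have "count_list js = a" by auto
  then show ?thesis
    unfolding multi_deriv_def js_def[symmetric] by (simp add: iter_partial_prod_fun[of D, OF assms(1)])
qed

lemma count_list_replicate_single:
  "count_list (replicate k j) i = (if i = j then k else 0)"
  by (cases "i = j"; induction k) auto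

lemma smooth_prod_fun:
  fixes D :: "'n::finite \<Rightarrow> nat \<Rightarrow> real \<Rightarrow> real"
  assumes "\<And>i. deriv_seq (D i)"
  shows "smooth (prod_fun D (\<lambda>_. 0))"
  unfolding smooth_def iter_partial_prod_fun[of D, OF assms]
proof (intro allI)
  fix "is" x
  show "prod_fun D (count_list is) differentiable at x"
    by (rule differentiableI[OF prod_fun_has_derivative[of D "count_list is" x, OF assms]])
qed

lemma continuous_prod_fun:
  fixes D :: "'n::finite \<Rightarrow> nat \<Rightarrow> real \<Rightarrow> real"
  assumes "\<And>i. deriv_seq (D i)"
  shows "continuous_on S (prod_fun D m)"
proof (rule continuous_at_imp_continuous_on, rule ballI)
  fix x
  show "isCont (prod_fun D m) x"
    using prod_fun_has_derivative[of D m x, OF assms] by (rule has_derivative_continuous)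
qed

lemma prod_fun_eq_0:
  fixes D :: "'n::finite \<Rightarrow> nat \<Rightarrow> real \<Rightarrow> real"
  assumes "\<And>i. supported_near (c $ i) \<rho> (D i)" "x \<notin> cbox (c - (\<chi> i. \<rho>)) (c + (\<chi> i. \<rho>))"
  shows "prod_fun D m x = 0"
proof -
  from assms(2) obtain i where "\<not> (c $ i - \<rho> \<le> x $ i \<and> x $ i \<le> c $ i + \<rho>)"
    by (auto simp: mem_box_cart)
  then have "\<rho> < \<bar>x $ i - c $ i\<bar>" by linarith
  then have "D i (m i) (x $ i) = 0" using assms(1) by (auto simp: supported_near_def)
  then show ?thesis unfolding prod_fun_def by (intro prod_zero) auto
qed

text \<open>Factors of the product shifted to x and shrunk by s; the chain rule contributes (1 / s)
  ^ n. The shape is that of \<open>deriv_seq_affine\<close>.\<close>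

definition rescale :: "real \<Rightarrow> real^'n \<Rightarrow> ('n \<Rightarrow> nat \<Rightarrow> real \<Rightarrow> real) \<Rightarrow> 'n \<Rightarrow> nat \<Rightarrow> real \<Rightarrow> real" where
  "rescale s x D i n t = 1 * (1 / s) ^ n * D i n ((1 / s) * t + - x $ i / s)"

lemma deriv_seq_rescale: "deriv_seq (D i) \<Longrightarrow> deriv_seq (rescale s x D i)"
  unfolding rescale_def by (rule deriv_seq_affine)

lemma prod_fun_rescale:
  fixes D :: "'n::finite \<Rightarrow> nat \<Rightarrow> real \<Rightarrow> real"
  shows "prod_fun (rescale s x D) m y = prod_fun D m ((1 / s) *\<^sub>R (y - x)) / s ^ (\<Sum>i\<in>UNIV. m i)"
proof -
  have "prod_fun (rescale s x D) m y = (\<Prod>i\<in>UNIV. (1 / s) ^ m i * D i (m i) (((1 / s) *\<^sub>R (y - x)) $ i))"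
    unfolding prod_fun_def rescale_def
    by (intro prod.cong refl) (simp add: diff_divide_distrib)
  also have "\<dots> = (1 / s) ^ (\<Sum>i\<in>UNIV. m i) * prod_fun D m ((1 / s) *\<^sub>R (y - x))"
    by (simp only: prod.distrib prod_fun_def power_sum)
  finally show ?thesis by (simp add: power_one_over)
qed

lemma test_function_prod_fun_rescale:
  fixes D :: "'n::finite \<Rightarrow> nat \<Rightarrow> real \<Rightarrow> real"
  assumes D: "\<And>i. deriv_seq (D i)" "\<And>i. supported_near (c $ i) \<rho> (D i)"
    and "s > 0" and M: "\<And>z. z \<in> cbox (c - (\<chi> i. \<rho>)) (c + (\<chi> i. \<rho>)) \<Longrightarrow> x + s *\<^sub>R z \<in> M"
  shows "test_function M (prod_fun (rescale s x D) (\<lambda>_. 0))"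
proof -
  let ?w = "prod_fun (rescale s x D) (\<lambda>_. 0)"
  define K where "K = (\<lambda>z. x + s *\<^sub>R z) ` cbox (c - (\<chi> i. \<rho>)) (c + (\<chi> i. \<rho>))"
  have K: "compact K" unfolding K_def
    by (intro compact_continuous_image continuous_intros compact_cbox)
  have "{y. ?w y \<noteq> 0} \<subseteq> K"
  proof (intro subsetI CollectI)
    fix y assume "y \<in> {y. ?w y \<noteq> 0}"
    then have "prod_fun D (\<lambda>_. 0) ((1 / s) *\<^sub>R (y - x)) \<noteq> 0"
      by (simp add: prod_fun_rescale)
    then have "(1 / s) *\<^sub>R (y - x) \<in> cbox (c - (\<chi> i. \<rho>)) (c + (\<chi> i. \<rho>))"
      using prod_fun_eq_0[OF D(2)] by blast
    moreover have "y = x + s *\<^sub>R ((1 / s) *\<^sub>R (y - x))" using \<open>s > 0\<close> by simp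
    ultimately show "y \<in> K" unfolding K_def by blast
  qed
  then have cl: "closure {y. ?w y \<noteq> 0} \<subseteq> K"
    using K by (simp add: closure_minimal compact_imp_closed)
  then have "compact (closure {y. ?w y \<noteq> 0})"
    using closed_Int_compact[OF closed_closure K, of "{y. ?w y \<noteq> 0}"] by (simp only: Int_absorb2)
  moreover have "K \<subseteq> M" using M by (auto simp: K_def)
  moreover have "smooth ?w" by (intro smooth_prod_fun deriv_seq_rescale D)
  ultimately show ?thesis using cl by (auto simp: test_function_def)
qed

lemma lborel_integral_prod_cart:
  fixes f :: "'n::finite \<Rightarrow> real \<Rightarrow> real"
  assumes int: "\<And>i. integrable lborel (f i)"
  shows "(\<integral>x. (\<Prod>i\<in>UNIV. f i (x $ i)) \<partial>(lborel :: (real^'n) measure)) = (\<Prod>i\<in>UNIV. integral\<^sup>L lborel (f i))"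
proof -
  interpret product_sigma_finite "\<lambda>_::real^'n. lborel :: real measure"
    by standard
  \<comment> \<open>\<open>lborel_eq\<close> presents the measure as a product over the set
    \<open>Basis\<close>; \<open>ix\<close> translates basis vectors back to indices.\<close>
  define ix :: "real^'n \<Rightarrow> 'n" where "ix b = (THE i. b = axis i 1)" for b
  have ix: "ix (axis i 1) = i" for i
    unfolding ix_def by (rule the_equality) (auto simp: axis_eq_axis)
  have bij: "bij_betw (\<lambda>i. axis i 1) (UNIV :: 'n set) (Basis :: (real^'n) set)"
    by (auto simp: bij_betw_def inj_on_def axis_eq_axis Basis_vec_def)
  have [measurable]: "f i \<in> borel_measurable borel" for i
    using borel_measurable_integrable[OF int] by simp
  have coord: "(\<Sum>b\<in>Basis. y b *\<^sub>R b) $ i = y (axis i 1)" for y :: "real^'n \<Rightarrow> real" and i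
  proof -
    have "(\<Sum>b\<in>Basis. y b *\<^sub>R b) $ i = (\<Sum>b\<in>Basis. y b *\<^sub>R b) \<bullet> axis i 1"
      by (simp add: inner_axis)
    also have "\<dots> = y (axis i 1)"
      by (rule inner_sum_left_Basis) (simp add: axis_in_Basis_iff)
    finally show ?thesis .
  qed
  have "(\<integral>x. (\<Prod>i\<in>UNIV. f i (x $ i)) \<partial>(lborel :: (real^'n) measure)) =
      (\<integral>y. (\<Prod>i\<in>UNIV. f i (y (axis i 1))) \<partial>(\<Pi>\<^sub>M b\<in>(Basis::(real^'n) set). (lborel :: real measure)))"
    by (subst lborel_eq, subst integral_distr) (simp_all add: coord del: sum_component)
  also have "\<dots> = (\<integral>y. (\<Prod>b\<in>Basis. f (ix b) (y b)) \<partial>(\<Pi>\<^sub>M b\<in>(Basis::(real^'n) set). (lborel :: real measure)))"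
    by (subst prod.reindex_bij_betw[OF bij, symmetric]) (simp add: ix)
  also have "\<dots> = (\<Prod>b\<in>(Basis::(real^'n) set). integral\<^sup>L lborel (f (ix b)))"
    by (rule product_integral_prod) (auto intro: int)
  also have "\<dots> = (\<Prod>i\<in>UNIV. integral\<^sup>L lborel (f i))"
    by (subst prod.reindex_bij_betw[OF bij, symmetric]) (simp add: ix)
  finally show ?thesis .
qed

section \<open>Weak derivatives\<close>

text \<open>Fubini on products of \<open>lborel\<close> asks for Borel functions, whereas elements
  of \<open>Lp\<close> are only Lebesgue measurable. The representative constructed here vanishes
  a.e. outside S, so an integral over \<open>lebesgue_on S\<close> becomes one over the whole
  space.\<close>

lemma borel_representative:
  fixes g :: "'a::euclidean_space \<Rightarrow> real"
  assumes S[measurable]: "S \<in> sets lebesgue" and g: "set_integrable lebesgue S g"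
  obtains g0 where "integrable lborel g0" "AE x in lebesgue. x \<in> S \<longrightarrow> g0 x = g x"
    "\<And>f. f \<in> borel_measurable borel \<Longrightarrow> (\<integral>x. f x * g0 x \<partial>lborel) = (\<integral>x. f x * g x \<partial>lebesgue_on S)"
proof -
  have int: "integrable lebesgue (\<lambda>x. indicator S x * g x)"
    using g by (simp add: set_integrable_def)
  note [measurable] = borel_measurable_integrable[OF int]
  obtain g0 where g0[measurable]: "g0 \<in> borel_measurable lborel"
    and ae: "AE x in lborel. indicator S x * g x = g0 x"
    using completion_ex_borel_measurable_real[OF borel_measurable_integrable[OF int]] by auto
  have ae': "AE x in lebesgue. indicator S x * g x = g0 x"
    by (rule AE_completion[OF ae])
  have g0'[measurable]: "g0 \<in> borel_measurable lebesgue"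
    using g0 by (rule measurable_completion)
  have "integrable lebesgue g0"
    using int integrable_cong_AE[OF _ g0' ae'] by simp
  then have "integrable lborel g0"
    using integrable_completion[of g0 lborel] g0 by simp
  moreover have "AE x in lebesgue. x \<in> S \<longrightarrow> g0 x = g x"
    using ae' by eventually_elim auto
  moreover have "(\<integral>x. f x * g0 x \<partial>lborel) = (\<integral>x. f x * g x \<partial>lebesgue_on S)"
    if [measurable]: "f \<in> borel_measurable borel" for f
  proof -
    have f: "f \<in> borel_measurable lebesgue"
      using that by (intro measurable_completion) simp
    have "(\<integral>x. f x * g0 x \<partial>lborel) = (\<integral>x. f x * g0 x \<partial>lebesgue)"
      by (rule integral_completion[symmetric]) measurable
    also have "\<dots> = (\<integral>x. f x * (indicator S x * g x) \<partial>lebesgue)"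
      using f by (intro integral_cong_AE borel_measurable_times g0' borel_measurable_integrable[OF int])
        (use ae' in \<open>auto elim: eventually_mono\<close>)
    also have "\<dots> = (\<integral>x. f x * g x \<partial>lebesgue_on S)"
      by (subst integral_restrict_space) (auto simp: mult_ac)
    finally show ?thesis .
  qed
  ultimately show thesis by (rule that)
qed

text \<open>By Lindelof's theorem countably many of the balls cover M, so only countably many null
  sets are united.\<close>

lemma AE_open_local:
  fixes M :: "'a::euclidean_space set"
  assumes "\<And>x. x \<in> M \<Longrightarrow> \<exists>r>0. AE y in lebesgue. y \<in> ball x r \<longrightarrow> P y"
  shows "AE y in lebesgue. y \<in> M \<longrightarrow> P y"
proof -
  obtain r where r: "\<And>x. x \<in> M \<Longrightarrow> r x > 0" "\<And>x. x \<in> M \<Longrightarrow> AE y in lebesgue. y \<in> ball x (r x) \<longrightarrow> P y"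
    using assms by metis
  obtain \<B> where B: "\<B> \<subseteq> (\<lambda>x. ball x (r x)) ` M" "countable \<B>" "\<Union>\<B> = \<Union>((\<lambda>x. ball x (r x)) ` M)"
    by (rule Lindelof[of "(\<lambda>x. ball x (r x)) ` M"]) auto
  have "AE y in lebesgue. \<forall>b\<in>\<B>. y \<in> b \<longrightarrow> P y"
    by (subst AE_ball_countable[OF B(2)]) (use B(1) r(2) in auto)
  then show ?thesis
  proof eventually_elim
    case (elim y)
    show ?case
    proof
      assume "y \<in> M"
      then have "y \<in> \<Union>\<B>" unfolding B(3) using r(1) by force
      then show "P y" using elim by auto
    qed
  qed
qed

lemma test_function_eq_0:
  assumes "test_function M w" "x \<notin> M"
  shows "w x = 0"
  using assms closure_subset[of "{x. w x \<noteq> 0}"] by (auto simp: test_function_def)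

lemma integral_test_function_cong:
  fixes w :: "real^'n::finite \<Rightarrow> real"
  assumes "A \<in> sets lebesgue" "M \<in> sets lebesgue" "\<And>x. x \<notin> A \<Longrightarrow> w x = 0" "\<And>x. x \<notin> M \<Longrightarrow> w x = 0"
  shows "(\<integral>x. w x * v x \<partial>lebesgue_on A) = (\<integral>x. w x * v x \<partial>lebesgue_on M)"
proof -
  have "indicator A x *\<^sub>R (w x * v x) = indicator M x *\<^sub>R (w x * v x)" for x
    using assms(3,4)[of x] by (auto simp: indicator_def)
  then have eq: "(\<lambda>x. indicator A x *\<^sub>R (w x * v x)) = (\<lambda>x. indicator M x *\<^sub>R (w x * v x))"
    by (rule ext)
  have "(\<integral>x. w x * v x \<partial>lebesgue_on A) = (\<integral>x. indicator A x *\<^sub>R (w x * v x) \<partial>lebesgue)"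
    by (rule integral_restrict_space) (use assms(1) in simp)
  also have "\<dots> = (\<integral>x. w x * v x \<partial>lebesgue_on M)"
    unfolding eq by (rule integral_restrict_space[symmetric]) (use assms(2) in simp)
  finally show ?thesis .
qed

lemma norm_le_card_of_cbox:
  fixes z :: "real^'n::finite"
  assumes "z \<in> cbox (c - (\<chi> i. \<rho>)) (c + (\<chi> i. \<rho>))"
  shows "norm (z - c) \<le> real CARD('n) * \<rho>"
proof -
  have "\<bar>(z - c) $ i\<bar> \<le> \<rho>" for i
    using assms by (auto simp: mem_box_cart abs_le_iff) (smt (verit))+
  then have "(\<Sum>i\<in>UNIV. \<bar>(z - c) $ i\<bar>) \<le> (\<Sum>i\<in>(UNIV::'n set). \<rho>)"
    by (intro sum_mono)
  then show ?thesis using norm_le_l1_cart[of "z - c"] by simp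
qed

lemma local_mean_prod_fun:
  fixes D :: "'n::finite \<Rightarrow> nat \<Rightarrow> real \<Rightarrow> real"
  shows "local_mean (prod_fun D (\<lambda>_. 0)) s g x =
    (\<integral>y. prod_fun (rescale s x D) (\<lambda>_. 0) y * g y \<partial>lborel) / s ^ CARD('n)"
  by (simp add: local_mean_def prod_fun_rescale)

lemma integral_prod_fun:
  fixes D :: "'n::finite \<Rightarrow> nat \<Rightarrow> real \<Rightarrow> real"
  assumes "\<And>i. deriv_seq (D i)" "\<And>i. supported_near (c i) \<rho> (D i)" "\<And>i. integral\<^sup>L lborel (D i 0) = 1"
  shows "integral\<^sup>L lborel (prod_fun D (\<lambda>_. 0)) = 1"
  unfolding prod_fun_def
  by (subst lborel_integral_prod_cart)
     (auto simp: assms(3) intro: deriv_seq_integrable[OF assms(1,2)])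

lemma prod_fun_integrable:
  fixes D :: "'n::finite \<Rightarrow> nat \<Rightarrow> real \<Rightarrow> real"
  assumes "\<And>i. deriv_seq (D i)" "\<And>i. supported_near (c $ i) \<rho> (D i)"
  shows "integrable lborel (prod_fun D m)"
  by (rule continuous_compact_support_integrable[where K = "cbox (c - (\<chi> i. \<rho>)) (c + (\<chi> i. \<rho>))"])
     (use assms in \<open>auto intro: continuous_prod_fun prod_fun_eq_0\<close>)

lemma prod_fun_bounded:
  fixes D :: "'n::finite \<Rightarrow> nat \<Rightarrow> real \<Rightarrow> real"
  assumes "\<And>i. deriv_seq (D i)" "\<And>i. supported_near (c $ i) \<rho> (D i)"
  obtains C where "C > 0" "\<And>x. \<bar>prod_fun D m x\<bar> \<le> C"
  by (rule bounded_continuous_compact_support[of "prod_fun D m" "cbox (c - (\<chi> i. \<rho>)) (c + (\<chi> i. \<rho>))"])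
     (use assms in \<open>auto intro: continuous_prod_fun prod_fun_eq_0\<close>)

text \<open>The fundamental lemma of the calculus of variations: near x0 all small-scale averages of
  v are integrals against test functions, hence 0, and the a.e. bound with B = 0 applies to v and to
  -v.\<close>

lemma AE_zero_of_test_functions:
  fixes v :: "real^'n::finite \<Rightarrow> real"
  assumes M: "open M" and v: "locally_integrable M v"
    and zero: "\<And>w. test_function M w \<Longrightarrow> (\<integral>x. w x * v x \<partial>lebesgue_on M) = 0"
  shows "AE x in lebesgue. x \<in> M \<longrightarrow> v x = 0"
proof (rule AE_open_local)
  fix x0 assume "x0 \<in> M"
  then obtain e where e: "e > 0" "cball x0 e \<subseteq> M"
    using M open_contains_cball by blast
  define r where "r = e / 2"
  define d where "d = real CARD('n)"
  have d: "d > 0" by (simp add: d_def)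
  have r: "r > 0" "cball x0 (2 * r) \<subseteq> M" using e by (auto simp: r_def)
  obtain h where h: "deriv_seq h" "\<And>n x. x \<notin> {-1..1} \<Longrightarrow> h n x = 0" "integral\<^sup>L lborel (h 0) = 1"
    using ex_bump[of "-1" 1] by auto
  define D where "D = (\<lambda>i::'n. h)"
  have D: "deriv_seq (D i)" "supported_near ((0::real^'n) $ i) 1 (D i)" "integral\<^sup>L lborel (D i 0) = 1" for i
    unfolding D_def supported_near_def using h(1,3) by (auto intro!: h(2))
  obtain C where C: "\<And>x. \<bar>prod_fun D (\<lambda>_. 0) x\<bar> \<le> C"
    using prod_fun_bounded[OF D(1,2)] by blast
  \<comment> \<open>Points of the cube [-1, 1]^d have norm at most d, so a scale up to r / d moves a
    point of \<open>ball x0 r\<close> by at most r and the kernel stays in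
    \<open>ball x0 (2 * r)\<close>.\<close>
  define s where "s n = r / d / real (Suc n)" for n
  have s: "s n > 0" "s n \<le> r / d" for n
    using r d by (auto simp: s_def divide_le_eq mult_le_cancel_left1)
  have s0: "s \<longlonglongrightarrow> 0"
    unfolding s_def by (intro LIMSEQ_Suc[OF lim_const_over_n])
  have K: "cball x0 (2 * r) \<in> sets lebesgue" by simp
  have "set_integrable lebesgue (cball x0 (2 * r)) v"
    using v r unfolding locally_integrable_def by auto
  from borel_representative[OF K this] obtain v0 where v0: "integrable lborel v0"
    "AE x in lebesgue. x \<in> cball x0 (2 * r) \<longrightarrow> v0 x = v x"
    "\<And>f. f \<in> borel_measurable borel \<Longrightarrow> (\<integral>x. f x * v0 x \<partial>lborel) = (\<integral>x. f x * v x \<partial>lebesgue_on (cball x0 (2 * r)))"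
    by blast
  have mean0: "(\<integral>y. prod_fun (rescale (s n) x D) (\<lambda>_. 0) y * v0 y \<partial>lborel) = 0" if x: "x \<in> ball x0 r" for n x
  proof -
    let ?w = "prod_fun (rescale (s n) x D) (\<lambda>_. 0)"
    have test: "test_function A ?w" if A: "ball x0 (2 * r) \<subseteq> A" for A
    proof (rule test_function_prod_fun_rescale[where c = 0 and \<rho> = 1])
      fix z :: "real^'n" assume "z \<in> cbox (0 - (\<chi> i. 1)) (0 + (\<chi> i. 1))"
      then have "norm z \<le> d"
        using norm_le_card_of_cbox[of z 0 1] by (simp add: d_def)
      then have "s n * norm z \<le> r / d * d"
        using s[of n] d r(1) by (intro mult_mono) auto
      then have "norm (s n *\<^sub>R z) \<le> r" using d s(1)[of n] by simp
      moreover have "dist x0 (x + s n *\<^sub>R z) \<le> dist x0 x + norm (s n *\<^sub>R z)"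
        by (metis add.commute dist_commute dist_norm dist_triangle add_diff_cancel_left')
      ultimately have "x + s n *\<^sub>R z \<in> ball x0 (2 * r)" using x by simp
      then show "x + s n *\<^sub>R z \<in> A" using A by auto
    qed (use D s in auto)
    have "?w \<in> borel_measurable borel"
      by (intro borel_measurable_continuous_onI continuous_prod_fun deriv_seq_rescale D)
    then have "(\<integral>y. ?w y * v0 y \<partial>lborel) = (\<integral>y. ?w y * v y \<partial>lebesgue_on (cball x0 (2 * r)))"
      by (rule v0(3))
    also have "\<dots> = (\<integral>y. ?w y * v y \<partial>lebesgue_on M)"
    proof (rule integral_test_function_cong)
      show "?w y = 0" if "y \<notin> M" for y
        by (rule test_function_eq_0[OF test that]) (use r(2) in auto)
      show "?w y = 0" if "y \<notin> cball x0 (2 * r)" for y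
        by (rule test_function_eq_0[OF test that]) auto
    qed (use M in auto)
    also have "\<dots> = 0"
      by (rule zero[OF test]) (use r(2) in auto)
    finally show ?thesis .
  qed
  have 1: "AE x in lborel. x \<in> ball x0 r \<longrightarrow> v0 x \<le> 0"
    by (rule AE_bounded_by_local_mean_le[OF v0(1) open_ball prod_fun_integrable[OF D(1,2)] C integral_prod_fun[OF D] s(1) s0])
       (use mean0 in \<open>auto simp: local_mean_prod_fun\<close>)
  have 2: "AE x in lborel. x \<in> ball x0 r \<longrightarrow> - v0 x \<le> 0"
    by (rule AE_bounded_by_local_mean_le[OF _ open_ball prod_fun_integrable[OF D(1,2)] C integral_prod_fun[OF D] s(1) s0])
       (use mean0 v0(1) in \<open>auto simp: local_mean_prod_fun\<close>)
  have "AE x in lebesgue. x \<in> ball x0 r \<longrightarrow> v x = 0"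
    using AE_completion[OF 1] AE_completion[OF 2] v0(2)
    by eventually_elim (use r in auto)
  then show "\<exists>r>0. AE x in lebesgue. x \<in> ball x0 r \<longrightarrow> v x = 0" using r(1) by blast
qed

lemma iter_partial_eq_0:
  fixes w :: "real^'n::finite \<Rightarrow> real"
  assumes "open U" "\<And>x. x \<in> U \<Longrightarrow> w x = 0" "x \<in> U"
  shows "iter_partial is w x = 0"
  using assms(3)
proof (induction "is" arbitrary: x)
  case Nil
  then show ?case using assms(2) by (simp add: iter_partial_def)
next
  case (Cons a "is")
  have "((\<lambda>_. 0) has_derivative (\<lambda>_. 0)) (at x)" by simp
  then have "(iter_partial is w has_derivative (\<lambda>_. 0)) (at x)"
    by (rule has_derivative_transform_within_open[OF _ assms(1) Cons.prems]) (use Cons.IH in auto)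
  then have "frechet_derivative (iter_partial is w) (at x) = (\<lambda>_. 0)"
    using frechet_derivative_at by metis
  then show ?case by (simp add: iter_partial_def partial_deriv_def)
qed

lemma test_function_iter_partial_continuous:
  assumes "test_function M w"
  shows "continuous_on S (iter_partial is w)"
  using assms unfolding test_function_def smooth_def
  by (auto intro!: continuous_at_imp_continuous_on differentiable_imp_continuous_within)

text \<open>u is integrable on compact sets only, while derivatives of w are bounded and vanish off
  the compact support of w. Integrability is what makes the integral additive in u: a nonintegrable
  function has integral 0 by convention.\<close>

lemma test_function_integrable:
  fixes u :: "real^'n::finite \<Rightarrow> real"
  assumes w: "test_function M w" and M: "open M" and u: "locally_integrable M u"
  shows "integrable (lebesgue_on M) (\<lambda>x. u x * iter_partial is w x)"
proof -
  define K where "K = closure {x. w x \<noteq> 0}"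
  have K: "compact K" "K \<subseteq> M" using w by (auto simp: test_function_def K_def)
  have zero: "iter_partial is w x = 0" if "x \<notin> K" for x
  proof (rule iter_partial_eq_0[of "- K"])
    show "open (- K)" unfolding K_def by (rule open_Compl[OF closed_closure])
    show "w x = 0" if "x \<in> - K" for x
      using that closure_subset[of "{x. w x \<noteq> 0}"] by (auto simp: K_def)
  qed (use that in auto)
  have cont: "continuous_on UNIV (iter_partial is w)"
    by (rule test_function_iter_partial_continuous[OF w])
  obtain C where C: "\<And>x. \<bar>iter_partial is w x\<bar> \<le> C"
    using bounded_continuous_compact_support[OF cont zero K(1)] by blast
  have int: "integrable lebesgue (\<lambda>x. indicator K x * u x)"
    using u K by (simp add: locally_integrable_def set_integrable_def)
  have meas: "iter_partial is w \<in> borel_measurable lebesgue"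
    using borel_measurable_continuous_onI[OF cont] by (intro measurable_completion) simp
  have "integrable lebesgue (\<lambda>x. (indicator K x * u x) * iter_partial is w x)"
  proof (rule Bochner_Integration.integrable_bound[where f = "\<lambda>x. C * (indicator K x * u x)"])
    show "AE x in lebesgue. norm (indicator K x * u x * iter_partial is w x) \<le> norm (C * (indicator K x * u x))"
    proof (rule AE_I2)
      fix x
      have "\<bar>indicator K x * u x\<bar> * \<bar>iter_partial is w x\<bar> \<le> \<bar>indicator K x * u x\<bar> * \<bar>C\<bar>"
        using C[of x] by (intro mult_left_mono) auto
      then show "norm (indicator K x * u x * iter_partial is w x) \<le> norm (C * (indicator K x * u x))"
        by (simp add: abs_mult mult_ac)
    qed
  qed (use int meas in auto)
  moreover have "(\<lambda>x. (indicator K x * u x) * iter_partial is w x) = (\<lambda>x. indicator M x *\<^sub>R (u x * iter_partial is w x))"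
    using zero K(2) by (force simp: indicator_def fun_eq_iff)
  ultimately show ?thesis
    using M by (subst integrable_restrict_space) auto
qed

lemma locally_integrable_diff:
  "locally_integrable M u \<Longrightarrow> locally_integrable M v \<Longrightarrow> locally_integrable M (\<lambda>x. u x - v x)"
  unfolding locally_integrable_def by (auto intro: set_integral_diff)

lemma iter_partial_Nil: "iter_partial [] w = w"
  by (simp add: iter_partial_def)

lemma has_weak_deriv_diff:
  fixes M :: "(real^'n::finite) set"
  assumes M: "open M" and 1: "has_weak_deriv M a u1 v1" and 2: "has_weak_deriv M a u2 v2"
  shows "has_weak_deriv M a (\<lambda>x. u1 x - u2 x) (\<lambda>x. v1 x - v2 x)"
  unfolding has_weak_deriv_def
proof (intro conjI allI impI)
  show "locally_integrable M (\<lambda>x. u1 x - u2 x)" "locally_integrable M (\<lambda>x. v1 x - v2 x)"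
    using 1 2 by (auto simp: has_weak_deriv_def intro: locally_integrable_diff)
  fix w assume w: "test_function M w"
  have lu: "locally_integrable M u1" "locally_integrable M u2" "locally_integrable M v1" "locally_integrable M v2"
    using 1 2 by (auto simp: has_weak_deriv_def)
  have iu: "integrable (lebesgue_on M) (\<lambda>x. u x * multi_deriv a w x)" if "locally_integrable M u" for u
    unfolding multi_deriv_def by (rule test_function_integrable[OF w M that])
  have iv: "integrable (lebesgue_on M) (\<lambda>x. u x * w x)" if "locally_integrable M u" for u
    using test_function_integrable[OF w M that, of "[]"] by (simp add: iter_partial_Nil)
  show "(\<integral>x. (u1 x - u2 x) * multi_deriv a w x \<partial>lebesgue_on M) =
      (-1) ^ (\<Sum>i\<in>UNIV. a i) * (\<integral>x. (v1 x - v2 x) * w x \<partial>lebesgue_on M)"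
    using 1 2 w lu
    by (simp add: left_diff_distrib iu iv Bochner_Integration.integral_diff has_weak_deriv_def right_diff_distrib)
qed

lemma has_weak_deriv_unique:
  fixes M :: "(real^'n::finite) set"
  assumes M: "open M" and 1: "has_weak_deriv M a u v1" and 2: "has_weak_deriv M a u v2"
  shows "AE x in lebesgue. x \<in> M \<longrightarrow> v1 x = v2 x"
proof -
  from has_weak_deriv_diff[OF M 1 2] have d: "has_weak_deriv M a (\<lambda>x. 0) (\<lambda>x. v1 x - v2 x)" by simp
  have "AE x in lebesgue. x \<in> M \<longrightarrow> v1 x - v2 x = 0"
  proof (rule AE_zero_of_test_functions[OF M])
    show "locally_integrable M (\<lambda>x. v1 x - v2 x)" using d by (simp add: has_weak_deriv_def)
    fix w assume "test_function M w"
    with d have "(-1) ^ (\<Sum>i\<in>UNIV. a i) * (\<integral>x. (v1 x - v2 x) * w x \<partial>lebesgue_on M) = 0"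
      by (simp add: has_weak_deriv_def)
    then show "(\<integral>x. w x * (v1 x - v2 x) \<partial>lebesgue_on M) = 0"
      by (simp add: mult.commute)
  qed
  then show ?thesis by simp
qed

section \<open>Lebesgue spaces and the chosen weak derivative\<close>

lemma Lp_cong_AE:
  fixes u v :: "'a::euclidean_space \<Rightarrow> real"
  assumes S: "S \<in> sets lebesgue" and u: "u \<in> Lp S p" and ae: "AE x in lebesgue. x \<in> S \<longrightarrow> u x = v x"
  shows "v \<in> Lp S p"
proof -
  have ae': "AE x in lebesgue_on S. u x = v x"
    using S ae by (subst AE_restrict_space_iff) auto
  have um: "u \<in> borel_measurable (lebesgue_on S)" using u by (simp add: Lp_def)
  \<comment> \<open>Extended by 0, u is measurable on the whole space; as Lebesgue measure is
    complete, a change on a null set keeps measurability.\<close>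
  then have "(\<lambda>x. if x \<in> S then u x else 0) \<in> borel_measurable lebesgue"
    by (rule borel_measurable_if_I[OF _ S])
  moreover have "AE x in lebesgue. (if x \<in> S then u x else 0) = (if x \<in> S then v x else 0)"
    using ae by eventually_elim auto
  ultimately have "(\<lambda>x. if x \<in> S then v x else 0) \<in> borel_measurable lebesgue"
    by (rule borel_measurable_AE)
  then have vm: "v \<in> borel_measurable (lebesgue_on S)"
    by (rule borel_measurable_if_D)
  show ?thesis
  proof (cases "p = \<infinity>")
    case True
    with u obtain B where "AE x in lebesgue_on S. \<bar>u x\<bar> \<le> B" by (auto simp: Lp_def)
    with ae' have "AE x in lebesgue_on S. \<bar>v x\<bar> \<le> B" by eventually_elim auto
    then show ?thesis using True vm by (auto simp: Lp_def)
  next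
    case False
    then have "integrable (lebesgue_on S) (\<lambda>x. \<bar>u x\<bar> powr real_of_ereal p)" using u by (simp add: Lp_def)
    moreover have "AE x in lebesgue_on S. \<bar>u x\<bar> powr real_of_ereal p = \<bar>v x\<bar> powr real_of_ereal p"
      using ae' by eventually_elim auto
    ultimately have "integrable (lebesgue_on S) (\<lambda>x. \<bar>v x\<bar> powr real_of_ereal p)"
      using um vm by (subst (asm) integrable_cong_AE[where g = "\<lambda>x. \<bar>v x\<bar> powr real_of_ereal p"]) auto
    then show ?thesis using False vm by (simp add: Lp_def)
  qed
qed

lemma Lp_diff:
  fixes u v :: "'a::euclidean_space \<Rightarrow> real"
  assumes p: "1 \<le> p" and u: "u \<in> Lp S p" and v: "v \<in> Lp S p"
  shows "(\<lambda>x. u x - v x) \<in> Lp S p"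
proof (cases "p = \<infinity>")
  case True
  with u v obtain B C where "AE x in lebesgue_on S. \<bar>u x\<bar> \<le> B" "AE x in lebesgue_on S. \<bar>v x\<bar> \<le> C"
    by (auto simp: Lp_def)
  then have "AE x in lebesgue_on S. \<bar>u x - v x\<bar> \<le> B + C" by eventually_elim auto
  then show ?thesis using u v True by (auto simp: Lp_def)
next
  case False
  define P where "P = real_of_ereal p"
  have P: "P \<ge> 1" using p False by (cases p) (auto simp: P_def)
  note [measurable] = u[unfolded Lp_def, simplified, THEN conjunct1] v[unfolded Lp_def, simplified, THEN conjunct1]
  have iu: "integrable (lebesgue_on S) (\<lambda>x. \<bar>u x\<bar> powr P)" and iv: "integrable (lebesgue_on S) (\<lambda>x. \<bar>v x\<bar> powr P)"
    using u v False by (auto simp: Lp_def P_def)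
  have bd: "\<bar>a - b\<bar> powr P \<le> 2 powr P * (\<bar>a\<bar> powr P + \<bar>b\<bar> powr P)" for a b :: real
  proof -
    have "\<bar>a - b\<bar> powr P \<le> (2 * max \<bar>a\<bar> \<bar>b\<bar>) powr P" using P by (intro powr_mono2) auto
    also have "\<dots> = 2 powr P * max \<bar>a\<bar> \<bar>b\<bar> powr P" by (simp add: powr_mult)
    also have "\<dots> \<le> 2 powr P * (\<bar>a\<bar> powr P + \<bar>b\<bar> powr P)"
      by (intro mult_left_mono) (auto simp: max_def)
    finally show ?thesis .
  qed
  have "integrable (lebesgue_on S) (\<lambda>x. \<bar>u x - v x\<bar> powr P)"
    by (rule Bochner_Integration.integrable_bound[where f = "\<lambda>x. 2 powr P * (\<bar>u x\<bar> powr P + \<bar>v x\<bar> powr P)"])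
       (use iu iv bd in auto)
  then show ?thesis using u v False by (auto simp: Lp_def P_def)
qed

text \<open>The choice in \<open>weak_deriv\<close> asks for a weak derivative, not for one in
  \<open>Lp\<close>; uniqueness up to null sets transfers membership from v.\<close>

lemma weak_deriv_in_Lp:
  fixes M :: "(real^'n::finite) set"
  assumes M: "open M" and v: "v \<in> Lp M p" "has_weak_deriv M a u v"
  shows "weak_deriv M a u \<in> Lp M p" "has_weak_deriv M a u (weak_deriv M a u)"
proof -
  show h: "has_weak_deriv M a u (weak_deriv M a u)"
    unfolding weak_deriv_def using v(2) by (rule someI[where P = "has_weak_deriv M a u"])
  show "weak_deriv M a u \<in> Lp M p"
    by (rule Lp_cong_AE[OF _ v(1) has_weak_deriv_unique[OF M v(2) h]]) (use M in auto)
qed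

lemma weak_deriv_sobolev_diff:
  fixes M :: "(real^'n::finite) set"
  assumes M: "open M" and p: "1 \<le> p" and u: "u1 \<in> sobolev M k p" "u2 \<in> sobolev M k p"
    and a: "(\<Sum>i\<in>UNIV. a i) \<le> k"
  shows "weak_deriv M a (\<lambda>x. u1 x - u2 x) \<in> Lp M p"
    "has_weak_deriv M a (\<lambda>x. u1 x - u2 x) (weak_deriv M a (\<lambda>x. u1 x - u2 x))"
proof -
  obtain v1 v2 where v: "v1 \<in> Lp M p" "has_weak_deriv M a u1 v1" "v2 \<in> Lp M p" "has_weak_deriv M a u2 v2"
    using u a unfolding sobolev_def by blast
  note * = weak_deriv_in_Lp[OF M Lp_diff[OF p v(1,3)] has_weak_deriv_diff[OF M v(2,4)]]
  show "weak_deriv M a (\<lambda>x. u1 x - u2 x) \<in> Lp M p" by (rule *(1))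
  show "has_weak_deriv M a (\<lambda>x. u1 x - u2 x) (weak_deriv M a (\<lambda>x. u1 x - u2 x))" by (rule *(2))
qed

section \<open>Local means of Sobolev functions\<close>

abbreviation inv_exponent :: "ereal \<Rightarrow> real" where
  "inv_exponent p \<equiv> (if p = \<infinity> then 0 else 1 / real_of_ereal p)"

section \<open>Estimates for the L^p norms\<close>

lemma esssup_abs_nonneg:
  fixes u :: "'a::euclidean_space \<Rightarrow> real"
  assumes "u \<in> borel_measurable (lebesgue_on S)"
  shows "0 \<le> real_of_ereal (esssup (lebesgue_on S) (\<lambda>x. ereal \<bar>u x\<bar>))" (is "0 \<le> real_of_ereal ?e")
proof (cases "?e < 0")
  \<comment> \<open>This happens only if S carries no mass; then the essential supremum is
    -\<infinity>, which \<open>real_of_ereal\<close> maps to 0.\<close>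
  case True
  have "AE x in lebesgue_on S. ereal \<bar>u x\<bar> \<le> ?e" by (rule esssup_AE)
  then have "AE x in lebesgue_on S. False"
    by eventually_elim (use True in \<open>metis abs_ge_zero ereal_less_eq(5) leD order_trans\<close>)
  then have "emeasure (lebesgue_on S) (space (lebesgue_on S)) = 0"
    by (simp only: eventually_False ae_filter_eq_bot_iff)
  then have "?e = -\<infinity>"
    using assms by (intro esssup_zero_space) auto
  then show ?thesis by simp
next
  case False
  then show ?thesis by (simp add: real_of_ereal_pos)
qed

lemma Lp_norm_nonneg:
  fixes u :: "'a::euclidean_space \<Rightarrow> real"
  assumes "u \<in> Lp S p"
  shows "0 \<le> Lp_norm S p u"
proof -
  have "u \<in> borel_measurable (lebesgue_on S)" using assms by (simp add: Lp_def)
  from esssup_abs_nonneg[OF this] show ?thesis by (simp add: Lp_norm_def)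
qed

lemma Lp_infinity_AE_le:
  fixes v :: "'a::euclidean_space \<Rightarrow> real"
  assumes "v \<in> Lp S \<infinity>"
  shows "AE x in lebesgue_on S. \<bar>v x\<bar> \<le> Lp_norm S \<infinity> v"
proof -
  let ?e = "esssup (lebesgue_on S) (\<lambda>x. ereal \<bar>v x\<bar>)"
  from assms obtain B where B: "AE x in lebesgue_on S. \<bar>v x\<bar> \<le> B" and [measurable]: "v \<in> borel_measurable (lebesgue_on S)"
    by (auto simp: Lp_def)
  have "?e \<le> ereal B"
    by (rule esssup_I) (use B in auto)
  \<comment> \<open>An infinite supremum would be mapped to 0 by \<open>real_of_ereal\<close>, and
    the norm would no longer dominate v.\<close>
  then have fin: "?e \<noteq> \<infinity>" by auto
  have "AE x in lebesgue_on S. ereal \<bar>v x\<bar> \<le> ?e" by (rule esssup_AE)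
  then show ?thesis
  proof eventually_elim
    case (elim x)
    with fin show ?case by (cases ?e) (auto simp: Lp_norm_def)
  qed
qed

lemma Lp_norm_1_eq:
  "Lp_norm S 1 u = (\<integral>x. \<bar>u x\<bar> \<partial>lebesgue_on S)"
  by (simp add: Lp_norm_def)

lemma Lp_1_integrable:
  fixes u :: "'a::euclidean_space \<Rightarrow> real"
  assumes "u \<in> Lp S 1"
  shows "integrable (lebesgue_on S) u"
proof -
  have "integrable (lebesgue_on S) (\<lambda>x. \<bar>u x\<bar>)" and m: "u \<in> borel_measurable (lebesgue_on S)"
    using assms by (simp_all add: Lp_def)
  then show ?thesis
    by (subst (asm) integrable_abs_iff) auto
qed

text \<open>
  This replaces Hoelder's inequality: it follows from \<open>\<bar>v\<bar> \<le> t\<^sup>1\<^sup>-\<^sup>p \<bar>v\<bar>\<^sup>p + t\<close> by optimising over \<open>t > 0\<close>.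
\<close>

lemma Lp_integral_bound:
  fixes v w :: "'a::euclidean_space \<Rightarrow> real"
  assumes p: "1 \<le> p" and M: "M \<in> sets lebesgue" and v: "v \<in> Lp M p"
    and w[measurable]: "w \<in> borel_measurable (lebesgue_on M)"
    and A: "A \<in> lmeasurable" and wb: "\<And>x. \<bar>w x\<bar> \<le> b" "\<And>x. x \<notin> A \<Longrightarrow> w x = 0"
    and m: "measure lebesgue A \<le> m" "m > 0"
  shows "\<bar>\<integral>x. v x * w x \<partial>lebesgue_on M\<bar> \<le> b * (2 * Lp_norm M p v * m powr (1 - inv_exponent p))"
proof -
  let ?L = "lebesgue_on M"
  have vm[measurable]: "v \<in> borel_measurable ?L" using v by (simp add: Lp_def)
  have b: "b \<ge> 0" using wb(1)[of undefined] by linarith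
  have Nn: "0 \<le> Lp_norm M p v" by (rule Lp_norm_nonneg[OF v])
  have AM: "A \<inter> M \<in> lmeasurable"
    using A M by (simp add: fmeasurable_Int_fmeasurable)
  have iA: "integrable ?L (\<lambda>x. indicat_real A x)"
  proof (subst integrable_restrict_space)
    have "(\<lambda>x. indicat_real M x *\<^sub>R indicat_real A x) = indicat_real (A \<inter> M)"
      by (auto simp: indicator_def fun_eq_iff)
    then show "integrable lebesgue (\<lambda>x. indicat_real M x *\<^sub>R indicat_real A x)"
      using AM by (auto simp: fmeasurable_def intro!: integrable_real_indicator)
  qed (use M in auto)
  have mA: "(\<integral>x. indicat_real A x \<partial>?L) \<le> m"
  proof -
    have "(\<integral>x. indicat_real A x \<partial>?L) = (\<integral>x. indicat_real M x *\<^sub>R indicat_real A x \<partial>lebesgue)"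
      by (rule integral_restrict_space) (use M in auto)
    also have "(\<lambda>x. indicat_real M x *\<^sub>R indicat_real A x) = indicat_real (A \<inter> M)"
      by (auto simp: indicator_def fun_eq_iff)
    also have "(\<integral>x. indicat_real (A \<inter> M) x \<partial>lebesgue) = measure lebesgue (A \<inter> M)"
      using AM by simp
    also have "\<dots> \<le> measure lebesgue A"
      using A AM by (intro measure_mono_fmeasurable) auto
    finally show ?thesis using m by simp
  qed
  have general: "\<bar>\<integral>x. v x * w x \<partial>?L\<bar> \<le> b * (\<integral>x. f x \<partial>?L)"
    if f: "integrable ?L f" and le: "AE x in ?L. x \<in> A \<longrightarrow> \<bar>v x\<bar> \<le> f x" and fn: "\<And>x. f x \<ge> 0" for f
  proof -
    have ae: "AE x in ?L. \<bar>v x * w x\<bar> \<le> b * f x"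
      using le
    proof eventually_elim
      case (elim x)
      show ?case
      proof (cases "x \<in> A")
        case True
        then have "\<bar>v x\<bar> * \<bar>w x\<bar> \<le> f x * b"
          using elim wb(1) fn by (intro mult_mono) auto
        then show ?thesis by (simp add: abs_mult mult.commute)
      qed (use wb(2) b fn in auto)
    qed
    have int: "integrable ?L (\<lambda>x. v x * w x)"
      by (rule Bochner_Integration.integrable_bound[where f = "\<lambda>x. b * f x"])
         (use f ae b fn in \<open>auto elim: eventually_mono\<close>)
    have "\<bar>\<integral>x. v x * w x \<partial>?L\<bar> \<le> (\<integral>x. \<bar>v x * w x\<bar> \<partial>?L)"
      by (rule integral_abs_bound)
    also have "\<dots> \<le> (\<integral>x. b * f x \<partial>?L)"
      by (rule integral_mono_AE) (use int f ae in auto)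
    finally show ?thesis by simp
  qed
  show ?thesis
  proof (cases "p = \<infinity>")
    case True
    let ?N = "Lp_norm M p v"
    have "\<bar>\<integral>x. v x * w x \<partial>?L\<bar> \<le> b * (\<integral>x. ?N * indicat_real A x \<partial>?L)"
      using Lp_infinity_AE_le[of v M] v True iA Nn by (intro general) (auto elim: eventually_mono)
    also have "\<dots> \<le> b * (?N * m)"
      using mA Nn b by (auto intro!: mult_left_mono)
    also have "\<dots> \<le> b * (2 * ?N * m)"
      using Nn b m by (intro mult_left_mono mult_right_mono) auto
    finally show ?thesis using True m by simp
  next
    case False
    define P where "P = real_of_ereal p"
    have P: "P \<ge> 1" using p False by (cases p) (auto simp: P_def)
    define I where "I = (\<integral>x. \<bar>v x\<bar> powr P \<partial>?L)"
    have iv: "integrable ?L (\<lambda>x. \<bar>v x\<bar> powr P)" using v False by (auto simp: Lp_def P_def)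
    have I: "I \<ge> 0" by (simp add: I_def)
    define N where "N = Lp_norm M p v"
    have N: "N = I powr (1 / P)" using False by (simp add: N_def Lp_norm_def I_def P_def)
    have NP: "N powr P = I" using P I by (simp add: N powr_powr)
    have bound: "\<bar>\<integral>x. v x * w x \<partial>?L\<bar> \<le> b * (t powr (1 - P) * N powr P + t * m)" if t: "t > 0" for t
    proof -
      \<comment> \<open>Where |v| \<le> t the second summand suffices; elsewhere |v|^(1 - P) \<le>
        t^(1 - P).\<close>
      have "\<bar>v x\<bar> \<le> t powr (1 - P) * \<bar>v x\<bar> powr P + t" for x
      proof (cases "\<bar>v x\<bar> \<le> t")
        case True
        then show ?thesis by (simp add: add_increasing)
      next
        case False
        then have v0: "\<bar>v x\<bar> > 0" using t by linarith
        have "\<bar>v x\<bar> = \<bar>v x\<bar> powr (1 - P) * \<bar>v x\<bar> powr P"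
          using v0 by (simp add: powr_add[symmetric])
        also have "\<dots> \<le> t powr (1 - P) * \<bar>v x\<bar> powr P"
          using False t P by (intro mult_right_mono powr_mono2') auto
        finally show ?thesis using t by linarith
      qed
      then have "\<bar>\<integral>x. v x * w x \<partial>?L\<bar> \<le> b * (\<integral>x. t powr (1 - P) * \<bar>v x\<bar> powr P + t * indicat_real A x \<partial>?L)"
        using iv iA t by (intro general) (auto simp: indicator_def)
      also have "(\<integral>x. t powr (1 - P) * \<bar>v x\<bar> powr P + t * indicat_real A x \<partial>?L) =
          t powr (1 - P) * I + t * (\<integral>x. indicat_real A x \<partial>?L)"
        using iv iA by (simp add: I_def)
      also have "b * \<dots> \<le> b * (t powr (1 - P) * N powr P + t * m)"
        using mA t b by (intro mult_left_mono add_mono) (auto simp: NP)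
      finally show ?thesis .
    qed
    have "\<bar>\<integral>x. v x * w x \<partial>?L\<bar> \<le> b * (2 * N * m powr (1 - 1 / P))"
    proof (cases "N = 0")
      case True
      \<comment> \<open>The balancing t of the other case would be 0 here, so t is sent to 0
        instead.\<close>
      have "\<bar>\<integral>x. v x * w x \<partial>?L\<bar> \<le> 0"
      proof (rule field_le_epsilon)
        fix e :: real assume "e > 0"
        define t where "t = e / ((b + 1) * m)"
        have "t > 0" using \<open>e > 0\<close> b m by (simp add: t_def)
        from bound[OF this] have "\<bar>\<integral>x. v x * w x \<partial>?L\<bar> \<le> b * (t * m)" using True P by simp
        also have "\<dots> = b / (b + 1) * e" using b m by (simp add: t_def)
        also have "\<dots> \<le> 1 * e" using b \<open>e > 0\<close> by (intro mult_right_mono) auto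
        finally show "\<bar>\<integral>x. v x * w x \<partial>?L\<bar> \<le> 0 + e" by simp
      qed
      then show ?thesis using True by simp
    next
      case False
      then have N0: "N > 0" using Nn by (simp add: N_def)
      \<comment> \<open>Both summands in \<open>bound\<close> become equal to N * m powr (1 - 1 /
        P), whence the factor 2.\<close>
      define t where "t = N * m powr (- 1 / P)"
      have t: "t > 0" using N0 m by (simp add: t_def)
      have "t powr (1 - P) * N powr P = N * m powr (1 - 1 / P)"
      proof -
        have "t powr (1 - P) = N powr (1 - P) * m powr ((- 1 / P) * (1 - P))"
          using N0 m by (simp add: t_def powr_mult powr_powr)
        moreover have "(- 1 / P) * (1 - P) = 1 - 1 / P" using P by (simp add: field_simps)
        moreover have "N powr (1 - P) * N powr P = N" using N0 by (simp add: powr_add[symmetric])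
        ultimately show ?thesis by (simp add: mult_ac)
      qed
      moreover have "t * m = N * m powr (1 - 1 / P)"
      proof -
        have "m powr (1 - 1 / P) = m powr (-1 / P) * m powr 1"
          unfolding powr_add[symmetric] by simp
        then show ?thesis using m by (simp add: t_def)
      qed
      ultimately show ?thesis using bound[OF t] by simp
    qed
    then show ?thesis using False by (simp add: N_def P_def)
  qed
qed

section \<open>Kernels in several variables\<close>

lemma measure_cbox_cart:
  fixes c :: "real^'n::finite"
  assumes "\<sigma> > 0"
  shows "measure lebesgue (cbox (c - (\<chi> i. \<sigma>)) (c + (\<chi> i. \<sigma>))) = (2 * \<sigma>) ^ CARD('n)"
proof -
  have "c \<in> cbox (c - (\<chi> i. \<sigma>)) (c + (\<chi> i. \<sigma>))" using assms by (auto simp: mem_box_cart)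
  then show ?thesis
    using content_cbox_cart[of "c - (\<chi> i. \<sigma>)" "c + (\<chi> i. \<sigma>)"] by (auto simp: measure_completion)
qed

text \<open>One l serves all coordinates, so that the product of the dilated factors is a dilation
  of the product. Taking l close to 1 keeps the supports of K, of its dilation K' and of Z in the
  cube of half-width \<sigma> around c.\<close>

lemma ex_cart_kernel:
  fixes c :: "real^'n::finite"
  assumes "\<sigma> > 0"
  obtains l K K' Z where "0 < l" "l < 1"
    "\<And>i. deriv_seq (K i)" "\<And>i. deriv_seq (K' i)" "\<And>i. deriv_seq (Z i)"
    "\<And>i. supported_near (c $ i) \<sigma> (K i)" "\<And>i. supported_near (c $ i) \<sigma> (K' i)" "\<And>i. supported_near (c $ i) \<sigma> (Z i)"
    "\<And>i. integral\<^sup>L lborel (K i 0) = 1"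
    "\<And>i t. K' i 0 t = K i 0 (t / l) / l"
    "\<And>i t. K i 0 t - K' i 0 t = Z i (Suc k) t"
proof -
  \<comment> \<open>The support starts with radius \<sigma> / 2 and drifts k + 1 times in
    \<open>ex_kernel_pair\<close> and once more in passing to K'; with 1 - l \<le> a these k + 2
    drifts add up to at most \<sigma> / 2. The minimum with 1 / 2 in the next line keeps l
    positive.\<close>
  define a where "a = \<sigma> / (2 * real (Suc (Suc k)) * (norm c + 1))"
  define l where "l = 1 - min (1 / 2) a"
  have nc: "norm c + 1 > 0" by (simp add: add_nonneg_pos)
  have a: "a > 0" using assms nc by (simp add: a_def)
  have l: "0 < l" "l < 1" "1 - l \<le> a" using a by (auto simp: l_def min_def)
  have drift: "real (Suc (Suc k)) * ((1 - l) * \<bar>c $ i\<bar>) \<le> \<sigma> / 2" for i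
  proof -
    have "\<bar>c $ i\<bar> \<le> norm c + 1" using component_le_norm_cart[of c i] by simp
    then have "real (Suc (Suc k)) * ((1 - l) * \<bar>c $ i\<bar>) \<le> real (Suc (Suc k)) * (a * (norm c + 1))"
      using l by (intro mult_left_mono mult_mono) auto
    also have "\<dots> = \<sigma> / 2"
    proof -
      have "N * (\<sigma> / (2 * N * B) * B) = \<sigma> / 2" if "N > 0" "B > 0" for N B :: real
        using that by (simp add: field_simps)
      then show ?thesis unfolding a_def using nc by (metis of_nat_0_less_iff zero_less_Suc)
    qed
    finally show ?thesis .
  qed
  have "\<forall>i. \<exists>K Z. deriv_seq K \<and> deriv_seq Z \<and>
    supported_near (c $ i) (\<sigma> / 2 + real (Suc k) * ((1 - l) * \<bar>c $ i\<bar>)) K \<and>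
    supported_near (c $ i) (\<sigma> / 2 + real (Suc k) * ((1 - l) * \<bar>c $ i\<bar>)) Z \<and>
    integral\<^sup>L lborel (K 0) = 1 \<and> (\<forall>y. K 0 y - K 0 (y / l) / l = Z (Suc k) y)"
    by (intro allI ex_kernel_pair l) (use assms in simp)
  then obtain K Z where KZ: "\<And>i. deriv_seq (K i)" "\<And>i. deriv_seq (Z i)"
    "\<And>i. supported_near (c $ i) (\<sigma> / 2 + real (Suc k) * ((1 - l) * \<bar>c $ i\<bar>)) (K i)"
    "\<And>i. supported_near (c $ i) (\<sigma> / 2 + real (Suc k) * ((1 - l) * \<bar>c $ i\<bar>)) (Z i)"
    "\<And>i. integral\<^sup>L lborel (K i 0) = 1" "\<And>i y. K i 0 y - K i 0 (y / l) / l = Z i (Suc k) y"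
    by metis
  define K' where "K' i n t = (1 / l) * (1 / l) ^ n * K i n ((1 / l) * t + 0)" for i n t
  have nn: "0 \<le> \<sigma> / 2 + real (Suc k) * ((1 - l) * \<bar>c $ i\<bar>)" for i
    using assms l by (intro add_nonneg_nonneg mult_nonneg_nonneg) auto
  have le: "\<sigma> / 2 + real (Suc k) * ((1 - l) * \<bar>c $ i\<bar>) + (1 - l) * \<bar>c $ i\<bar> \<le> \<sigma>" for i
    using drift[of i] by (simp add: algebra_simps)
  have le': "\<sigma> / 2 + real (Suc k) * ((1 - l) * \<bar>c $ i\<bar>) \<le> \<sigma>" for i
    using le[of i] l mult_nonneg_nonneg[of "1 - l" "\<bar>c $ i\<bar>"] by linarith
  show thesis
  proof (rule that[of l K K' Z])
    show "deriv_seq (K' i)" for i unfolding K'_def by (intro deriv_seq_affine KZ)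
    show "supported_near (c $ i) \<sigma> (K i)" "supported_near (c $ i) \<sigma> (Z i)" for i
      using KZ(3,4) le' by (blast intro: supported_near_mono)+
    show "supported_near (c $ i) \<sigma> (K' i)" for i
      unfolding supported_near_def
    proof (intro allI impI)
      fix n y assume "\<sigma> < \<bar>y - c $ i\<bar>"
      then have "\<sigma> / 2 + real (Suc k) * ((1 - l) * \<bar>c $ i\<bar>) + (1 - l) * \<bar>c $ i\<bar> < \<bar>y - c $ i\<bar>"
        using le[of i] by linarith
      from supported_near_dilation(1)[OF KZ(3) l(1,2) nn this, of n]
      show "K' i n y = 0" by (simp add: K'_def)
    qed
    show "K' i 0 t = K i 0 (t / l) / l" for i t by (simp add: K'_def)
    then show "K i 0 t - K' i 0 t = Z i (Suc k) t" for i t using KZ(6) by simp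
  qed (use l KZ in auto)
qed

text \<open>The kernel at scale s is s^k times the k-th derivative of the test function y \<mapsto>
  D((y - x) / s), so integrating by parts gains s^k. What remains lives on a cube of side 2 s
  \<sigma>, and \<open>Lp_integral_bound\<close> contributes a power of its volume.\<close>

lemma weak_deriv_scaled_bound:
  fixes D :: "'n::finite \<Rightarrow> nat \<Rightarrow> real \<Rightarrow> real"
  assumes M: "open M" and p: "1 \<le> p"
    and D: "\<And>i. deriv_seq (D i)" "\<And>i. supported_near (c $ i) \<sigma> (D i)" and \<sigma>: "\<sigma> > 0"
    and b: "\<And>z. \<bar>prod_fun D (\<lambda>_. 0) z\<bar> \<le> b"
    and s: "s > 0" and cone: "\<And>z. z \<in> cbox (c - (\<chi> i. \<sigma>)) (c + (\<chi> i. \<sigma>)) \<Longrightarrow> x + s *\<^sub>R z \<in> M"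
    and v: "v \<in> Lp M p" "has_weak_deriv M (\<lambda>i. if i = j then k else 0) g v"
  shows "\<bar>\<integral>y. prod_fun D (\<lambda>i. if i = j then k else 0) ((1 / s) *\<^sub>R (y - x)) * g y \<partial>lebesgue_on M\<bar>
    \<le> s ^ k * (b * (2 * Lp_norm M p v * ((2 * (s * \<sigma>)) ^ CARD('n)) powr (1 - inv_exponent p)))"
proof -
  let ?a = "\<lambda>i. if i = j then k else (0::nat)"
  define w where "w = prod_fun (rescale s x D) (\<lambda>_. 0)"
  have E: "\<And>i. deriv_seq (rescale s x D i)" by (intro deriv_seq_rescale D)
  have test: "test_function M w"
    unfolding w_def by (rule test_function_prod_fun_rescale[OF D s cone])
  have md: "multi_deriv ?a w = prod_fun (rescale s x D) ?a"
    unfolding w_def by (rule multi_deriv_prod_fun[OF E, of "replicate k j"]) (simp add: count_list_replicate_single)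
  have sum: "(\<Sum>i\<in>UNIV. ?a i) = k" by simp
  have "(\<integral>y. g y * multi_deriv ?a w y \<partial>lebesgue_on M) = (-1) ^ k * (\<integral>y. v y * w y \<partial>lebesgue_on M)"
    using v(2) test unfolding has_weak_deriv_def sum by blast
  moreover have "(\<integral>y. g y * multi_deriv ?a w y \<partial>lebesgue_on M) =
      (\<integral>y. prod_fun D ?a ((1 / s) *\<^sub>R (y - x)) * g y \<partial>lebesgue_on M) / s ^ k"
    unfolding md prod_fun_rescale sum by (simp add: mult.commute)
  ultimately have eq: "(\<integral>y. prod_fun D ?a ((1 / s) *\<^sub>R (y - x)) * g y \<partial>lebesgue_on M) =
      s ^ k * ((-1) ^ k * (\<integral>y. v y * w y \<partial>lebesgue_on M))"
    using s by (simp add: field_simps)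
  have "w \<in> borel_measurable borel"
    unfolding w_def by (rule borel_measurable_continuous_onI[OF continuous_prod_fun[OF E]])
  then have wm: "w \<in> borel_measurable lebesgue"
    by (intro measurable_completion) simp
  let ?A = "cbox ((x + s *\<^sub>R c) - (\<chi> i. s * \<sigma>)) ((x + s *\<^sub>R c) + (\<chi> i. s * \<sigma>))"
  have "\<bar>\<integral>y. v y * w y \<partial>lebesgue_on M\<bar> \<le> b * (2 * Lp_norm M p v * ((2 * (s * \<sigma>)) ^ CARD('n)) powr (1 - inv_exponent p))"
  proof (rule Lp_integral_bound[OF p _ v(1) _ lmeasurable_cbox])
    show "w \<in> borel_measurable (lebesgue_on M)" using wm by (rule measurable_restrict_space1)
    show "\<bar>w y\<bar> \<le> b" for y unfolding w_def prod_fun_rescale using b by simp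
    show "w y = 0" if "y \<notin> ?A" for y
    proof -
      have "(1 / s) *\<^sub>R (y - x) \<notin> cbox (c - (\<chi> i. \<sigma>)) (c + (\<chi> i. \<sigma>))"
        using that s by (auto simp: mem_box_cart field_simps)
      then show ?thesis unfolding w_def prod_fun_rescale using prod_fun_eq_0[OF D(2)] by simp
    qed
    show "measure lebesgue ?A \<le> (2 * (s * \<sigma>)) ^ CARD('n)"
      using s \<sigma> by (subst measure_cbox_cart) auto
  qed (use M s \<sigma> in auto)
  then have "s ^ k * \<bar>\<integral>y. v y * w y \<partial>lebesgue_on M\<bar> \<le>
    s ^ k * (b * (2 * Lp_norm M p v * ((2 * (s * \<sigma>)) ^ CARD('n)) powr (1 - inv_exponent p)))"
    using s by (intro mult_left_mono) auto
  then show ?thesis unfolding eq using s by (simp add: abs_mult)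
qed

lemma kernel_integrable:
  fixes D :: "'n::finite \<Rightarrow> nat \<Rightarrow> real \<Rightarrow> real"
  assumes "\<And>i. deriv_seq (D i)" "\<And>z. \<bar>prod_fun D m z\<bar> \<le> b"
    and g: "integrable (lebesgue_on M) g"
  shows "integrable (lebesgue_on M) (\<lambda>y. prod_fun D m ((1 / s) *\<^sub>R (y - x)) * g y)"
    "\<bar>\<integral>y. prod_fun D m ((1 / s) *\<^sub>R (y - x)) * g y \<partial>lebesgue_on M\<bar> \<le> b * (\<integral>y. \<bar>g y\<bar> \<partial>lebesgue_on M)"
proof -
  have "(\<lambda>y. prod_fun D m ((1 / s) *\<^sub>R (y - x))) \<in> borel_measurable borel"
    by (rule borel_measurable_continuous_onI, rule continuous_on_compose2[OF continuous_prod_fun[OF assms(1)]])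
       (auto intro!: continuous_intros)
  then have "(\<lambda>y. prod_fun D m ((1 / s) *\<^sub>R (y - x))) \<in> borel_measurable lebesgue"
    by (intro measurable_completion) simp
  then have [measurable]: "(\<lambda>y. prod_fun D m ((1 / s) *\<^sub>R (y - x))) \<in> borel_measurable (lebesgue_on M)"
    by (rule measurable_restrict_space1)
  have b: "b \<ge> 0" using assms(2)[of undefined] by linarith
  have le: "\<bar>prod_fun D m ((1 / s) *\<^sub>R (y - x)) * g y\<bar> \<le> b * \<bar>g y\<bar>" for y
    using assms(2) by (simp add: abs_mult mult_right_mono)
  show int: "integrable (lebesgue_on M) (\<lambda>y. prod_fun D m ((1 / s) *\<^sub>R (y - x)) * g y)"
    by (rule Bochner_Integration.integrable_bound[where f = "\<lambda>y. b * \<bar>g y\<bar>"]) (use g le b in auto)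
  have "\<bar>\<integral>y. prod_fun D m ((1 / s) *\<^sub>R (y - x)) * g y \<partial>lebesgue_on M\<bar> \<le>
      (\<integral>y. \<bar>prod_fun D m ((1 / s) *\<^sub>R (y - x)) * g y\<bar> \<partial>lebesgue_on M)"
    by (rule integral_abs_bound)
  also have "\<dots> \<le> (\<integral>y. b * \<bar>g y\<bar> \<partial>lebesgue_on M)"
    by (rule integral_mono) (use int g le in auto)
  finally show "\<bar>\<integral>y. prod_fun D m ((1 / s) *\<^sub>R (y - x)) * g y \<partial>lebesgue_on M\<bar> \<le> b * (\<integral>y. \<bar>g y\<bar> \<partial>lebesgue_on M)"
    by simp
qed

text \<open>
  A kernel \<open>\<kappa>\<close> supported near the axis \<open>c\<close> of an interior cone is used such that the averages of \<open>g\<close>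
  with respect to \<open>\<kappa>\<close> at the scales \<open>s\<close> and \<open>l s\<close> differ by integrals of pure \<open>k\<close>-th derivatives of \<open>g\<close>,
  of size \<open>O(s\<^sup>k\<^sup>-\<^sup>d\<^sup>/\<^sup>p)\<close>.  The telescoping sum over the scales \<open>\<rho> l\<^sup>n\<close> is a geometric series.
\<close>

lemma local_sup_bound:
  fixes M :: "(real^'n::finite) set" and c :: "real^'n"
  assumes M: "open M" and U: "open U" and p: "1 \<le> p" and \<kappa>: "\<kappa> > 0"
    and cone: "\<And>x z s. x \<in> U \<inter> M \<Longrightarrow> norm (z - c) \<le> \<kappa> \<Longrightarrow> 0 < s \<Longrightarrow> s \<le> r0 \<Longrightarrow> x + s *\<^sub>R z \<in> M"
    and k: "real k - real CARD('n) * inv_exponent p > 0"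
  shows "\<exists>C>0. \<forall>g S \<rho>. g \<in> Lp M 1 \<longrightarrow>
    (\<forall>j. \<exists>v\<in>Lp M p. has_weak_deriv M (\<lambda>i. if i = j then k else 0) g v \<and> Lp_norm M p v \<le> S) \<longrightarrow>
    0 < \<rho> \<longrightarrow> \<rho> \<le> r0 \<longrightarrow>
    (AE x in lebesgue. x \<in> U \<inter> M \<longrightarrow> \<bar>g x\<bar> \<le>
      C * (Lp_norm M 1 g / \<rho> ^ CARD('n) + \<rho> powr (real k - real CARD('n) * inv_exponent p) * S))"
proof -
  let ?d = "CARD('n)"
  define e where "e = real k - real ?d * inv_exponent p"
  have e: "e > 0" using k by (simp add: e_def)
  have "inv_exponent p \<ge> 0" using p by (cases p) auto
  then have "real ?d * inv_exponent p \<ge> 0" by (rule mult_nonneg_nonneg[OF of_nat_0_le_iff])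
  then have "k \<noteq> 0" using k by linarith
  then obtain k' where k': "k = Suc k'" by (cases k) auto
  \<comment> \<open>A cube of half-width \<kappa> / d around c lies in the ball of radius \<kappa>,
    that is, in the cone.\<close>
  define \<sigma> where "\<sigma> = \<kappa> / real ?d"
  have \<sigma>: "\<sigma> > 0" using \<kappa> by (simp add: \<sigma>_def)
  have box: "x + s *\<^sub>R z \<in> M"
    if "x \<in> U \<inter> M" "z \<in> cbox (c - (\<chi> i. \<sigma>)) (c + (\<chi> i. \<sigma>))" "0 < s" "s \<le> r0" for x z s
    using norm_le_card_of_cbox[OF that(2)] that by (intro cone) (auto simp: \<sigma>_def)
  obtain l K K' Z where l: "0 < l" "l < 1"
    and DK: "\<And>i. deriv_seq (K i)" "\<And>i. deriv_seq (K' i)" "\<And>i. deriv_seq (Z i)"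
    and sK: "\<And>i. supported_near (c $ i) \<sigma> (K i)" "\<And>i. supported_near (c $ i) \<sigma> (K' i)" "\<And>i. supported_near (c $ i) \<sigma> (Z i)"
    and iK: "\<And>i. integral\<^sup>L lborel (K i 0) = 1"
    and K': "\<And>i t. K' i 0 t = K i 0 (t / l) / l"
    and Z: "\<And>i t. K i 0 t - K' i 0 t = Z i k t"
    using ex_cart_kernel[OF \<sigma>, of c k'] unfolding k' by blast
  \<comment> \<open>Hybrids between the kernel and its dilation: the coordinates in A are already
    dilated. Adding j to A changes a single factor by K - K', the k-th derivative of Z, so the
    difference is a pure k-th derivative of \<Psi> A j.\<close>
  define \<Phi> where "\<Phi> A i = (if i \<in> A then K' i else K i)" for A i
  define \<Psi> where "\<Psi> A j i = (if i = j then Z i else \<Phi> A i)" for A j i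
  have D\<Phi>: "deriv_seq (\<Phi> A i)" "supported_near (c $ i) \<sigma> (\<Phi> A i)" for A i
    by (auto simp: \<Phi>_def DK sK)
  have D\<Psi>: "deriv_seq (\<Psi> A j i)" "supported_near (c $ i) \<sigma> (\<Psi> A j i)" for A j i
    by (auto simp: \<Psi>_def DK sK D\<Phi>)
  have "\<exists>b. b > 0 \<and> (\<forall>z. \<bar>prod_fun (\<Psi> A j) (\<lambda>_. 0) z\<bar> \<le> b)" for A j
    by (rule prod_fun_bounded[of "\<Psi> A j" c \<sigma> "\<lambda>_. 0", OF D\<Psi>]) auto
  note ex\<Psi> = someI_ex[OF this]
  define bb where "bb A j = (SOME b. b > 0 \<and> (\<forall>z. \<bar>prod_fun (\<Psi> A j) (\<lambda>_. 0) z\<bar> \<le> b))" for A j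
  have bb: "bb A j > 0" "\<bar>prod_fun (\<Psi> A j) (\<lambda>_. 0) z\<bar> \<le> bb A j" for A j z
    using ex\<Psi>[of A j] unfolding bb_def by blast+
  \<comment> \<open>There are finitely many A and j; the sum is one bound for all hybrids.\<close>
  define b where "b = (\<Sum>A\<in>UNIV. \<Sum>j\<in>UNIV. bb A j)"
  have bbb: "bb A j \<le> b" for A j
  proof -
    have "bb A j \<le> (\<Sum>j\<in>UNIV. bb A j)"
      by (rule member_le_sum) (use bb(1) in \<open>auto intro: less_imp_le\<close>)
    also have "\<dots> \<le> b" unfolding b_def
      by (rule member_le_sum) (use bb(1) in \<open>auto intro!: sum_nonneg intro: less_imp_le\<close>)
    finally show ?thesis .
  qed
  have b: "b > 0" using bb(1)[of undefined undefined] bbb[of undefined undefined] by linarith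
  have bound\<Psi>: "\<bar>prod_fun (\<Psi> A j) (\<lambda>_. 0) z\<bar> \<le> b" for A j z
    using bb(2)[of A j z] bbb[of A j] by linarith
  have "\<exists>b. b > 0 \<and> (\<forall>z. \<bar>prod_fun (\<Phi> A) (\<lambda>_. 0) z\<bar> \<le> b)" for A
    by (rule prod_fun_bounded[of "\<Phi> A" c \<sigma> "\<lambda>_. 0", OF D\<Phi>]) auto
  note ex\<Phi> = someI_ex[OF this]
  define b0 where "b0 A = (SOME b. b > 0 \<and> (\<forall>z. \<bar>prod_fun (\<Phi> A) (\<lambda>_. 0) z\<bar> \<le> b))" for A
  have b0: "b0 A > 0" "\<bar>prod_fun (\<Phi> A) (\<lambda>_. 0) z\<bar> \<le> b0 A" for A z
    using ex\<Phi>[of A] unfolding b0_def by blast+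
  have diff: "prod_fun (\<Phi> A) (\<lambda>_. 0) z - prod_fun (\<Phi> (insert j A)) (\<lambda>_. 0) z =
      prod_fun (\<Psi> A j) (\<lambda>i. if i = j then k else 0) z" if "j \<notin> A" for A j z
  proof -
    have P: "prod_fun (\<Phi> A) (\<lambda>_. 0) z = K j 0 (z $ j) * (\<Prod>i\<in>UNIV - {j}. \<Phi> A i 0 (z $ i))"
      unfolding prod_fun_def by (subst prod.remove[of UNIV j]) (use that in \<open>auto simp: \<Phi>_def\<close>)
    have Q: "prod_fun (\<Phi> (insert j A)) (\<lambda>_. 0) z = K' j 0 (z $ j) * (\<Prod>i\<in>UNIV - {j}. \<Phi> A i 0 (z $ i))"
      unfolding prod_fun_def by (subst prod.remove[of UNIV j]) (auto simp: \<Phi>_def intro!: prod.cong)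
    have R: "prod_fun (\<Psi> A j) (\<lambda>i. if i = j then k else 0) z = Z j k (z $ j) * (\<Prod>i\<in>UNIV - {j}. \<Phi> A i 0 (z $ i))"
      unfolding prod_fun_def by (subst prod.remove[of UNIV j]) (auto simp: \<Psi>_def intro!: prod.cong)
    show ?thesis unfolding P Q R Z[symmetric] by (simp add: left_diff_distrib)
  qed
  define I where "I A s g x = (\<integral>y. prod_fun (\<Phi> A) (\<lambda>_. 0) ((1 / s) *\<^sub>R (y - x)) * g y \<partial>lebesgue_on M)" for A s g x
  define C1 where "C1 = real ?d * (b * (2 * ((2 * \<sigma>) ^ ?d) powr (1 - inv_exponent p)))"
  have C1: "C1 > 0" using b \<sigma> by (simp add: C1_def)
  \<comment> \<open>With every coordinate dilated the hybrid is the original kernel at scale l s;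
    the factor l^d disappears in J, which divides by the d-th power of the scale.\<close>
  have dil: "I UNIV s g x = I {} (l * s) g x / l ^ ?d" if "s > 0" for s g x
  proof -
    have "prod_fun (\<Phi> UNIV) (\<lambda>_. 0) ((1 / s) *\<^sub>R (y - x)) = prod_fun (\<Phi> {}) (\<lambda>_. 0) ((1 / (l * s)) *\<^sub>R (y - x)) / l ^ ?d" for y
    proof -
      have "prod_fun (\<Phi> UNIV) (\<lambda>_. 0) ((1 / s) *\<^sub>R (y - x)) = (\<Prod>i\<in>UNIV. K i 0 (((1 / (l * s)) *\<^sub>R (y - x)) $ i) / l)"
        unfolding prod_fun_def by (intro prod.cong refl) (simp add: \<Phi>_def K' diff_divide_distrib mult.commute)
      then show ?thesis by (simp add: prod_dividef prod_fun_def \<Phi>_def)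
    qed
    then show ?thesis by (simp add: I_def)
  qed
  show ?thesis
  proof (intro exI[of _ "b0 {} + C1 / (1 - l powr e)"] conjI allI impI)
    have le1: "l powr e < 1" using l e powr_less_mono2[of e l 1] by simp
    show "0 < b0 {} + C1 / (1 - l powr e)"
      using b0(1) C1 le1 by (intro add_pos_pos) auto
    fix g S \<rho>
    assume g: "g \<in> Lp M 1"
      and S: "\<forall>j. \<exists>v\<in>Lp M p. has_weak_deriv M (\<lambda>i. if i = j then k else 0) g v \<and> Lp_norm M p v \<le> S"
      and \<rho>: "0 < \<rho>" "\<rho> \<le> r0"
    have S0: "S \<ge> 0" using S Lp_norm_nonneg by (meson order_trans)
    have gi: "integrable (lebesgue_on M) g" by (rule Lp_1_integrable[OF g])
    have ki: "integrable (lebesgue_on M) (\<lambda>y. prod_fun (\<Phi> A) (\<lambda>_. 0) ((1 / s) *\<^sub>R (y - x)) * g y)" for A s x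
      by (rule kernel_integrable(1)[of "\<Phi> A", OF D\<Phi>(1) b0(2) gi])
    have step: "\<bar>I A s g x - I (insert j A) s g x\<bar> \<le> s ^ k * (b * (2 * S * ((2 * (s * \<sigma>)) ^ ?d) powr (1 - inv_exponent p)))"
      if "j \<notin> A" and x: "x \<in> U \<inter> M" and s: "0 < s" "s \<le> r0" for A j s x
    proof -
      obtain v where v: "v \<in> Lp M p" "has_weak_deriv M (\<lambda>i. if i = j then k else 0) g v" "Lp_norm M p v \<le> S"
        using S by blast
      have "I A s g x - I (insert j A) s g x =
          (\<integral>y. prod_fun (\<Psi> A j) (\<lambda>i. if i = j then k else 0) ((1 / s) *\<^sub>R (y - x)) * g y \<partial>lebesgue_on M)"
        unfolding I_def diff[OF \<open>j \<notin> A\<close>, symmetric]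
        by (simp add: left_diff_distrib Bochner_Integration.integral_diff ki)
      moreover have "\<bar>\<integral>y. prod_fun (\<Psi> A j) (\<lambda>i. if i = j then k else 0) ((1 / s) *\<^sub>R (y - x)) * g y \<partial>lebesgue_on M\<bar>
          \<le> s ^ k * (b * (2 * Lp_norm M p v * ((2 * (s * \<sigma>)) ^ ?d) powr (1 - inv_exponent p)))"
        by (rule weak_deriv_scaled_bound[of M p "\<Psi> A j", OF M p D\<Psi> \<sigma> bound\<Psi> s(1) _ v(1,2)]) (use box x s in auto)
      moreover have "s ^ k * (b * (2 * Lp_norm M p v * ((2 * (s * \<sigma>)) ^ ?d) powr (1 - inv_exponent p))) \<le>
          s ^ k * (b * (2 * S * ((2 * (s * \<sigma>)) ^ ?d) powr (1 - inv_exponent p)))"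
        using v(3) s b by (intro mult_left_mono mult_right_mono) auto
      ultimately show ?thesis by linarith
    qed
    have hybrid: "\<bar>I {} s g x - I A s g x\<bar> \<le> real (card A) * (s ^ k * (b * (2 * S * ((2 * (s * \<sigma>)) ^ ?d) powr (1 - inv_exponent p))))"
      if x: "x \<in> U \<inter> M" and s: "0 < s" "s \<le> r0" for A s x
    proof -
      have "finite A" by simp
      then show ?thesis
      proof (induction A)
        case (insert j A)
        from step[OF insert.hyps(2) x s] insert.IH insert.hyps show ?case
          by (simp add: algebra_simps abs_le_iff)
      qed simp
    qed
    define J where "J s x = I {} s g x / s ^ ?d" for s x
    have J: "\<bar>J s x - J (l * s) x\<bar> \<le> C1 * S * s powr e" if x: "x \<in> U \<inter> M" and s: "0 < s" "s \<le> r0" for s x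
    proof -
      have "J s x - J (l * s) x = (I {} s g x - I UNIV s g x) / s ^ ?d"
        unfolding dil[OF s(1)] J_def using l s by (simp add: power_mult_distrib diff_divide_distrib)
      then have "\<bar>J s x - J (l * s) x\<bar> = \<bar>I {} s g x - I UNIV s g x\<bar> / s ^ ?d"
        using s by (simp add: abs_divide)
      also have "\<dots> \<le> real ?d * (s ^ k * (b * (2 * S * ((2 * (s * \<sigma>)) ^ ?d) powr (1 - inv_exponent p)))) / s ^ ?d"
        using hybrid[OF x s, of UNIV] s by (intro divide_right_mono) auto
      also have "\<dots> = C1 * S * s powr e"
      proof -
        \<comment> \<open>Powers of s: d (1 - 1/p) from the volume of the cube, k from the
          derivatives and -d from the normalisation, in total e.\<close>
        define t where "t = 1 - inv_exponent p"
        have A: "((2 * (s * \<sigma>)) ^ ?d) powr t = ((2 * \<sigma>) ^ ?d) powr t * (s ^ ?d) powr t"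
          using s \<sigma> by (simp add: powr_mult[symmetric] power_mult_distrib mult_ac)
        have "(s ^ ?d) powr t * s ^ k / s ^ ?d = s powr (real ?d * t + real k - real ?d)"
          using s by (simp only: powr_realpow[OF s(1), symmetric] powr_powr powr_add[symmetric] powr_diff[symmetric])
        also have "real ?d * t + real k - real ?d = e"
          by (simp add: e_def t_def algebra_simps)
        finally have B: "(s ^ ?d) powr t * s ^ k / s ^ ?d = s powr e" .
        have "real ?d * (s ^ k * (b * (2 * S * ((2 * (s * \<sigma>)) ^ ?d) powr t))) / s ^ ?d =
            real ?d * (b * (2 * ((2 * \<sigma>) ^ ?d) powr t)) * S * ((s ^ ?d) powr t * s ^ k / s ^ ?d)"
          unfolding A by simp
        then show ?thesis unfolding B C1_def t_def[symmetric] .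
      qed
      finally show ?thesis .
    qed
    \<comment> \<open>The first summand bounds the average at the coarsest scale \<rho> by the L^1
      norm alone; the second bounds the sum of all increments.\<close>
    define B where "B = b0 {} * (Lp_norm M 1 g / \<rho> ^ ?d) + C1 * S * \<rho> powr e / (1 - l powr e)"
    have Jn: "\<bar>J (\<rho> * l ^ n) x\<bar> \<le> B" if x: "x \<in> U \<inter> M" for n x
    proof -
      have "\<bar>J (\<rho> * l ^ n) x\<bar> \<le> b0 {} * (Lp_norm M 1 g / \<rho> ^ ?d) + C1 * S * \<rho> powr e * (\<Sum>i<n. (l powr e) ^ i)"
      proof (induction n)
        case 0
        have "\<bar>I {} \<rho> g x\<bar> \<le> b0 {} * Lp_norm M 1 g"
          unfolding I_def Lp_norm_1_eq by (rule kernel_integrable(2)[of "\<Phi> {}", OF D\<Phi>(1) b0(2) gi])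
        then show ?case using \<rho> by (simp add: J_def abs_divide divide_right_mono)
      next
        case (Suc n)
        have ln: "0 < l ^ n" "l ^ n \<le> 1" using l by (auto intro: power_le_one)
        have le: "\<rho> * l ^ n \<le> r0" using ln \<rho> by (meson mult_left_le less_imp_le order_trans)
        have "\<bar>J (\<rho> * l ^ n) x - J (l * (\<rho> * l ^ n)) x\<bar> \<le> C1 * S * (\<rho> * l ^ n) powr e"
          by (rule J[OF x _ le]) (use \<rho> ln in simp)
        also have "(\<rho> * l ^ n) powr e = \<rho> powr e * (l powr e) ^ n"
          using \<rho> l by (simp add: powr_mult powr_realpow[symmetric] powr_powr mult.commute)
        finally show ?case using Suc by (simp add: algebra_simps abs_le_iff)
      qed
      also have "\<dots> \<le> B"
      proof -
        have "(\<Sum>i<n. (l powr e) ^ i) \<le> 1 / (1 - l powr e)"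
          using le1 by (simp add: sum_gp_strict divide_right_mono)
        then have "C1 * S * \<rho> powr e * (\<Sum>i<n. (l powr e) ^ i) \<le> C1 * S * \<rho> powr e * (1 / (1 - l powr e))"
          using C1 S0 by (intro mult_left_mono) auto
        then show ?thesis by (simp add: B_def)
      qed
      finally show ?thesis .
    qed
    have "set_integrable lebesgue M g"
      using gi M by (subst (asm) integrable_restrict_space) (auto simp: set_integrable_def)
    then obtain g0 where g0: "integrable lborel g0" "AE x in lebesgue. x \<in> M \<longrightarrow> g0 x = g x"
      "\<And>f. f \<in> borel_measurable borel \<Longrightarrow> (\<integral>x. f x * g0 x \<partial>lborel) = (\<integral>x. f x * g x \<partial>lebesgue_on M)"
      using borel_representative[of M g] M by auto
    have mean: "local_mean (prod_fun (\<Phi> {}) (\<lambda>_. 0)) s g0 x = J s x" for s x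
    proof -
      have "(\<lambda>y. prod_fun (\<Phi> {}) (\<lambda>_. 0) ((1 / s) *\<^sub>R (y - x))) \<in> borel_measurable borel"
        by (rule borel_measurable_continuous_onI, rule continuous_on_compose2[OF continuous_prod_fun[of "\<Phi> {}", OF D\<Phi>(1)]])
           (auto intro!: continuous_intros)
      from g0(3)[OF this] show ?thesis by (simp add: local_mean_def J_def I_def)
    qed
    have mean': "local_mean (prod_fun (\<Phi> {}) (\<lambda>_. 0)) s (\<lambda>x. - g0 x) x = - J s x" for s x
      using mean[of s x] by (simp add: local_mean_def)
    have s: "\<rho> * l ^ n > 0" for n using \<rho> l by simp
    have s0: "(\<lambda>n. \<rho> * l ^ n) \<longlonglongrightarrow> 0"
      using l by (intro tendsto_mult_right_zero LIMSEQ_power_zero) auto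
    have i1: "integral\<^sup>L lborel (\<Phi> {} i 0) = 1" for i by (simp add: \<Phi>_def iK)
    note AE = AE_bounded_by_local_mean_le[OF _ open_Int[OF U M] prod_fun_integrable[of "\<Phi> {}", OF D\<Phi>] b0(2) integral_prod_fun[of "\<Phi> {}", OF D\<Phi> i1] s s0]
    have 1: "AE x in lborel. x \<in> U \<inter> M \<longrightarrow> g0 x \<le> B"
      by (rule AE[OF g0(1)], unfold mean) (use Jn abs_le_D1 in blast)
    have 2: "AE x in lborel. x \<in> U \<inter> M \<longrightarrow> - g0 x \<le> B"
      by (rule AE, unfold mean') (use g0(1) Jn abs_le_D2 in \<open>auto\<close>)
    have BC: "B \<le> (b0 {} + C1 / (1 - l powr e)) * (Lp_norm M 1 g / \<rho> ^ ?d + \<rho> powr e * S)"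
    proof -
      have "Lp_norm M 1 g / \<rho> ^ ?d \<ge> 0" "\<rho> powr e * S \<ge> 0" "b0 {} \<ge> 0" "C1 / (1 - l powr e) \<ge> 0"
        using Lp_norm_nonneg[OF g] \<rho> S0 b0(1)[of "{}"] C1 le1 by auto
      then have "b0 {} * (\<rho> powr e * S) \<ge> 0" "C1 / (1 - l powr e) * (Lp_norm M 1 g / \<rho> ^ ?d) \<ge> 0"
        by (metis mult_nonneg_nonneg)+
      moreover have "B = b0 {} * (Lp_norm M 1 g / \<rho> ^ ?d) + C1 / (1 - l powr e) * (\<rho> powr e * S)"
        by (simp add: B_def mult_ac)
      ultimately show ?thesis by (simp only: distrib_left distrib_right)
    qed
    show "AE x in lebesgue. x \<in> U \<inter> M \<longrightarrow> \<bar>g x\<bar> \<le> (b0 {} + C1 / (1 - l powr e)) *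
        (Lp_norm M 1 g / \<rho> ^ ?d + \<rho> powr (real k - real ?d * inv_exponent p) * S)"
      using AE_completion[OF 1] AE_completion[OF 2] g0(2)
    proof eventually_elim
      case (elim x)
      show ?case
      proof
        assume "x \<in> U \<inter> M"
        then have "\<bar>g x\<bar> \<le> B" using elim by auto
        then show "\<bar>g x\<bar> \<le> (b0 {} + C1 / (1 - l powr e)) *
            (Lp_norm M 1 g / \<rho> ^ ?d + \<rho> powr (real k - real ?d * inv_exponent p) * S)"
          using BC by (simp add: e_def)
      qed
    qed
  qed
qed

section \<open>Small sets in Lipschitz domains\<close>

text \<open>In a chart the cone is taken around the vertical axis e: moving by s z raises the height
  by at least s (1 - \<kappa>), while the Lipschitz graph rises by at most L s \<kappa>. The axis is
  that of the chart, so one c serves all y near x. At interior points c = 0.\<close>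

lemma lipschitz_domain_local_cone:
  fixes M :: "'a::euclidean_space set"
  assumes M: "bounded_lipschitz_domain M" and x: "x \<in> closure M"
  shows "\<exists>c \<kappa> r r0. \<kappa> > 0 \<and> r > 0 \<and> r0 > 0 \<and>
    (\<forall>y z s. y \<in> ball x r \<inter> M \<longrightarrow> norm (z - c) \<le> \<kappa> \<longrightarrow> 0 < s \<longrightarrow> s \<le> r0 \<longrightarrow> y + s *\<^sub>R z \<in> M)"
proof (cases "x \<in> M")
  case True
  have "open M" using M by (simp add: bounded_lipschitz_domain_def)
  then obtain e where e: "e > 0" "ball x e \<subseteq> M" using True open_contains_ball by blast
  have "y + s *\<^sub>R z \<in> M" if "y \<in> ball x (e / 2) \<inter> M" "norm (z - 0) \<le> 1" "0 < s" "s \<le> e / 2" for y z s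
  proof -
    have "norm (s *\<^sub>R z) \<le> e / 2 * 1"
      unfolding norm_scaleR using that e by (intro mult_mono) auto
    moreover have "dist x (y + s *\<^sub>R z) \<le> dist x y + norm (s *\<^sub>R z)"
      by (metis add.commute dist_commute dist_norm dist_triangle add_diff_cancel_left')
    ultimately have "y + s *\<^sub>R z \<in> ball x e" using that(1) by simp
    then show ?thesis using e by auto
  qed
  then show ?thesis
    using e by - (rule exI[of _ 0], rule exI[of _ 1], rule exI[of _ "e / 2"], rule exI[of _ "e / 2"], auto)
next
  case False
  have "open M" using M by (simp add: bounded_lipschitz_domain_def)
  then have "x \<in> frontier M" using x False by (simp add: frontier_def interior_open)
  with M[unfolded bounded_lipschitz_domain_def, THEN conjunct2, THEN conjunct2, THEN conjunct2, THEN conjunct2]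
  have "\<exists>e r L h. norm e = 1 \<and> 0 < r \<and> L-lipschitz_on {z. z \<bullet> e = 0} h \<and>
      M \<inter> ball x r = {y \<in> ball x r. (h :: 'a \<Rightarrow> real) (y - (y \<bullet> e) *\<^sub>R e) < y \<bullet> e}"
    by (rule bspec)
  then obtain e r L h where e: "norm e = 1" and r: "0 < r" and h: "L-lipschitz_on {z. z \<bullet> e = 0} h"
    and chart: "M \<inter> ball x r = {y \<in> ball x r. (h :: 'a \<Rightarrow> real) (y - (y \<bullet> e) *\<^sub>R e) < y \<bullet> e}"
    by blast
  have ee: "e \<bullet> e = 1" using e by (simp add: norm_eq_1)
  define \<pi> where "\<pi> w = w - (w \<bullet> e) *\<^sub>R e" for w
  have \<pi>0: "\<pi> w \<bullet> e = 0" for w by (simp add: \<pi>_def inner_diff_left ee)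
  have \<pi>_norm: "norm (\<pi> w) \<le> norm w" for w
  proof -
    have "\<pi> w \<bullet> \<pi> w = w \<bullet> w - (w \<bullet> e) * (w \<bullet> e)"
      by (simp add: \<pi>_def inner_diff_left inner_diff_right ee inner_commute algebra_simps)
    then have "\<pi> w \<bullet> \<pi> w \<le> w \<bullet> w" by simp
    then show ?thesis by (simp add: norm_le)
  qed
  have L: "L \<ge> 0" using h by (rule lipschitz_on_nonneg)
  \<comment> \<open>The solution of L * \<kappa> = 1 - \<kappa>: the graph rises no faster than the
    moving point.\<close>
  define \<kappa> where "\<kappa> = 1 / (L + 1)"
  have \<kappa>: "\<kappa> > 0" "\<kappa> \<le> 1" "L * \<kappa> = 1 - \<kappa>" using L by (auto simp: \<kappa>_def field_simps)
  have "y + s *\<^sub>R z \<in> M" if y: "y \<in> ball x (r / 2) \<inter> M" and z: "norm (z - e) \<le> \<kappa>" and s: "0 < s" "s \<le> r / 4" for y z s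
  proof -
    \<comment> \<open>With norm z \<le> 2 and s \<le> r / 4 the step has length at most r / 2, and
      the point stays in the chart.\<close>
    have "norm z \<le> norm (z - e) + norm e" by (metis diff_add_cancel norm_triangle_ineq)
    then have "norm z \<le> 2" using z e \<kappa> by simp
    then have "norm (s *\<^sub>R z) \<le> r / 4 * 2"
      unfolding norm_scaleR using s r by (intro mult_mono) auto
    moreover have "dist x (y + s *\<^sub>R z) \<le> dist x y + norm (s *\<^sub>R z)"
      by (metis add.commute dist_commute dist_norm dist_triangle add_diff_cancel_left')
    ultimately have ball: "y + s *\<^sub>R z \<in> ball x r" using y by simp
    have "y \<in> M \<inter> ball x r" using y r by auto
    then have hy: "h (\<pi> y) < y \<bullet> e" unfolding chart by (simp add: \<pi>_def)
    have lin: "\<pi> (y + s *\<^sub>R z) = \<pi> y + s *\<^sub>R \<pi> z" "\<pi> z = \<pi> (z - e)"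
      by (auto simp: \<pi>_def algebra_simps inner_diff_left ee)
    have "dist (h (\<pi> (y + s *\<^sub>R z))) (h (\<pi> y)) \<le> L * dist (\<pi> (y + s *\<^sub>R z)) (\<pi> y)"
      by (rule lipschitz_onD[OF h]) (auto simp: \<pi>0)
    also have "dist (\<pi> (y + s *\<^sub>R z)) (\<pi> y) = s * norm (\<pi> z)"
      using s by (simp add: dist_norm lin(1))
    also have "L * (s * norm (\<pi> z)) \<le> L * (s * \<kappa>)"
      unfolding lin(2) using L s order_trans[OF \<pi>_norm z] by (intro mult_left_mono) auto
    also have "L * (s * \<kappa>) = s * (L * \<kappa>)" by simp
    also have "s * (L * \<kappa>) = s * (1 - \<kappa>)" by (simp only: \<kappa>(3))
    finally have "h (\<pi> (y + s *\<^sub>R z)) \<le> h (\<pi> y) + s * (1 - \<kappa>)" by (simp add: dist_real_def)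
    also have "\<dots> < y \<bullet> e + s * (1 - \<kappa>)" using hy by simp
    also have "\<dots> \<le> y \<bullet> e + s * (z \<bullet> e)"
    proof -
      have "\<bar>(z - e) \<bullet> e\<bar> \<le> norm (z - e) * norm e" by (rule Cauchy_Schwarz_ineq2)
      then have "1 - \<kappa> \<le> z \<bullet> e" using z e by (simp add: inner_diff_left ee)
      then show ?thesis using s by simp
    qed
    finally have "y + s *\<^sub>R z \<in> M \<inter> ball x r"
      using ball unfolding chart by (simp add: \<pi>_def inner_add_left)
    then show ?thesis by auto
  qed
  then show ?thesis
    using \<kappa> r by - (rule exI[of _ e], rule exI[of _ \<kappa>], rule exI[of _ "r / 2"], rule exI[of _ "r / 4"], auto)
qed

text \<open>Compactness of \<open>closure M\<close>: finitely many neighbourhoods with local cones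
  cover it, boundary included. The smallest of their scales and the sum of their constants work for
  all of M.\<close>

lemma sup_bound:
  fixes M :: "(real^'n::finite) set"
  assumes M: "bounded_lipschitz_domain M" and p: "1 \<le> p"
    and k: "real k - real CARD('n) * inv_exponent p > 0"
  shows "\<exists>C>0. \<exists>r0>0. \<forall>g S \<rho>. g \<in> Lp M 1 \<longrightarrow>
    (\<forall>j. \<exists>v\<in>Lp M p. has_weak_deriv M (\<lambda>i. if i = j then k else 0) g v \<and> Lp_norm M p v \<le> S) \<longrightarrow>
    0 < \<rho> \<longrightarrow> \<rho> \<le> r0 \<longrightarrow>
    (AE x in lebesgue. x \<in> M \<longrightarrow> \<bar>g x\<bar> \<le>
      C * (Lp_norm M 1 g / \<rho> ^ CARD('n) + \<rho> powr (real k - real CARD('n) * inv_exponent p) * S))"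
proof -
  have oM: "open M" and "bounded M" and ne: "M \<noteq> {}"
    using M by (auto simp: bounded_lipschitz_domain_def)
  let ?bd = "\<lambda>g S \<rho>. Lp_norm M 1 g / \<rho> ^ CARD('n) + \<rho> powr (real k - real CARD('n) * inv_exponent p) * S"
  let ?hyp = "\<lambda>g S. g \<in> Lp M 1 \<and> (\<forall>j. \<exists>v\<in>Lp M p. has_weak_deriv M (\<lambda>i. if i = j then k else 0) g v \<and> Lp_norm M p v \<le> S)"
  let ?Q = "\<lambda>x r r0 C. r > 0 \<and> r0 > 0 \<and> C > 0 \<and> (\<forall>g S \<rho>. ?hyp g S \<longrightarrow> 0 < \<rho> \<longrightarrow> \<rho> \<le> r0 \<longrightarrow>
      (AE y in lebesgue. y \<in> ball x r \<inter> M \<longrightarrow> \<bar>g y\<bar> \<le> C * ?bd g S \<rho>))"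
  \<comment> \<open>Radius, largest scale and constant are packed into one triple, so that
    \<open>bchoice\<close> yields all three at once.\<close>
  have "\<exists>t. ?Q x (fst t) (fst (snd t)) (snd (snd t))" if x: "x \<in> closure M" for x
  proof -
    obtain c \<kappa> r r0 where c: "\<kappa> > 0" "r > 0" "r0 > 0"
      "\<And>y z s. y \<in> ball x r \<inter> M \<Longrightarrow> norm (z - c) \<le> \<kappa> \<Longrightarrow> 0 < s \<Longrightarrow> s \<le> r0 \<Longrightarrow> y + s *\<^sub>R z \<in> M"
      using lipschitz_domain_local_cone[OF M x] by blast
    from local_sup_bound[OF oM open_ball p c(1) c(4) k] obtain C where C: "C > 0 \<and> (\<forall>g S \<rho>. g \<in> Lp M 1 \<longrightarrow>
        (\<forall>j. \<exists>v\<in>Lp M p. has_weak_deriv M (\<lambda>i. if i = j then k else 0) g v \<and> Lp_norm M p v \<le> S) \<longrightarrow>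
        0 < \<rho> \<longrightarrow> \<rho> \<le> r0 \<longrightarrow> (AE y in lebesgue. y \<in> ball x r \<inter> M \<longrightarrow> \<bar>g y\<bar> \<le> C * ?bd g S \<rho>))"
      by (rule exE)
    show ?thesis
      by (rule exI[of _ "(r, r0, C)"], unfold fst_conv snd_conv, intro conjI c(2,3) C[THEN conjunct1])
         (use C in blast)
  qed
  then have "\<forall>x\<in>closure M. \<exists>t. ?Q x (fst t) (fst (snd t)) (snd (snd t))" by (rule ballI)
  from bchoice[OF this] obtain f where f: "\<forall>x\<in>closure M. ?Q x (fst (f x)) (fst (snd (f x))) (snd (snd (f x)))"
    by (rule exE)
  define r where "r x = fst (f x)" for x
  define r0 where "r0 x = fst (snd (f x))" for x
  define C where "C x = snd (snd (f x))" for x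
  have Q: "?Q x (r x) (r0 x) (C x)" if "x \<in> closure M" for x
    unfolding r_def r0_def C_def using f that by (rule bspec)
  have rC: "r x > 0" "r0 x > 0" "C x > 0" if "x \<in> closure M" for x
    using Q[OF that] by blast+
  have "compact (closure M)" using \<open>bounded M\<close> by (simp add: compact_closure)
  moreover have "closure M \<subseteq> (\<Union>x\<in>closure M. ball x (r x))" using rC(1) by force
  ultimately obtain D where D: "D \<subseteq> closure M" "finite D" "closure M \<subseteq> (\<Union>x\<in>D. ball x (r x))"
    using compactE_image[of "closure M" "closure M" "\<lambda>x. ball x (r x)"] by auto
  have Dne: "D \<noteq> {}" using D(3) ne closure_subset[of M] by auto
  define R where "R = Min (r0 ` D)"
  define CC where "CC = (\<Sum>x\<in>D. C x)"
  have R: "R > 0" "\<And>x. x \<in> D \<Longrightarrow> R \<le> r0 x"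
    unfolding R_def using D Dne rC(2) by (auto simp: subset_iff)
  have CC: "CC > 0" unfolding CC_def using D Dne rC(3) by (intro sum_pos) auto
  have CCx: "C x \<le> CC" if "x \<in> D" for x
    unfolding CC_def using that D rC(3) by (intro member_le_sum) (auto intro: less_imp_le)
  show ?thesis
  proof (rule exI[of _ CC], rule conjI[OF CC], rule exI[of _ R], rule conjI[OF R(1)], intro allI impI)
    fix g S \<rho>
    assume g: "g \<in> Lp M 1" and S: "\<forall>j. \<exists>v\<in>Lp M p. has_weak_deriv M (\<lambda>i. if i = j then k else 0) g v \<and> Lp_norm M p v \<le> S"
      and \<rho>: "0 < \<rho>" "\<rho> \<le> R"
    have S0: "S \<ge> 0" using S Lp_norm_nonneg by (meson order_trans)
    have bd: "?bd g S \<rho> \<ge> 0"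
      using S0 \<rho> Lp_norm_nonneg[OF g] by (intro add_nonneg_nonneg) auto
    have "AE y in lebesgue. \<forall>x\<in>D. y \<in> ball x (r x) \<inter> M \<longrightarrow> \<bar>g y\<bar> \<le> C x * ?bd g S \<rho>"
      unfolding AE_ball_countable[OF countable_finite[OF D(2)]]
    proof (intro ballI)
      fix x assume x: "x \<in> D"
      show "AE y in lebesgue. y \<in> ball x (r x) \<inter> M \<longrightarrow> \<bar>g y\<bar> \<le> C x * ?bd g S \<rho>"
        by (rule Q[THEN conjunct2, THEN conjunct2, THEN conjunct2, rule_format])
           (use x D(1) g S \<rho> order_trans[OF \<rho>(2) R(2)[OF x]] in auto)
    qed
    then show "AE y in lebesgue. y \<in> M \<longrightarrow> \<bar>g y\<bar> \<le> CC * ?bd g S \<rho>"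
    proof eventually_elim
      case (elim y)
      show ?case
      proof
        assume y: "y \<in> M"
        then obtain x where x: "x \<in> D" "y \<in> ball x (r x)" using D(3) closure_subset by blast
        then have "\<bar>g y\<bar> \<le> C x * ?bd g S \<rho>" using elim y by blast
        also have "\<dots> \<le> CC * ?bd g S \<rho>" using CCx[OF x(1)] bd by (rule mult_right_mono)
        finally show "\<bar>g y\<bar> \<le> CC * ?bd g S \<rho>" .
      qed
    qed
  qed
qed

section \<open>From pointwise bounds to integrals over small sets\<close>

lemma integral_on_small_set_le:
  fixes g :: "'a::euclidean_space \<Rightarrow> real"
  assumes M: "M \<in> sets lebesgue" and P: "P \<in> sets borel" "P \<subseteq> M" and bdd: "bounded M"
    and m: "measure lebesgue P \<le> \<eta>" and B: "AE x in lebesgue. x \<in> M \<longrightarrow> \<bar>g x\<bar> \<le> B" and "B \<ge> 0"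
  shows "(\<integral>x. indicator P x * \<bar>g x\<bar> \<partial>lebesgue_on M) \<le> \<eta> * B"
proof -
  \<comment> \<open>Finiteness matters: \<open>measure\<close> is 0 on sets of infinite measure, and
    the bound by \<eta> would then say nothing about P.\<close>
  have Pl: "P \<in> lmeasurable"
    using P bdd by (intro bounded_set_imp_lmeasurable) (auto intro: bounded_subset)
  have iP: "integrable lebesgue (\<lambda>x. indicat_real P x)"
    using Pl by (auto simp: fmeasurable_def intro!: integrable_real_indicator)
  have "(\<integral>x. indicator P x * \<bar>g x\<bar> \<partial>lebesgue_on M) = (\<integral>x. indicator M x *\<^sub>R (indicator P x * \<bar>g x\<bar>) \<partial>lebesgue)"
    by (rule integral_restrict_space) (use M in simp)
  also have "\<dots> \<le> (\<integral>x. B * indicat_real P x \<partial>lebesgue)"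
  proof (rule integral_mono_AE')
    show "integrable lebesgue (\<lambda>x. B * indicat_real P x)" using iP by simp
    show "AE x in lebesgue. indicator M x *\<^sub>R (indicator P x * \<bar>g x\<bar>) \<le> B * indicat_real P x"
      using B by eventually_elim (use P \<open>B \<ge> 0\<close> in \<open>auto simp: indicator_def\<close>)
    show "AE x in lebesgue. 0 \<le> B * indicat_real P x" using \<open>B \<ge> 0\<close> by simp
  qed
  also have "\<dots> = B * measure lebesgue P" using Pl by simp
  also have "\<dots> \<le> B * \<eta>" using m \<open>B \<ge> 0\<close> by (rule mult_left_mono)
  finally show ?thesis by (simp add: mult.commute)
qed

lemma finite_multi_indices: "finite {a :: 'n::finite \<Rightarrow> nat. (\<Sum>i\<in>UNIV. a i) = k}"
proof (rule finite_subset)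
  show "{a :: 'n \<Rightarrow> nat. (\<Sum>i\<in>UNIV. a i) = k} \<subseteq> (\<Pi>\<^sub>E i\<in>UNIV. {..k})"
    by (auto intro: member_le_sum)
qed (auto intro: finite_PiE)

lemma weak_deriv_norm_le_seminorm:
  fixes M :: "(real^'n::finite) set"
  assumes p: "1 \<le> p" and a: "(\<Sum>i\<in>UNIV. a i) = k" and nn: "Lp_norm M p (weak_deriv M a u) \<ge> 0"
  shows "Lp_norm M p (weak_deriv M a u) \<le> sobolev_seminorm M k p u"
proof (cases "p = \<infinity>")
  case True
  then show ?thesis
    using a finite_multi_indices[of k] by (auto simp: sobolev_seminorm_def intro!: Max_ge)
next
  case False
  define P where "P = real_of_ereal p"
  have P: "P \<ge> 1" using p False by (cases p) (auto simp: P_def)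
  have "Lp_norm M p (weak_deriv M a u) powr P \<le> (\<Sum>a | (\<Sum>i\<in>UNIV. a i) = k. Lp_norm M p (weak_deriv M a u) powr P)"
    using a by (intro member_le_sum finite_multi_indices) auto
  then have "(Lp_norm M p (weak_deriv M a u) powr P) powr (1 / P) \<le> sobolev_seminorm M k p u"
    using False P unfolding sobolev_seminorm_def P_def[symmetric] by (auto intro!: powr_mono2)
  then show ?thesis using nn P by (simp add: powr_powr)
qed

text \<open>\<sigma> is free so that the L^1 term can be absorbed by the residual later. The
  assumptions are on u1 and u2 since Sobolev membership is known for \<open>F f\<close> and
  \<open>gd\<close> separately; the weak derivatives of the difference come from
  \<open>weak_deriv_sobolev_diff\<close>.\<close>

lemma small_set_bound:
  fixes M :: "(real^'n::finite) set"
  assumes M: "bounded_lipschitz_domain M" and p: "1 \<le> p"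
    and k: "k = 0 \<and> p = \<infinity> \<or> real k - real CARD('n) * inv_exponent p > 0" and \<sigma>: "\<sigma> > 0"
  shows "\<exists>C>0. \<exists>t0>0. \<forall>u1 u2 P \<eta>. u1 \<in> sobolev M k p \<longrightarrow> u2 \<in> sobolev M k p \<longrightarrow> u1 \<in> Lp M 1 \<longrightarrow> u2 \<in> Lp M 1 \<longrightarrow>
    P \<in> sets borel \<longrightarrow> P \<subseteq> M \<longrightarrow> measure lebesgue P \<le> \<eta> \<longrightarrow> 0 < \<eta> \<longrightarrow> \<eta> \<le> t0 \<longrightarrow>
    (\<integral>x. indicator P x * \<bar>u1 x - u2 x\<bar> \<partial>lebesgue_on M) \<le> \<sigma> * Lp_norm M 1 (\<lambda>x. u1 x - u2 x) +
      C * \<eta> powr (real k / real CARD('n) + 1 - inv_exponent p) * sobolev_seminorm M k p (\<lambda>x. u1 x - u2 x)"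
proof -
  have oM: "open M" and bM: "bounded M" using M by (auto simp: bounded_lipschitz_domain_def)
  have sM: "M \<in> sets lebesgue" using oM by simp
  let ?d = "real CARD('n)"
  have wd: "weak_deriv M a (\<lambda>x. u1 x - u2 x) \<in> Lp M p"
      "has_weak_deriv M a (\<lambda>x. u1 x - u2 x) (weak_deriv M a (\<lambda>x. u1 x - u2 x))"
      "Lp_norm M p (weak_deriv M a (\<lambda>x. u1 x - u2 x)) \<le> sobolev_seminorm M k p (\<lambda>x. u1 x - u2 x)"
    if "u1 \<in> sobolev M k p" "u2 \<in> sobolev M k p" "(\<Sum>i\<in>UNIV. a i) = k" for a u1 u2
  proof -
    note * = weak_deriv_sobolev_diff[OF oM p that(1,2), of a]
    show 1: "weak_deriv M a (\<lambda>x. u1 x - u2 x) \<in> Lp M p"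
      "has_weak_deriv M a (\<lambda>x. u1 x - u2 x) (weak_deriv M a (\<lambda>x. u1 x - u2 x))" using * that(3) by auto
    show "Lp_norm M p (weak_deriv M a (\<lambda>x. u1 x - u2 x)) \<le> sobolev_seminorm M k p (\<lambda>x. u1 x - u2 x)"
      by (rule weak_deriv_norm_le_seminorm[OF p that(3) Lp_norm_nonneg[OF 1(1)]])
  qed
  show ?thesis
  proof (cases "k = 0 \<and> p = \<infinity>")
    case True
    then have k0: "k = 0" and pinf: "p = \<infinity>" by auto
    show ?thesis
    proof (rule exI[of _ 1], rule conjI[OF zero_less_one], rule exI[of _ 1], rule conjI[OF zero_less_one], intro allI impI)
      fix u1 u2 P \<eta>
      assume u: "u1 \<in> sobolev M k p" "u2 \<in> sobolev M k p" "u1 \<in> Lp M 1" "u2 \<in> Lp M 1"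
        and P: "P \<in> sets borel" "P \<subseteq> M" "measure lebesgue P \<le> \<eta>" and \<eta>: "0 < \<eta>"
      define g where "g = (\<lambda>x. u1 x - u2 x)"
      define v where "v = weak_deriv M (\<lambda>_. 0) g"
      have v: "v \<in> Lp M p" "has_weak_deriv M (\<lambda>_. 0) g v" "Lp_norm M p v \<le> sobolev_seminorm M k p g"
        using wd[OF u(1,2), of "\<lambda>_. 0"] k0 unfolding v_def g_def by auto
      \<comment> \<open>Order 0 still passes through the choice of a list, but the empty list is the
        only one with all counts 0. So g is a weak derivative of itself, and the chosen derivative v
        equals g a.e.\<close>
      have some: "(SOME is :: 'n list. \<forall>i. count_list is i = 0) = []"
      proof (rule some_equality)
        fix "is" :: "'n list" assume "\<forall>i. count_list is i = 0"
        then show "is = []" by (cases "is") (auto dest: spec[of _ "hd is"])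
      qed auto
      have "has_weak_deriv M (\<lambda>_. 0) g g"
        using v(2) by (auto simp: has_weak_deriv_def multi_deriv_def some iter_partial_def)
      from has_weak_deriv_unique[OF oM v(2) this] have "AE x in lebesgue. x \<in> M \<longrightarrow> v x = g x" .
      moreover have "AE x in lebesgue. x \<in> M \<longrightarrow> \<bar>v x\<bar> \<le> Lp_norm M \<infinity> v"
        using Lp_infinity_AE_le[of v M] v(1) pinf sM by (simp add: AE_restrict_space_iff)
      ultimately have "AE x in lebesgue. x \<in> M \<longrightarrow> \<bar>g x\<bar> \<le> sobolev_seminorm M k p g"
        by eventually_elim (use v(3) pinf in auto)
      moreover have "sobolev_seminorm M k p g \<ge> 0" using Lp_norm_nonneg[OF v(1)] v(3) by linarith
      ultimately have "(\<integral>x. indicator P x * \<bar>g x\<bar> \<partial>lebesgue_on M) \<le> \<eta> * sobolev_seminorm M k p g"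
        using integral_on_small_set_le[OF sM P(1,2) bM P(3)] by blast
      moreover have "\<sigma> * Lp_norm M 1 g \<ge> 0"
        using \<sigma> Lp_norm_nonneg[OF Lp_diff[OF _ u(3,4)]] by (simp add: g_def)
      ultimately show "(\<integral>x. indicator P x * \<bar>u1 x - u2 x\<bar> \<partial>lebesgue_on M) \<le> \<sigma> * Lp_norm M 1 (\<lambda>x. u1 x - u2 x) +
          1 * \<eta> powr (real k / ?d + 1 - inv_exponent p) * sobolev_seminorm M k p (\<lambda>x. u1 x - u2 x)"
        using \<eta> k0 pinf by (simp add: g_def)
    qed
  next
    case False
    define e where "e = real k - ?d * inv_exponent p"
    have e: "e > 0" using k False by (auto simp: e_def)
    obtain C r0 where C: "C > 0" "r0 > 0" and bound: "\<And>g S \<rho>. g \<in> Lp M 1 \<Longrightarrow>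
      (\<forall>j. \<exists>v\<in>Lp M p. has_weak_deriv M (\<lambda>i. if i = j then k else 0) g v \<and> Lp_norm M p v \<le> S) \<Longrightarrow>
      0 < \<rho> \<Longrightarrow> \<rho> \<le> r0 \<Longrightarrow>
      (AE x in lebesgue. x \<in> M \<longrightarrow> \<bar>g x\<bar> \<le> C * (Lp_norm M 1 g / \<rho> ^ CARD('n) + \<rho> powr e * S))"
      using sup_bound[OF M p, of k] e unfolding e_def by blast
    \<comment> \<open>With \<rho>^d = K \<eta> the coefficient \<eta> C / \<rho>^d of the L^1 norm
      equals \<sigma>. The threshold r0^d / K for \<eta> expresses \<rho> \<le> r0.\<close>
    define K where "K = C / \<sigma>"
    have K: "K > 0" using C \<sigma> by (simp add: K_def)
    have pos: "0 < C * K powr (e / ?d)" "0 < r0 powr ?d / K" using C K by auto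
    show ?thesis
    proof (rule exI[of _ "C * K powr (e / ?d)"], rule conjI[OF pos(1)],
        rule exI[of _ "r0 powr ?d / K"], rule conjI[OF pos(2)], intro allI impI)
      fix u1 u2 P \<eta>
      assume u: "u1 \<in> sobolev M k p" "u2 \<in> sobolev M k p" "u1 \<in> Lp M 1" "u2 \<in> Lp M 1"
        and P: "P \<in> sets borel" "P \<subseteq> M" "measure lebesgue P \<le> \<eta>" and \<eta>: "0 < \<eta>" "\<eta> \<le> r0 powr ?d / K"
      define g where "g = (\<lambda>x. u1 x - u2 x)"
      define S where "S = sobolev_seminorm M k p g"
      have g: "g \<in> Lp M 1" unfolding g_def by (rule Lp_diff[OF _ u(3,4)]) simp
      have S: "\<forall>j. \<exists>v\<in>Lp M p. has_weak_deriv M (\<lambda>i. if i = j then k else 0) g v \<and> Lp_norm M p v \<le> S"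
      proof
        fix j :: 'n
        have "(\<Sum>i\<in>UNIV. if i = j then k else 0) = k" by simp
        from wd[OF u(1,2) this] show "\<exists>v\<in>Lp M p. has_weak_deriv M (\<lambda>i. if i = j then k else 0) g v \<and> Lp_norm M p v \<le> S"
          unfolding g_def S_def by blast
      qed
      have S0: "S \<ge> 0" using S Lp_norm_nonneg by (meson order_trans)
      define \<rho> where "\<rho> = (K * \<eta>) powr (1 / ?d)"
      have d: "?d > 0" by simp
      have \<rho>: "\<rho> > 0" using K \<eta> by (simp add: \<rho>_def)
      have "\<rho> \<le> (r0 powr ?d) powr (1 / ?d)"
        unfolding \<rho>_def using K \<eta> d by (intro powr_mono2) (auto simp: field_simps)
      then have "\<rho> \<le> r0" using C(2) d by (simp add: powr_powr)
      note ae = bound[OF g S \<rho> this]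
      have \<rho>d: "\<rho> ^ CARD('n) = K * \<eta>"
        using K \<eta> \<rho> d by (simp add: powr_realpow[symmetric] \<rho>_def powr_powr)
      have \<rho>e: "\<rho> powr e = K powr (e / ?d) * \<eta> powr (e / ?d)"
        using K \<eta> by (simp add: \<rho>_def powr_powr powr_mult)
      have "C * (Lp_norm M 1 g / \<rho> ^ CARD('n) + \<rho> powr e * S) \<ge> 0"
        using C \<rho> S0 Lp_norm_nonneg[OF g] by (intro mult_nonneg_nonneg add_nonneg_nonneg) auto
      from integral_on_small_set_le[OF sM P(1,2) bM P(3) ae this]
      have "(\<integral>x. indicator P x * \<bar>g x\<bar> \<partial>lebesgue_on M) \<le> \<eta> * (C * (Lp_norm M 1 g / \<rho> ^ CARD('n) + \<rho> powr e * S))" .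
      also have "\<dots> = \<sigma> * Lp_norm M 1 g + C * K powr (e / ?d) * (\<eta> * \<eta> powr (e / ?d)) * S"
        unfolding \<rho>d \<rho>e using K \<eta> C \<sigma> by (simp add: K_def field_simps)
      also have "\<eta> * \<eta> powr (e / ?d) = \<eta> powr (1 + e / ?d)"
        using \<eta> by (simp add: powr_add)
      also have "1 + e / ?d = real k / ?d + 1 - inv_exponent p"
        using d by (simp add: e_def diff_divide_distrib)
      finally show "(\<integral>x. indicator P x * \<bar>u1 x - u2 x\<bar> \<partial>lebesgue_on M) \<le> \<sigma> * Lp_norm M 1 (\<lambda>x. u1 x - u2 x) +
          C * K powr (e / ?d) * \<eta> powr (real k / ?d + 1 - inv_exponent p) * sobolev_seminorm M k p (\<lambda>x. u1 x - u2 x)"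
        by (simp only: g_def S_def)
    qed
  qed
qed

section \<open>Index functions\<close>

locale subpower_index_function =
  fixes \<phi> :: "real \<Rightarrow> real" and \<delta> :: real
  assumes index: "concave_index_function \<phi>" and nontrivial: "\<exists>t\<ge>0. \<phi> t \<noteq> 0"
    and delta_pos: "\<delta> > 0" and power_concave: "concave_on {0..} (\<lambda>t. \<phi> t powr (1 + \<delta>))"
begin

lemma phi_nonneg: "0 \<le> t \<Longrightarrow> 0 \<le> \<phi> t"
  and phi_zero: "\<phi> 0 = 0"
  and phi_mono: "0 \<le> s \<Longrightarrow> s \<le> t \<Longrightarrow> \<phi> s \<le> \<phi> t"
  using index by (auto simp: concave_index_function_def mono_on_def)

definition r :: real where "r = 1 / (1 + \<delta>)"

lemma r: "0 < r" "r < 1"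
  using delta_pos by (auto simp: r_def)

text \<open>Concavity of the power at the point t between 0 and B t gives the growth exponent r < 1.
  This strict gap to linear growth makes \<psi> finite, positive and of at most polynomial
  growth.\<close>

lemma phi_scale_le:
  assumes "1 \<le> B" "0 \<le> t"
  shows "\<phi> (B * t) \<le> B powr r * \<phi> t"
proof -
  have "(1 / B) * \<phi> (B * t) powr (1 + \<delta>) \<le> \<phi> t powr (1 + \<delta>)"
  proof -
    have "(1 - 1 / B) * \<phi> 0 powr (1 + \<delta>) + (1 / B) * \<phi> (B * t) powr (1 + \<delta>)
        \<le> \<phi> ((1 - 1 / B) *\<^sub>R 0 + (1 / B) *\<^sub>R (B * t)) powr (1 + \<delta>)"
      by (rule concave_onD[OF power_concave]) (use assms in auto)
    then show ?thesis using assms by (simp add: phi_zero)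
  qed
  then have "\<phi> (B * t) powr (1 + \<delta>) \<le> B * \<phi> t powr (1 + \<delta>)"
    using assms by (simp add: field_simps)
  then have "(\<phi> (B * t) powr (1 + \<delta>)) powr r \<le> (B * \<phi> t powr (1 + \<delta>)) powr r"
    using r by (intro powr_mono2) auto
  moreover have "(1 + \<delta>) * r = 1" using delta_pos by (simp add: r_def)
  ultimately show ?thesis
    using assms phi_nonneg[of "B * t"] phi_nonneg[of t] by (simp add: powr_mult powr_powr)
qed

section \<open>The conjugate \<psi> and the inverses of \<open>theta\<close> and
  \<open>theta_tilde\<close>\<close>

lemma psi_upper: "0 \<le> t \<Longrightarrow> ereal (\<phi> t - t / \<alpha>) \<le> psi \<phi> \<alpha>"
  unfolding psi_def by (rule SUP_upper) auto

lemma psi_le_scaled: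
  assumes "1 \<le> C" "0 < \<alpha>"
  shows "psi \<phi> (C * \<alpha>) \<le> ereal (C powr (1 / \<delta>)) * psi \<phi> \<alpha>"
  unfolding psi_def[of \<phi> "C * \<alpha>"]
proof (rule SUP_least)
  fix \<tau> :: real assume \<tau>: "\<tau> \<in> {0..}"
  \<comment> \<open>B solves B^r = B / C, so that after \<tau> = B s both terms carry the same
    factor C^(1/\<delta>).\<close>
  define B where "B = C powr ((1 + \<delta>) / \<delta>)"
  have B: "B \<ge> 1" unfolding B_def using assms delta_pos by (intro ge_one_powr_ge_zero) auto
  have Br: "B powr r = C powr (1 / \<delta>)" using delta_pos by (simp add: B_def powr_powr r_def)
  have BC: "B / C = C powr (1 / \<delta>)"
  proof -
    have "(1 + \<delta>) / \<delta> = 1 / \<delta> + 1" using delta_pos by (simp add: field_simps)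
    then show ?thesis using assms by (simp add: B_def powr_add)
  qed
  define s where "s = \<tau> / B"
  have s: "0 \<le> s" "\<tau> = B * s" using \<tau> B by (auto simp: s_def)
  have "\<phi> \<tau> - \<tau> / (C * \<alpha>) \<le> B powr r * \<phi> s - (B / C) * (s / \<alpha>)"
    using phi_scale_le[OF B s(1)] unfolding s(2) by simp
  also have "\<dots> = C powr (1 / \<delta>) * (\<phi> s - s / \<alpha>)"
    unfolding Br BC by (simp add: right_diff_distrib)
  finally have "ereal (\<phi> \<tau> - \<tau> / (C * \<alpha>)) \<le> ereal (C powr (1 / \<delta>)) * ereal (\<phi> s - s / \<alpha>)" by simp
  also have "\<dots> \<le> ereal (C powr (1 / \<delta>)) * psi \<phi> \<alpha>"
    by (rule ereal_mult_left_mono[OF psi_upper[OF s(1)]]) simp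
  finally show "ereal (\<phi> \<tau> - \<tau> / (C * \<alpha>)) \<le> ereal (C powr (1 / \<delta>)) * psi \<phi> \<alpha>" .
qed

lemma psi_less_infinity:
  assumes "0 < \<alpha>"
  shows "psi \<phi> \<alpha> < \<infinity>"
proof -
  \<comment> \<open>Beyond T one has \<tau>^(1 - r) \<ge> \<alpha> \<phi>(1), and \<tau> / \<alpha>
    outweighs \<phi>(\<tau>) \<le> \<tau>^r \<phi>(1).\<close>
  define T where "T = max 1 ((\<alpha> * \<phi> 1) powr (1 / (1 - r)))"
  have T: "T \<ge> 1" by (simp add: T_def)
  have "psi \<phi> \<alpha> \<le> ereal (\<phi> T)"
    unfolding psi_def
  proof (rule SUP_least)
    fix \<tau> :: real assume \<tau>: "\<tau> \<in> {0..}"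
    show "ereal (\<phi> \<tau> - \<tau> / \<alpha>) \<le> ereal (\<phi> T)"
    proof (cases "\<tau> \<le> T")
      case True
      then have "\<phi> \<tau> \<le> \<phi> T" using \<tau> by (intro phi_mono) auto
      moreover have "\<tau> / \<alpha> \<ge> 0" using \<tau> assms by simp
      ultimately show ?thesis by simp
    next
      case False
      then have \<tau>T: "1 \<le> \<tau>" "(\<alpha> * \<phi> 1) powr (1 / (1 - r)) \<le> \<tau>" by (auto simp: T_def)
      have "\<alpha> * \<phi> 1 = ((\<alpha> * \<phi> 1) powr (1 / (1 - r))) powr (1 - r)"
        using assms phi_nonneg[of 1] r by (simp add: powr_powr)
      also have "\<dots> \<le> \<tau> powr (1 - r)" using \<tau>T r by (intro powr_mono2) auto
      finally have "\<tau> powr r * (\<alpha> * \<phi> 1) \<le> \<tau> powr r * \<tau> powr (1 - r)" by (intro mult_left_mono) auto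
      also have "\<dots> = \<tau>" using \<tau>T by (simp add: powr_add[symmetric])
      finally have "\<tau> powr r * \<phi> 1 \<le> \<tau> / \<alpha>" using assms by (simp add: field_simps)
      moreover have "\<phi> \<tau> \<le> \<tau> powr r * \<phi> 1" using phi_scale_le[of \<tau> 1] \<tau>T by simp
      ultimately have "\<phi> \<tau> - \<tau> / \<alpha> \<le> 0" by simp
      also have "0 \<le> \<phi> T" using T phi_nonneg[of T] by simp
      finally show ?thesis by simp
    qed
  qed
  then show ?thesis by (rule order_le_less_trans) simp
qed

lemma psi_pos:
  assumes "0 < \<alpha>"
  shows "0 < psi \<phi> \<alpha>"
proof -
  obtain t where t: "t \<ge> 0" "\<phi> t \<noteq> 0" using nontrivial by blast
  then have t0: "\<phi> t > 0" "t > 0" using phi_nonneg[of t] phi_zero by (auto simp: less_le)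
  \<comment> \<open>Near 0, \<phi>(t / B) \<ge> \<phi>(t) / B^r beats (t / B) / \<alpha> as soon as
    B^(1 - r) > t / (\<alpha> \<phi>(t)); the added 1 makes the inequality strict.\<close>
  define B where "B = max 1 ((t / (\<alpha> * \<phi> t) + 1) powr (1 / (1 - r)))"
  have B: "B \<ge> 1" by (simp add: B_def)
  have "t / (\<alpha> * \<phi> t) + 1 = ((t / (\<alpha> * \<phi> t) + 1) powr (1 / (1 - r))) powr (1 - r)"
    using t0 assms r by (simp add: powr_powr add_nonneg_nonneg)
  also have "\<dots> \<le> B powr (1 - r)" using r by (intro powr_mono2) (auto simp: B_def)
  finally have "t / (\<alpha> * \<phi> t) < B powr (1 - r)" by simp
  then have "t / \<alpha> < B powr (1 - r) * \<phi> t" using t0 assms by (simp add: field_simps)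
  moreover have "B powr (1 - r) = B / B powr r" using B by (simp add: powr_diff)
  ultimately have "t / \<alpha> < B * (\<phi> t / B powr r)" by simp
  moreover have "\<phi> t \<le> B powr r * \<phi> (t / B)" using phi_scale_le[OF B, of "t / B"] B t by simp
  then have "\<phi> t / B powr r \<le> \<phi> (t / B)" using B by (simp add: field_simps)
  then have "B * (\<phi> t / B powr r) \<le> B * \<phi> (t / B)" using B by (intro mult_left_mono) auto
  ultimately have "t / \<alpha> < B * \<phi> (t / B)" by linarith
  then have "t / \<alpha> / B < \<phi> (t / B)" using B by (subst pos_divide_less_eq) (auto simp: mult.commute)
  then have "0 < \<phi> (t / B) - (t / B) / \<alpha>" by (simp add: mult.commute)
  then have "0 < ereal (\<phi> (t / B) - (t / B) / \<alpha>)" by simp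
  also have "\<dots> \<le> psi \<phi> \<alpha>" using B t by (intro psi_upper) auto
  finally show ?thesis .
qed

definition \<psi> :: "real \<Rightarrow> real" where "\<psi> \<alpha> = real_of_ereal (psi \<phi> \<alpha>)"

lemma psi_eq: "0 < \<alpha> \<Longrightarrow> psi \<phi> \<alpha> = ereal (\<psi> \<alpha>)"
  using psi_less_infinity[of \<alpha>] psi_pos[of \<alpha>] by (cases "psi \<phi> \<alpha>") (auto simp: \<psi>_def)

lemma real_psi_pos: "0 < \<alpha> \<Longrightarrow> 0 < \<psi> \<alpha>"
  using psi_pos[of \<alpha>] by (simp add: psi_eq)

lemma real_psi_upper: "0 < \<alpha> \<Longrightarrow> 0 \<le> t \<Longrightarrow> \<phi> t - t / \<alpha> \<le> \<psi> \<alpha>"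
  using psi_upper[of t \<alpha>] by (simp add: psi_eq)

lemma real_psi_scaled: "1 \<le> C \<Longrightarrow> 0 < \<alpha> \<Longrightarrow> \<psi> (C * \<alpha>) \<le> C powr (1 / \<delta>) * \<psi> \<alpha>"
  using psi_le_scaled[of C \<alpha>] by (simp add: psi_eq)

lemma real_psi_mono:
  assumes "0 < a" "a \<le> b"
  shows "\<psi> a \<le> \<psi> b"
proof -
  have "psi \<phi> a \<le> psi \<phi> b"
    unfolding psi_def[of \<phi> a]
  proof (rule SUP_least)
    fix t :: real assume t: "t \<in> {0..}"
    then have "t / b \<le> t / a" using assms by (intro divide_left_mono) auto
    then have "ereal (\<phi> t - t / a) \<le> ereal (\<phi> t - t / b)" by simp
    also have "\<dots> \<le> psi \<phi> b" using t by (intro psi_upper) auto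
    finally show "ereal (\<phi> t - t / a) \<le> psi \<phi> b" .
  qed
  then show ?thesis using assms by (simp add: psi_eq)
qed

text \<open>In the variable s = 1/\<alpha>, \<psi> is a supremum of affine functions, hence convex,
  and a finite convex function on an open interval is continuous.\<close>

lemma real_psi_continuous: "continuous_on {0<..} \<psi>"
proof -
  have "continuous_on {0<..} (\<lambda>s. \<psi> (1 / s))"
  proof (rule convex_on_continuous)
    show "convex_on {0<..} (\<lambda>s. \<psi> (1 / s))"
    proof (rule convex_onI)
      fix u x y :: real
      assume u: "0 < u" "u < 1" and xy: "x \<in> {0<..}" "y \<in> {0<..}"
      define z where "z = (1 - u) *\<^sub>R x + u *\<^sub>R y"
      have z: "z > 0" unfolding z_def using u xy by (simp add: add_pos_pos)
      have "psi \<phi> (1 / z) \<le> ereal ((1 - u) * \<psi> (1 / x) + u * \<psi> (1 / y))"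
        unfolding psi_def
      proof (rule SUP_least)
        fix t :: real assume t: "t \<in> {0..}"
        have "\<phi> t - t / (1 / z) = (1 - u) * (\<phi> t - t / (1 / x)) + u * (\<phi> t - t / (1 / y))"
          by (simp add: z_def algebra_simps)
        also have "\<dots> \<le> (1 - u) * \<psi> (1 / x) + u * \<psi> (1 / y)"
          using u xy t by (intro add_mono mult_left_mono real_psi_upper) auto
        finally show "ereal (\<phi> t - t / (1 / z)) \<le> ereal ((1 - u) * \<psi> (1 / x) + u * \<psi> (1 / y))" by simp
      qed
      then show "\<psi> (1 / ((1 - u) *\<^sub>R x + u *\<^sub>R y)) \<le> (1 - u) * \<psi> (1 / x) + u * \<psi> (1 / y)"
        using z unfolding z_def[symmetric] by (simp add: psi_eq)
    qed simp
  qed simp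
  then have "continuous_on {0<..} (\<lambda>a. \<psi> (1 / (1 / a)))"
    by (rule continuous_on_compose2) (auto intro!: continuous_intros)
  then show ?thesis by simp
qed

text \<open>Comparison with the line a \<psi>(1), from below for a \<le> 1 and from above for a
  \<ge> 1, yields both endpoints for the intermediate value theorem. It holds for
  \<open>theta\<close> and \<open>theta_tilde\<close> alike, as \<psi> is increasing and the power
  of a is at least 1.\<close>

lemma ex_preimage:
  assumes cont: "continuous_on {0<..} \<Theta>" and le: "\<And>a. 0 < a \<Longrightarrow> a \<le> 1 \<Longrightarrow> \<Theta> a \<le> a * \<psi> 1"
    and ge: "\<And>a. 1 \<le> a \<Longrightarrow> a * \<psi> 1 \<le> \<Theta> a" and t: "t > 0"
  shows "\<exists>a>0. \<Theta> a = (t :: real)"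
proof -
  have p1: "\<psi> 1 > 0" by (rule real_psi_pos) simp
  define a where "a = min 1 (t / \<psi> 1)"
  define b where "b = max 1 (t / \<psi> 1)"
  have a: "0 < a" "a \<le> 1" "a * \<psi> 1 \<le> t" using p1 t by (auto simp: a_def min_def field_simps)
  have b: "1 \<le> b" "t \<le> b * \<psi> 1" using p1 t by (auto simp: b_def max_def field_simps)
  have "{a..b} \<subseteq> {0<..}" using a by auto
  from continuous_on_subset[OF cont this] obtain x where "a \<le> x" "\<Theta> x = t"
    using IVT'[of \<Theta> a t b] a b le[of a] ge[of b] by auto
  then show ?thesis using a(1) by (intro exI[of _ x]) auto
qed

text \<open>\<open>inv_into\<close> picks a preimage as soon as one exists; the estimates work with
  the equation that it solves.\<close>

lemma inv_pos_eq:
  assumes "\<And>a. 0 < a \<Longrightarrow> \<Theta> a = ereal (\<Theta>' a)" "\<exists>a>0. \<Theta>' a = t"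
  shows "inv_pos \<Theta> t > 0" "\<Theta>' (inv_pos \<Theta> t) = t"
proof -
  obtain a where "a > 0" "\<Theta>' a = t" using assms(2) by blast
  then have im: "ereal t \<in> \<Theta> ` {0<..}" using assms(1)[of a] by (metis greaterThan_iff image_eqI)
  show p: "inv_pos \<Theta> t > 0" unfolding inv_pos_def using inv_into_into[OF im] by simp
  have "\<Theta> (inv_pos \<Theta> t) = ereal t" unfolding inv_pos_def by (rule f_inv_into_f[OF im])
  then show "\<Theta>' (inv_pos \<Theta> t) = t" using assms(1)[OF p] by simp
qed

lemma inv_theta:
  assumes "t > 0"
  shows "inv_pos (theta \<phi>) t > 0" "inv_pos (theta \<phi>) t * \<psi> (inv_pos (theta \<phi>) t) = t"
proof -
  have ex: "\<exists>a>0. a * \<psi> a = t"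
    by (rule ex_preimage[OF _ _ _ assms])
       (auto intro!: continuous_intros real_psi_continuous real_psi_mono)
  have eq: "theta \<phi> a = ereal (a * \<psi> a)" if "0 < a" for a
    using that by (simp add: theta_def psi_eq)
  show "inv_pos (theta \<phi>) t > 0" "inv_pos (theta \<phi>) t * \<psi> (inv_pos (theta \<phi>) t) = t"
    using inv_pos_eq[of "theta \<phi>" "\<lambda>a. a * \<psi> a", OF eq ex] by auto
qed

lemma inv_theta_tilde:
  assumes "t > 0" "q > 1"
  shows "inv_pos (theta_tilde q \<phi>) t > 0"
    "inv_pos (theta_tilde q \<phi>) t powr q * \<psi> (inv_pos (theta_tilde q \<phi>) t) = t"
proof -
  have ex: "\<exists>a>0. a powr q * \<psi> a = t"
  proof (rule ex_preimage[OF _ _ _ assms(1)])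
    show "continuous_on {0<..} (\<lambda>a. a powr q * \<psi> a)"
      by (intro continuous_intros real_psi_continuous) auto
    fix a :: real
    show "a powr q * \<psi> a \<le> a * \<psi> 1" if "0 < a" "a \<le> 1"
    proof (rule mult_mono)
      show "a powr q \<le> a" using powr_mono'[of 1 q a] that assms by simp
    qed (use that real_psi_mono[of a 1] real_psi_pos[of a] in auto)
    show "a * \<psi> 1 \<le> a powr q * \<psi> a" if "1 \<le> a"
    proof (rule mult_mono)
      show "a \<le> a powr q" using powr_mono[of 1 q a] that assms by simp
    qed (use that real_psi_mono[of 1 a] real_psi_pos[of 1] in auto)
  qed
  have eq: "theta_tilde q \<phi> a = ereal (a powr q * \<psi> a)" if "0 < a" for a
    using that by (simp add: theta_tilde_def psi_eq)
  show "inv_pos (theta_tilde q \<phi>) t > 0"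
    "inv_pos (theta_tilde q \<phi>) t powr q * \<psi> (inv_pos (theta_tilde q \<phi>) t) = t"
    using inv_pos_eq[of "theta_tilde q \<phi>" "\<lambda>a. a powr q * \<psi> a", OF eq ex] by auto
qed

text \<open>Splits \<theta>(a + b) into \<theta>(a) and \<theta>(b) for the residual bound: a + b
  \<le> 2 max a b costs a factor 2 outside \<psi> and 2^(1/\<delta>) for doubling its
  argument.\<close>

lemma theta_sum_le:
  assumes "0 < a" "0 < b"
  shows "(a + b) * \<psi> (a + b) \<le> 2 * 2 powr (1 / \<delta>) * (a * \<psi> a + b * \<psi> b)"
proof -
  define m where "m = max a b"
  have m: "m > 0" "a + b \<le> 2 * m" using assms by (auto simp: m_def)
  have "(a + b) * \<psi> (a + b) \<le> (2 * m) * \<psi> (2 * m)"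
    using assms m real_psi_mono[of "a + b" "2 * m"] real_psi_pos[of "a + b"] by (intro mult_mono) auto
  also have "\<dots> \<le> (2 * m) * (2 powr (1 / \<delta>) * \<psi> m)"
    using m by (intro mult_left_mono real_psi_scaled) auto
  also have "\<dots> = 2 * 2 powr (1 / \<delta>) * (m * \<psi> m)" by simp
  also have "\<dots> \<le> 2 * 2 powr (1 / \<delta>) * (a * \<psi> a + b * \<psi> b)"
    using assms real_psi_pos[of a] real_psi_pos[of b] by (intro mult_left_mono) (auto simp: m_def max_def)
  finally show ?thesis .
qed

end

section \<open>Error bounds\<close>

lemma conjugate_exponent:
  fixes q q' :: real
  assumes "1 < q" "1 / q + 1 / q' = 1"
  shows "1 / q' = 1 - 1 / q" "1 < q'"
proof -
  show eq: "1 / q' = 1 - 1 / q" using assms(2) by linarith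
  have "0 < 1 / q" "1 / q < 1" using assms(1) by auto
  then have q': "0 < 1 / q'" "1 / q' < 1" unfolding eq by linarith+
  then have "0 < q'" by (simp add: zero_less_divide_iff)
  then show "1 < q'" using q'(2) by (simp add: divide_less_eq)
qed

text \<open>Either the product is at most \<kappa> D, or D^(1/q') < x / \<kappa>; in the second case
  D^(1/q) is at most (x / \<kappa>)^(q'/q), and q'/q + 1 = q' collects the powers of x.\<close>

lemma young_absorb:
  fixes x D \<kappa> q q' :: real
  assumes "\<kappa> > 0" "x \<ge> 0" "D \<ge> 0" "q > 1" "1 / q + 1 / q' = 1"
  shows "x * D powr (1 / q) \<le> \<kappa> * D + \<kappa> powr (- (q' / q)) * x powr q'"
proof (cases "x * D powr (1 / q) \<le> \<kappa> * D")
  case True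
  then show ?thesis by (simp add: add_increasing2)
next
  case False
  note q' = conjugate_exponent[OF assms(4,5)]
  have "q' > 0" using q'(2) by simp
  have "q' / q = q' * (1 - 1 / q')" unfolding q'(1) by simp
  then have q'q: "q' / q + 1 = q'" using \<open>q' > 0\<close> by (simp add: right_diff_distrib)
  have D: "D > 0" using False assms by (cases "D = 0") auto
  have x: "x > 0" using False assms mult_nonneg_nonneg[of \<kappa> D] by (cases "x = 0") auto
  have "\<kappa> * D powr (1 / q') = \<kappa> * D / D powr (1 / q)"
    using D unfolding q'(1) by (simp add: powr_diff)
  also have "\<dots> < x" using False D by (simp add: divide_less_eq)
  finally have "D powr (1 / q') \<le> x / \<kappa>" using assms by (simp add: field_simps)
  then have "(D powr (1 / q')) powr (q' / q) \<le> (x / \<kappa>) powr (q' / q)"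
    using \<open>q' > 0\<close> \<open>q > 1\<close> by (intro powr_mono2) auto
  then have "D powr (1 / q) \<le> (x / \<kappa>) powr (q' / q)"
    using \<open>q' > 0\<close> by (simp add: powr_powr)
  then have "x * D powr (1 / q) \<le> x * (x / \<kappa>) powr (q' / q)"
    using assms by (intro mult_left_mono) auto
  also have "\<dots> = \<kappa> powr (- (q' / q)) * (x powr (q' / q) * x powr 1)"
    using x assms by (simp add: powr_divide powr_minus_divide)
  also have "x powr (q' / q) * x powr 1 = x powr q'"
    by (simp only: powr_add[symmetric] q'q)
  finally show ?thesis using assms by (simp add: add_increasing)
qed

text \<open>Pointwise |g - \<xi>| \<ge> |\<xi>| - |g| on P and |g - \<xi>| \<ge> |g| - |\<xi>| off
  P. So the loss on P involves g alone, however large \<xi> is there, and the loss off P involves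
  \<xi> alone; each reversed sign costs a factor 2.\<close>

lemma impulsive_residual_lower_bound:
  fixes g \<xi> :: "'a::euclidean_space \<Rightarrow> real"
  assumes M: "M \<in> sets lebesgue" and g: "g \<in> Lp M 1" and \<xi>: "\<xi> \<in> Lp M 1"
    and P: "P \<in> sets borel" "P \<subseteq> M" and \<epsilon>: "Lp_norm (M - P) 1 \<xi> \<le> \<epsilon>"
  shows "Lp_norm M 1 \<xi> + Lp_norm M 1 g - 2 * (\<integral>x. indicator P x * \<bar>g x\<bar> \<partial>lebesgue_on M) - 2 * \<epsilon>
    \<le> Lp_norm M 1 (\<lambda>x. g x - \<xi> x)"
proof -
  let ?L = "lebesgue_on M"
  have Pl: "P \<in> sets lebesgue" using P(1) by (simp add: sets_completionI_sets)
  have ig: "integrable ?L (\<lambda>x. \<bar>g x\<bar>)" and i\<xi>: "integrable ?L (\<lambda>x. \<bar>\<xi> x\<bar>)"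
    and id: "integrable ?L (\<lambda>x. \<bar>g x - \<xi> x\<bar>)"
    using Lp_1_integrable[OF g] Lp_1_integrable[OF \<xi>] by auto
  have [measurable]: "indicat_real P \<in> borel_measurable ?L"
    using Pl by (intro measurable_restrict_space1 borel_measurable_indicator)
  have igP: "integrable ?L (\<lambda>x. indicator P x * \<bar>g x\<bar>)"
  proof (rule Bochner_Integration.integrable_bound[OF ig])
    show "(\<lambda>x. indicator P x * \<bar>g x\<bar>) \<in> borel_measurable ?L" using ig by auto
  qed (auto simp: indicator_def)
  have i\<xi>P: "integrable ?L (\<lambda>x. indicator (M - P) x * \<bar>\<xi> x\<bar>)"
  proof (rule Bochner_Integration.integrable_bound[OF i\<xi>])
    have "indicat_real (M - P) \<in> borel_measurable ?L"
      using Pl M by (intro measurable_restrict_space1 borel_measurable_indicator) auto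
    then show "(\<lambda>x. indicator (M - P) x * \<bar>\<xi> x\<bar>) \<in> borel_measurable ?L" using i\<xi> by auto
  qed (auto simp: indicator_def)
  have noise: "(\<integral>x. indicator (M - P) x * \<bar>\<xi> x\<bar> \<partial>?L) \<le> \<epsilon>"
  proof -
    have "(\<integral>x. indicator (M - P) x * \<bar>\<xi> x\<bar> \<partial>?L) = (\<integral>x. indicator M x *\<^sub>R (indicator (M - P) x * \<bar>\<xi> x\<bar>) \<partial>lebesgue)"
      by (rule integral_restrict_space) (use M in simp)
    also have "(\<lambda>x. indicator M x *\<^sub>R (indicator (M - P) x * \<bar>\<xi> x\<bar>)) = (\<lambda>x. indicator (M - P) x *\<^sub>R \<bar>\<xi> x\<bar>)"
      by (auto simp: indicator_def fun_eq_iff)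
    also have "(\<integral>x. indicator (M - P) x *\<^sub>R \<bar>\<xi> x\<bar> \<partial>lebesgue) = Lp_norm (M - P) 1 \<xi>"
      unfolding Lp_norm_1_eq by (rule integral_restrict_space[symmetric]) (use M Pl in auto)
    finally show ?thesis using \<epsilon> by simp
  qed
  have "(\<integral>x. \<bar>\<xi> x\<bar> + \<bar>g x\<bar> - 2 * (indicator P x * \<bar>g x\<bar>) - 2 * (indicator (M - P) x * \<bar>\<xi> x\<bar>) \<partial>?L)
      \<le> (\<integral>x. \<bar>g x - \<xi> x\<bar> \<partial>?L)"
  proof (rule integral_mono)
    fix x assume "x \<in> space ?L"
    then show "\<bar>\<xi> x\<bar> + \<bar>g x\<bar> - 2 * (indicator P x * \<bar>g x\<bar>) - 2 * (indicator (M - P) x * \<bar>\<xi> x\<bar>) \<le> \<bar>g x - \<xi> x\<bar>"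
      by (auto simp: indicator_def)
  qed (use ig i\<xi> id igP i\<xi>P in auto)
  also have "(\<integral>x. \<bar>\<xi> x\<bar> + \<bar>g x\<bar> - 2 * (indicator P x * \<bar>g x\<bar>) - 2 * (indicator (M - P) x * \<bar>\<xi> x\<bar>) \<partial>?L) =
      (\<integral>x. \<bar>\<xi> x\<bar> \<partial>?L) + (\<integral>x. \<bar>g x\<bar> \<partial>?L) - 2 * (\<integral>x. indicator P x * \<bar>g x\<bar> \<partial>?L)
      - 2 * (\<integral>x. indicator (M - P) x * \<bar>\<xi> x\<bar> \<partial>?L)"
    using ig i\<xi> igP i\<xi>P by simp
  finally show ?thesis using noise by (simp add: Lp_norm_1_eq)
qed

text \<open>K and t0 are fixed before \<alpha> is given, since in Case 1 \<alpha> depends on the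
  noise level.\<close>

lemma error_inequality:
  fixes M :: "(real^'n::finite) set"
    and TX :: "'x::banach topology" and TY :: "(real^'n \<Rightarrow> real) topology"
    and DF :: "'x set" and F :: "'x \<Rightarrow> real^'n \<Rightarrow> real" and R :: "'x \<Rightarrow> ereal"
    and fd :: 'x and fs :: "'x \<Rightarrow>\<^sub>L real" and gd :: "real^'n \<Rightarrow> real"
    and \<beta> q q' \<gamma> CF :: real and \<phi> :: "real \<Rightarrow> real" and k :: nat and p :: ereal
  assumes M: "bounded_lipschitz_domain M"
    and wp: "well_posed M TX TY DF F R"
    and fd: "fd \<in> ess_dom R" and gd: "gd = F fd" and fs: "fs \<in> subdifferential R fd"
    and \<beta>: "\<beta> > 0"
    and vsc: "\<forall>f\<in>ess_dom R.
           ereal \<beta> * bregman R fs f fd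
             \<le> R f - R fd + ereal (\<phi> (Lp_norm M 1 (\<lambda>x. F f x - gd x)))"
    and p: "1 \<le> p" and q: "1 < q" and CF: "CF > 0"
    and sob: "F ` ess_dom R \<subseteq> sobolev M k p"
    and interp: "\<forall>f\<in>ess_dom R.
           sobolev_seminorm M k p (\<lambda>x. F f x - gd x)
             \<le> CF * real_of_ereal (bregman R fs f fd) powr (1 / q)"
    and k: "k = 0 \<and> p = \<infinity> \<or>
         real k > (if p = \<infinity> then 0 else real CARD('n) / real_of_ereal p)"
    and q': "1 / q + 1 / q' = 1"
    and \<gamma>: "\<gamma> = q' * real k / real CARD('n) +
             (if p = \<infinity> then q' else q' * (real_of_ereal p - 1) / real_of_ereal p)"
  shows "\<exists>K>0. \<exists>t0>0. \<forall>\<epsilon> \<eta> \<xi> \<alpha> fh.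
    \<epsilon> > 0 \<longrightarrow> \<eta> > 0 \<longrightarrow> max \<epsilon> \<eta> \<le> t0 \<longrightarrow> impulsive_noise M \<epsilon> \<eta> \<xi> \<longrightarrow> \<alpha> > 0 \<longrightarrow>
    tikhonov_minimizer M DF F R \<alpha> (\<lambda>x. gd x + \<xi> x) fh \<longrightarrow>
    0 \<le> Lp_norm M 1 (\<lambda>x. F fh x - gd x) \<and>
    (\<exists>D\<ge>0. bregman R fs fh fd = ereal D \<and>
      \<beta> / 2 * D \<le> \<phi> (Lp_norm M 1 (\<lambda>x. F fh x - gd x)) - 3 / 4 * (Lp_norm M 1 (\<lambda>x. F fh x - gd x) / \<alpha>)
        + 2 * \<epsilon> / \<alpha> + K * (\<eta> powr \<gamma> / \<alpha> powr q'))"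
proof -
  have sM: "M \<in> sets lebesgue" using M by (auto simp: bounded_lipschitz_domain_def)
  have q'pos: "q' > 0" using conjugate_exponent(2)[OF q q'] by simp
  have \<gamma>q': "\<gamma> = q' * (real k / real CARD('n) + 1 - inv_exponent p)"
  proof (cases "p = \<infinity>")
    case False
    then have "real_of_ereal p \<noteq> 0" using p by (cases p) auto
    then show ?thesis using False by (simp add: \<gamma> field_simps)
  qed (simp add: \<gamma> algebra_simps)
  have k': "k = 0 \<and> p = \<infinity> \<or> real k - real CARD('n) * inv_exponent p > 0"
    using k by (auto split: if_splits)
  have eighth: "(1 / 8 :: real) > 0" by simp
  obtain Cs t0 where Cs: "Cs > 0" "t0 > 0" and small: "\<forall>u1 u2 P \<eta>. u1 \<in> sobolev M k p \<longrightarrow> u2 \<in> sobolev M k p \<longrightarrow> u1 \<in> Lp M 1 \<longrightarrow> u2 \<in> Lp M 1 \<longrightarrow>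
    P \<in> sets borel \<longrightarrow> P \<subseteq> M \<longrightarrow> measure lebesgue P \<le> \<eta> \<longrightarrow> 0 < \<eta> \<longrightarrow> \<eta> \<le> t0 \<longrightarrow>
    (\<integral>x. indicator P x * \<bar>u1 x - u2 x\<bar> \<partial>lebesgue_on M) \<le> (1 / 8) * Lp_norm M 1 (\<lambda>x. u1 x - u2 x) +
      Cs * \<eta> powr (real k / real CARD('n) + 1 - inv_exponent p) * sobolev_seminorm M k p (\<lambda>x. u1 x - u2 x)"
    using small_set_bound[OF M p k' eighth] by (elim exE conjE) (rule that)
  \<comment> \<open>The constant of \<open>young_absorb\<close> for \<kappa> = \<beta> / 2, which
    leaves \<beta> / 2 * D on the left; 2 Cs CF is the part of x below that does not depend on
    \<eta> and \<alpha>.\<close>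
  define K where "K = (\<beta> / 2) powr (- (q' / q)) * (2 * Cs * CF) powr q'"
  have K: "K > 0" using \<beta> Cs CF by (simp add: K_def)
  show ?thesis
  proof (rule exI[of _ K], rule conjI[OF K], rule exI[of _ t0], rule conjI[OF Cs(2)], intro allI impI)
    fix \<epsilon> \<eta> \<xi> \<alpha> fh
    assume \<epsilon>: "\<epsilon> > 0" and \<eta>: "\<eta> > 0" and t0: "max \<epsilon> \<eta> \<le> t0" and noise: "impulsive_noise M \<epsilon> \<eta> \<xi>"
      and \<alpha>: "\<alpha> > 0" and min: "tikhonov_minimizer M DF F R \<alpha> (\<lambda>x. gd x + \<xi> x) fh"
    define g where "g = (\<lambda>x. F fh x - gd x)"
    define \<tau> where "\<tau> = Lp_norm M 1 g"
    obtain P where \<xi>: "\<xi> \<in> Lp M 1" and P: "P \<in> sets borel" "P \<subseteq> M" "Lp_norm (M - P) 1 \<xi> \<le> \<epsilon>" "measure lebesgue P \<le> \<eta>"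
      using noise by (auto simp: impulsive_noise_def)
    have dom: "ess_dom R \<subseteq> DF" and L1: "\<And>f. f \<in> DF \<Longrightarrow> F f \<in> Lp M 1" and Rninf: "\<And>f. R f \<noteq> -\<infinity>"
      using wp by (auto simp: well_posed_def)
    have fhD: "fh \<in> DF" and
      opt: "\<not> ereal (1 / \<alpha> * Lp_norm M 1 (\<lambda>x. F fd x - (gd x + \<xi> x))) + R fd
        < ereal (1 / \<alpha> * Lp_norm M 1 (\<lambda>x. F fh x - (gd x + \<xi> x))) + R fh"
      using min fd dom unfolding tikhonov_minimizer_def is_arg_min_def by blast+
    have res_fd: "Lp_norm M 1 (\<lambda>x. F fd x - (gd x + \<xi> x)) = Lp_norm M 1 \<xi>"
      by (simp add: Lp_norm_1_eq gd)
    have res_fh: "Lp_norm M 1 (\<lambda>x. F fh x - (gd x + \<xi> x)) = Lp_norm M 1 (\<lambda>x. g x - \<xi> x)"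
      by (simp add: g_def diff_diff_eq)
    have "R fd < \<infinity>" using fd by (simp add: ess_dom_def)
    then obtain rd where rd: "R fd = ereal rd" using Rninf[of fd] by (cases "R fd") auto
    \<comment> \<open>The value of the functional at fd is finite, so a minimiser cannot have an
      infinite one.\<close>
    have "R fh \<noteq> \<infinity>" using opt rd by auto
    then obtain rh where rh: "R fh = ereal rh" using Rninf[of fh] by (cases "R fh") auto
    have fh: "fh \<in> ess_dom R" by (simp add: ess_dom_def rh)
    have opt': "1 / \<alpha> * Lp_norm M 1 (\<lambda>x. g x - \<xi> x) + rh \<le> 1 / \<alpha> * Lp_norm M 1 \<xi> + rd"
      using opt unfolding res_fd res_fh rd rh by simp
    define D where "D = rh - rd - blinfun_apply fs (fh - fd)"
    have breg: "bregman R fs fh fd = ereal D" by (simp add: bregman_def rd rh D_def)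
    have D0: "D \<ge> 0"
    proof -
      have "R fd + ereal (blinfun_apply fs (fh - fd)) \<le> R fh"
        using fs by (simp add: subdifferential_def)
      then show ?thesis by (simp add: rd rh D_def)
    qed
    have "ereal \<beta> * ereal D \<le> ereal rh - ereal rd + ereal (\<phi> \<tau>)"
      using bspec[OF vsc fh] unfolding breg rd rh \<tau>_def g_def .
    then have vsc': "\<beta> * D \<le> rh - rd + \<phi> \<tau>" by simp
    have "F fh \<in> sobolev M k p" "gd \<in> sobolev M k p" using sob fh fd gd by auto
    moreover have L1g: "F fh \<in> Lp M 1" "gd \<in> Lp M 1" using L1 fhD fd dom gd by auto
    moreover have "\<eta> \<le> t0" using t0 by simp
    ultimately have "(\<integral>x. indicator P x * \<bar>g x\<bar> \<partial>lebesgue_on M) \<le> (1 / 8) * \<tau> +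
        Cs * \<eta> powr (real k / real CARD('n) + 1 - inv_exponent p) * sobolev_seminorm M k p g"
      using small P \<eta> unfolding g_def \<tau>_def by blast
    also have "\<dots> \<le> (1 / 8) * \<tau> + Cs * \<eta> powr (\<gamma> / q') * (CF * D powr (1 / q))"
    proof -
      have seminorm: "sobolev_seminorm M k p g \<le> CF * D powr (1 / q)"
        using bspec[OF interp fh] unfolding breg g_def by simp
      \<comment> \<open>The origin of \<gamma>: raising \<eta>^(\<gamma>/q') to the power q' in
        Young's inequality yields \<eta>^\<gamma>.\<close>
      have exponent: "real k / real CARD('n) + 1 - inv_exponent p = \<gamma> / q'"
        using \<gamma>q' q'pos by (metis nonzero_mult_div_cancel_left less_irrefl)
      have "0 \<le> Cs * \<eta> powr (\<gamma> / q')" using Cs by simp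
      then show ?thesis
        unfolding exponent by (rule add_left_mono[OF mult_left_mono[OF seminorm]])
    qed
    finally have smallP: "(\<integral>x. indicator P x * \<bar>g x\<bar> \<partial>lebesgue_on M) \<le> (1 / 8) * \<tau> + Cs * \<eta> powr (\<gamma> / q') * (CF * D powr (1 / q))" .
    have gL: "g \<in> Lp M 1" unfolding g_def by (rule Lp_diff[OF _ L1g]) simp
    have lower: "Lp_norm M 1 \<xi> + \<tau> - 2 * (\<integral>x. indicator P x * \<bar>g x\<bar> \<partial>lebesgue_on M) - 2 * \<epsilon> \<le> Lp_norm M 1 (\<lambda>x. g x - \<xi> x)"
      unfolding \<tau>_def by (rule impulsive_residual_lower_bound[OF sM gL \<xi> P(1-3)])
    define x where "x = 2 * Cs * CF * \<eta> powr (\<gamma> / q') / \<alpha>"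
    have x0: "x \<ge> 0" using Cs CF \<alpha> by (simp add: x_def)
    have "Lp_norm M 1 (\<lambda>x. g x - \<xi> x) - Lp_norm M 1 \<xi> \<ge> 3 / 4 * \<tau> - 2 * \<epsilon> - \<alpha> * (x * D powr (1 / q))"
      using lower smallP \<alpha> by (simp add: x_def mult_ac)
    then have "(3 / 4 * \<tau> - 2 * \<epsilon> - \<alpha> * (x * D powr (1 / q))) / \<alpha> \<le> (Lp_norm M 1 (\<lambda>x. g x - \<xi> x) - Lp_norm M 1 \<xi>) / \<alpha>"
      using \<alpha> by (intro divide_right_mono) auto
    also have "\<dots> \<le> rd - rh" using opt' by (simp add: diff_divide_distrib)
    finally have "rh - rd \<le> - (3 / 4 * (\<tau> / \<alpha>)) + 2 * \<epsilon> / \<alpha> + x * D powr (1 / q)"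
      using \<alpha> by (simp add: diff_divide_distrib)
    moreover have "x * D powr (1 / q) \<le> \<beta> / 2 * D + (\<beta> / 2) powr (- (q' / q)) * x powr q'"
      by (rule young_absorb) (use \<beta> x0 D0 q q' in auto)
    moreover have "(\<beta> / 2) powr (- (q' / q)) * x powr q' = K * (\<eta> powr \<gamma> / \<alpha> powr q')"
      using Cs CF \<alpha> \<eta> q'pos by (simp add: x_def K_def powr_divide powr_mult powr_powr)
    ultimately have "\<beta> / 2 * D \<le> \<phi> \<tau> - 3 / 4 * (\<tau> / \<alpha>) + 2 * \<epsilon> / \<alpha> + K * (\<eta> powr \<gamma> / \<alpha> powr q')"
      using vsc' by linarith
    then show "0 \<le> Lp_norm M 1 (\<lambda>x. F fh x - gd x) \<and>
      (\<exists>D\<ge>0. bregman R fs fh fd = ereal D \<and>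
        \<beta> / 2 * D \<le> \<phi> (Lp_norm M 1 (\<lambda>x. F fh x - gd x)) - 3 / 4 * (Lp_norm M 1 (\<lambda>x. F fh x - gd x) / \<alpha>)
          + 2 * \<epsilon> / \<alpha> + K * (\<eta> powr \<gamma> / \<alpha> powr q'))"
      using D0 breg Lp_norm_nonneg[OF gL] unfolding \<tau>_def g_def by blast
  qed
qed

section \<open>The convergence rates in the two cases\<close>

theorem theorem4p1:
  fixes M :: "(real^'n::finite) set"
    and TX :: "'x::banach topology" and TY :: "(real^'n \<Rightarrow> real) topology"
    and DF :: "'x set" and F :: "'x \<Rightarrow> real^'n \<Rightarrow> real" and R :: "'x \<Rightarrow> ereal"
    and fd :: 'x and fs :: "'x \<Rightarrow>\<^sub>L real" and gd :: "real^'n \<Rightarrow> real"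
    and \<beta> q q' \<gamma> CF :: real and \<phi> :: "real \<Rightarrow> real" and k :: nat and p :: ereal
  assumes "bounded_lipschitz_domain M"
    and "well_posed M TX TY DF F R"
    and "fd \<in> ess_dom R" and "gd = F fd" and "fs \<in> subdifferential R fd"
    and "\<beta> > 0" and "concave_index_function \<phi>" and "\<exists>t\<ge>0. \<phi> t \<noteq> 0"
    and "\<forall>f\<in>ess_dom R.
           ereal \<beta> * bregman R fs f fd
             \<le> R f - R fd + ereal (\<phi> (Lp_norm M 1 (\<lambda>x. F f x - gd x)))"
    and "1 \<le> p" and "1 < q" and "CF > 0"
    and "F ` ess_dom R \<subseteq> sobolev M k p"
    and "\<forall>f\<in>ess_dom R.
           sobolev_seminorm M k p (\<lambda>x. F f x - gd x)
             \<le> CF * real_of_ereal (bregman R fs f fd) powr (1 / q)"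
    and "k = 0 \<and> p = \<infinity> \<or>
         real k > (if p = \<infinity> then 0 else real CARD('n) / real_of_ereal p)"
    and "1 / q + 1 / q' = 1"
    and "\<gamma> = q' * real k / real CARD('n) +
             (if p = \<infinity> then q' else q' * (real_of_ereal p - 1) / real_of_ereal p)"
  shows
    "(\<forall>\<delta> cl cu. \<delta> > 0 \<and> cl > 0 \<and> cu > 0 \<and> concave_on {0..} (\<lambda>t. \<phi> t powr (1 + \<delta>)) \<longrightarrow>
        (\<exists>C>0. \<exists>t0>0. \<forall>\<epsilon> \<eta> \<xi> \<alpha> fh.
           \<epsilon> > 0 \<and> \<eta> > 0 \<and> max \<epsilon> \<eta> \<le> t0 \<and> impulsive_noise M \<epsilon> \<eta> \<xi> \<and> \<alpha> > 0 \<and>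
           cl * \<alpha> \<le> inv_pos (theta \<phi>) \<epsilon> + inv_pos (theta_tilde q' \<phi>) (\<eta> powr \<gamma>) \<and>
           inv_pos (theta \<phi>) \<epsilon> + inv_pos (theta_tilde q' \<phi>) (\<eta> powr \<gamma>) \<le> cu * \<alpha> \<and>
           tikhonov_minimizer M DF F R \<alpha> (\<lambda>x. gd x + \<xi> x) fh \<longrightarrow>
           bregman R fs fh fd
             \<le> ereal C * psi \<phi> (inv_pos (theta \<phi>) \<epsilon> + inv_pos (theta_tilde q' \<phi>) (\<eta> powr \<gamma>)) \<and>
           ereal (Lp_norm M 1 (\<lambda>x. F fh x - gd x))
             \<le> ereal C * (ereal \<epsilon> + theta \<phi> (inv_pos (theta_tilde q' \<phi>) (\<eta> powr \<gamma>))))) \<and>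
     (\<forall>c Cerr \<alpha>. c > 0 \<and> (\<forall>t\<ge>0. \<phi> t = c * t) \<and>
        (if k = 0 \<and> p = \<infinity> then Cerr = 1 else Cerr > 1) \<and>
        0 < \<alpha> \<and> \<alpha> \<le> 1 / (2 * Cerr * c) \<longrightarrow>
        (\<exists>C>0. \<exists>t0>0. \<forall>\<epsilon> \<eta> \<xi> fh.
           \<epsilon> > 0 \<and> \<eta> > 0 \<and> max \<epsilon> \<eta> \<le> t0 \<and> impulsive_noise M \<epsilon> \<eta> \<xi> \<and>
           tikhonov_minimizer M DF F R \<alpha> (\<lambda>x. gd x + \<xi> x) fh \<longrightarrow>
           bregman R fs fh fd + ereal (Lp_norm M 1 (\<lambda>x. F fh x - gd x))
             \<le> ereal (C * (\<epsilon> + \<eta> powr \<gamma>))))"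
proof -
  note q'1 = conjugate_exponent(2)[OF assms(11,16)]
  obtain K t0 where K: "K > 0" and t0: "t0 > 0" and err: "\<forall>\<epsilon> \<eta> \<xi> \<alpha> fh.
    \<epsilon> > 0 \<longrightarrow> \<eta> > 0 \<longrightarrow> max \<epsilon> \<eta> \<le> t0 \<longrightarrow> impulsive_noise M \<epsilon> \<eta> \<xi> \<longrightarrow> \<alpha> > 0 \<longrightarrow>
    tikhonov_minimizer M DF F R \<alpha> (\<lambda>x. gd x + \<xi> x) fh \<longrightarrow>
    0 \<le> Lp_norm M 1 (\<lambda>x. F fh x - gd x) \<and>
    (\<exists>D\<ge>0. bregman R fs fh fd = ereal D \<and>
      \<beta> / 2 * D \<le> \<phi> (Lp_norm M 1 (\<lambda>x. F fh x - gd x)) - 3 / 4 * (Lp_norm M 1 (\<lambda>x. F fh x - gd x) / \<alpha>)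
        + 2 * \<epsilon> / \<alpha> + K * (\<eta> powr \<gamma> / \<alpha> powr q'))"
    using error_inequality[OF assms(1-6) assms(9-17)] by (elim exE conjE) (rule that)
  show ?thesis
  proof (rule conjI)
    show "\<forall>\<delta> cl cu. \<delta> > 0 \<and> cl > 0 \<and> cu > 0 \<and> concave_on {0..} (\<lambda>t. \<phi> t powr (1 + \<delta>)) \<longrightarrow>
        (\<exists>C>0. \<exists>t0>0. \<forall>\<epsilon> \<eta> \<xi> \<alpha> fh.
           \<epsilon> > 0 \<and> \<eta> > 0 \<and> max \<epsilon> \<eta> \<le> t0 \<and> impulsive_noise M \<epsilon> \<eta> \<xi> \<and> \<alpha> > 0 \<and>
           cl * \<alpha> \<le> inv_pos (theta \<phi>) \<epsilon> + inv_pos (theta_tilde q' \<phi>) (\<eta> powr \<gamma>) \<and>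
           inv_pos (theta \<phi>) \<epsilon> + inv_pos (theta_tilde q' \<phi>) (\<eta> powr \<gamma>) \<le> cu * \<alpha> \<and>
           tikhonov_minimizer M DF F R \<alpha> (\<lambda>x. gd x + \<xi> x) fh \<longrightarrow>
           bregman R fs fh fd
             \<le> ereal C * psi \<phi> (inv_pos (theta \<phi>) \<epsilon> + inv_pos (theta_tilde q' \<phi>) (\<eta> powr \<gamma>)) \<and>
           ereal (Lp_norm M 1 (\<lambda>x. F fh x - gd x))
             \<le> ereal C * (ereal \<epsilon> + theta \<phi> (inv_pos (theta_tilde q' \<phi>) (\<eta> powr \<gamma>))))"
    proof (intro allI impI, elim conjE)
      fix \<delta> cl cu :: real
      assume "\<delta> > 0" and cl: "cl > 0" and cu: "cu > 0" and "concave_on {0..} (\<lambda>t. \<phi> t powr (1 + \<delta>))"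
      then interpret subpower_index_function \<phi> \<delta>
        using assms(7,8) by unfold_locales
      \<comment> \<open>From cl * \<alpha> \<le> A = a + b follows 2 \<alpha> \<le> (2 / cl) A; the
        maximum with 1 allows \<open>real_psi_scaled\<close>.\<close>
      define m where "m = max 1 (2 / cl)"
      \<comment> \<open>One summand each for \<phi>(\<tau>) - \<tau> / (2 \<alpha>), for 2
        \<epsilon> / \<alpha> and for K \<eta>^\<gamma> / \<alpha>^q', all measured in units of
        \<psi>(a + b).\<close>
      define L where "L = m powr (1 / \<delta>) + 2 * cu + K * cu powr q'"
      have m: "m \<ge> 1" "2 / cl \<le> m" by (auto simp: m_def)
      have L: "L > 0" unfolding L_def using m cu K by (intro add_pos_pos) auto
      \<comment> \<open>The first summand serves D. In the second, which serves \<tau>, 4 / cl comes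
        from 4 \<alpha> \<le> 4 A / cl and 2 * 2 powr (1 / \<delta>) from
        \<open>theta_sum_le\<close>.\<close>
      define C where "C = 2 / \<beta> * L + 4 / cl * (L * (2 * 2 powr (1 / \<delta>)))"
      have C: "C > 0" "2 / \<beta> * L \<le> C" "4 / cl * (L * (2 * 2 powr (1 / \<delta>))) \<le> C"
        using L cl assms(6) by (auto simp: C_def intro!: add_pos_pos)
      show "\<exists>C>0. \<exists>t0>0. \<forall>\<epsilon> \<eta> \<xi> \<alpha> fh.
           \<epsilon> > 0 \<and> \<eta> > 0 \<and> max \<epsilon> \<eta> \<le> t0 \<and> impulsive_noise M \<epsilon> \<eta> \<xi> \<and> \<alpha> > 0 \<and>
           cl * \<alpha> \<le> inv_pos (theta \<phi>) \<epsilon> + inv_pos (theta_tilde q' \<phi>) (\<eta> powr \<gamma>) \<and>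
           inv_pos (theta \<phi>) \<epsilon> + inv_pos (theta_tilde q' \<phi>) (\<eta> powr \<gamma>) \<le> cu * \<alpha> \<and>
           tikhonov_minimizer M DF F R \<alpha> (\<lambda>x. gd x + \<xi> x) fh \<longrightarrow>
           bregman R fs fh fd
             \<le> ereal C * psi \<phi> (inv_pos (theta \<phi>) \<epsilon> + inv_pos (theta_tilde q' \<phi>) (\<eta> powr \<gamma>)) \<and>
           ereal (Lp_norm M 1 (\<lambda>x. F fh x - gd x))
             \<le> ereal C * (ereal \<epsilon> + theta \<phi> (inv_pos (theta_tilde q' \<phi>) (\<eta> powr \<gamma>)))"
      proof (rule exI[of _ C], rule conjI[OF C(1)], rule exI[of _ t0], rule conjI[OF t0], intro allI impI, elim conjE)
        fix \<epsilon> \<eta> \<xi> \<alpha> fh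
        define a where "a = inv_pos (theta \<phi>) \<epsilon>"
        define b where "b = inv_pos (theta_tilde q' \<phi>) (\<eta> powr \<gamma>)"
        define \<tau> where "\<tau> = Lp_norm M 1 (\<lambda>x. F fh x - gd x)"
        assume \<epsilon>: "\<epsilon> > 0" and \<eta>: "\<eta> > 0" and "max \<epsilon> \<eta> \<le> t0" "impulsive_noise M \<epsilon> \<eta> \<xi>" and \<alpha>: "\<alpha> > 0"
          and "cl * \<alpha> \<le> inv_pos (theta \<phi>) \<epsilon> + inv_pos (theta_tilde q' \<phi>) (\<eta> powr \<gamma>)"
          and "inv_pos (theta \<phi>) \<epsilon> + inv_pos (theta_tilde q' \<phi>) (\<eta> powr \<gamma>) \<le> cu * \<alpha>"
          and "tikhonov_minimizer M DF F R \<alpha> (\<lambda>x. gd x + \<xi> x) fh"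
        then have clA: "cl * \<alpha> \<le> a + b" and cuA: "a + b \<le> cu * \<alpha>"
          and \<tau>0: "0 \<le> \<tau>" and ex: "\<exists>D\<ge>0. bregman R fs fh fd = ereal D \<and>
            \<beta> / 2 * D \<le> \<phi> \<tau> - 3 / 4 * (\<tau> / \<alpha>) + 2 * \<epsilon> / \<alpha> + K * (\<eta> powr \<gamma> / \<alpha> powr q')"
          using err unfolding a_def b_def \<tau>_def by blast+
        from ex obtain D where D: "D \<ge> 0" "bregman R fs fh fd = ereal D"
          "\<beta> / 2 * D \<le> \<phi> \<tau> - 3 / 4 * (\<tau> / \<alpha>) + 2 * \<epsilon> / \<alpha> + K * (\<eta> powr \<gamma> / \<alpha> powr q')"
          by blast
        have a: "a > 0" "a * \<psi> a = \<epsilon>" unfolding a_def by (rule inv_theta[OF \<epsilon>])+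
        have "\<eta> powr \<gamma> > 0" using \<eta> by simp
        from inv_theta_tilde[OF this q'1] have b: "b > 0" "b powr q' * \<psi> b = \<eta> powr \<gamma>"
          by (simp_all add: b_def)
        define A where "A = a + b"
        have A: "A > 0" "a \<le> A" "b \<le> A" "cl * \<alpha> \<le> A" "A \<le> cu * \<alpha>" using a b clA cuA by (auto simp: A_def)
        have inv\<alpha>: "1 / \<alpha> \<le> cu / A" using A \<alpha> by (simp add: field_simps)
        have \<psi>A: "\<psi> A > 0" by (rule real_psi_pos[OF A(1)])
        have "2 * \<alpha> \<le> m * A"
        proof -
          have "2 * \<alpha> = 2 / cl * (cl * \<alpha>)" using cl by simp
          also have "\<dots> \<le> m * A" using m A cl \<alpha> by (intro mult_mono) auto
          finally show ?thesis .
        qed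
        then have "\<psi> (2 * \<alpha>) \<le> \<psi> (m * A)" using \<alpha> by (intro real_psi_mono) auto
        also have "\<dots> \<le> m powr (1 / \<delta>) * \<psi> A" by (rule real_psi_scaled[OF m(1) A(1)])
        finally have bound\<phi>: "\<phi> \<tau> - \<tau> / (2 * \<alpha>) \<le> m powr (1 / \<delta>) * \<psi> A"
          using real_psi_upper[of "2 * \<alpha>" \<tau>] \<alpha> \<tau>0 by simp
        have bound\<epsilon>: "2 * \<epsilon> / \<alpha> \<le> 2 * cu * \<psi> A"
        proof -
          \<comment> \<open>\<epsilon> = \<theta>(a) \<le> \<theta>(A) by monotonicity; dividing by
            \<alpha> \<ge> A / cu leaves a multiple of \<psi>(A).\<close>
          have "\<epsilon> \<le> A * \<psi> A"
            unfolding a(2)[symmetric] using a A real_psi_mono[OF a(1) A(2)] real_psi_pos[OF a(1)] by (intro mult_mono) auto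
          then have "\<epsilon> * (1 / \<alpha>) \<le> (A * \<psi> A) * (cu / A)"
            using inv\<alpha> \<epsilon> \<alpha> A \<psi>A by (intro mult_mono) auto
          then have "\<epsilon> / \<alpha> \<le> cu * \<psi> A" using A by (simp add: mult.commute)
          then show ?thesis using mult_left_mono[of "\<epsilon> / \<alpha>" "cu * \<psi> A" 2] by simp
        qed
        have bound\<eta>: "\<eta> powr \<gamma> / \<alpha> powr q' \<le> cu powr q' * \<psi> A"
        proof -
          \<comment> \<open>The same argument with \<open>theta_tilde\<close> at b, where
            \<alpha>^q' is matched by A^q'.\<close>
          have "\<eta> powr \<gamma> \<le> A powr q' * \<psi> A"
            unfolding b(2)[symmetric] using b A q'1 real_psi_mono[OF b(1) A(3)] real_psi_pos[OF b(1)]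
            by (intro mult_mono powr_mono2) auto
          moreover have "(1 / \<alpha>) powr q' \<le> (cu / A) powr q'"
            using inv\<alpha> \<alpha> q'1 by (intro powr_mono2) auto
          ultimately have "\<eta> powr \<gamma> * (1 / \<alpha>) powr q' \<le> (A powr q' * \<psi> A) * (cu / A) powr q'"
            using A \<psi>A by (intro mult_mono) auto
          then show ?thesis using A \<alpha> cu by (simp add: powr_divide mult.commute)
        qed
        have "K * (\<eta> powr \<gamma> / \<alpha> powr q') \<le> K * (cu powr q' * \<psi> A)"
          using K by (intro mult_left_mono bound\<eta>) auto
        moreover have "L * \<psi> A = m powr (1 / \<delta>) * \<psi> A + 2 * cu * \<psi> A + K * (cu powr q' * \<psi> A)"
          by (simp add: L_def distrib_right)
        \<comment> \<open>The quarter of \<tau> / \<alpha> that \<phi> leaves over; it yields the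
          bound on \<tau>.\<close>
        moreover have "\<tau> / (4 * \<alpha>) = 3 / 4 * (\<tau> / \<alpha>) - \<tau> / (2 * \<alpha>)"
          using \<alpha> by (simp add: field_simps)
        ultimately have key: "\<beta> / 2 * D + \<tau> / (4 * \<alpha>) \<le> L * \<psi> A"
          using D(3) bound\<phi> bound\<epsilon> by linarith
        have "0 \<le> \<tau> / (4 * \<alpha>)" using \<tau>0 \<alpha> by simp
        then have "\<beta> / 2 * D \<le> L * \<psi> A" using key by linarith
        then have "D \<le> 2 / \<beta> * L * \<psi> A" using assms(6) by (simp add: field_simps)
        also have "\<dots> \<le> C * \<psi> A" using C(2) \<psi>A by (intro mult_right_mono) auto
        finally have D_le: "D \<le> C * \<psi> A" .
        have "0 \<le> \<beta> / 2 * D" using D(1) assms(6) by simp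
        then have "\<tau> / (4 * \<alpha>) \<le> L * \<psi> A" using key by linarith
        then have "\<tau> \<le> 4 * \<alpha> * (L * \<psi> A)" using \<alpha> by (simp add: field_simps)
        also have "\<dots> \<le> 4 * (A / cl) * (L * \<psi> A)"
          using A cl L \<psi>A by (intro mult_right_mono mult_left_mono) (auto simp: field_simps)
        also have "\<dots> = 4 / cl * (L * (A * \<psi> A))" by simp
        also have "\<dots> \<le> 4 / cl * (L * (2 * 2 powr (1 / \<delta>) * (a * \<psi> a + b * \<psi> b)))"
          unfolding A_def using cl L a b by (intro mult_left_mono theta_sum_le) auto
        also have "\<dots> = 4 / cl * (L * (2 * 2 powr (1 / \<delta>))) * (\<epsilon> + b * \<psi> b)"
          using a(2) by simp
        also have "\<dots> \<le> C * (\<epsilon> + b * \<psi> b)"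
          using C(3) \<epsilon> b(1) real_psi_pos[OF b(1)] by (intro mult_right_mono) auto
        finally have \<tau>_le: "\<tau> \<le> C * (\<epsilon> + b * \<psi> b)" .
        show "bregman R fs fh fd
             \<le> ereal C * psi \<phi> (inv_pos (theta \<phi>) \<epsilon> + inv_pos (theta_tilde q' \<phi>) (\<eta> powr \<gamma>)) \<and>
           ereal (Lp_norm M 1 (\<lambda>x. F fh x - gd x))
             \<le> ereal C * (ereal \<epsilon> + theta \<phi> (inv_pos (theta_tilde q' \<phi>) (\<eta> powr \<gamma>)))"
          unfolding a_def[symmetric] b_def[symmetric] A_def[symmetric] \<tau>_def[symmetric] D(2) theta_def
            psi_eq[OF A(1)] psi_eq[OF b(1)]
          using D_le \<tau>_le by simp
      qed
    qed
  next
    show "\<forall>c Cerr \<alpha>. c > 0 \<and> (\<forall>t\<ge>0. \<phi> t = c * t) \<and>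
        (if k = 0 \<and> p = \<infinity> then Cerr = 1 else Cerr > 1) \<and>
        0 < \<alpha> \<and> \<alpha> \<le> 1 / (2 * Cerr * c) \<longrightarrow>
        (\<exists>C>0. \<exists>t0>0. \<forall>\<epsilon> \<eta> \<xi> fh.
           \<epsilon> > 0 \<and> \<eta> > 0 \<and> max \<epsilon> \<eta> \<le> t0 \<and> impulsive_noise M \<epsilon> \<eta> \<xi> \<and>
           tikhonov_minimizer M DF F R \<alpha> (\<lambda>x. gd x + \<xi> x) fh \<longrightarrow>
           bregman R fs fh fd + ereal (Lp_norm M 1 (\<lambda>x. F fh x - gd x))
             \<le> ereal (C * (\<epsilon> + \<eta> powr \<gamma>)))"
    proof (intro allI impI, elim conjE)
      fix c Cerr \<alpha> :: real
      assume c: "c > 0" and lin: "\<forall>t\<ge>0. \<phi> t = c * t" and Cerr: "if k = 0 \<and> p = \<infinity> then Cerr = 1 else Cerr > 1"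
        and \<alpha>: "0 < \<alpha>" and \<alpha>c: "\<alpha> \<le> 1 / (2 * Cerr * c)"
      have Cerr1: "Cerr \<ge> 1" using Cerr by (auto split: if_splits)
      have "1 / (2 * Cerr * c) \<le> 1 / (2 * c)"
        using Cerr1 c by (intro divide_left_mono) auto
      then have "\<alpha> \<le> 1 / (2 * c)" using \<alpha>c by linarith
      \<comment> \<open>Half of \<tau> / \<alpha> thus dominates \<phi>(\<tau>) = c \<tau>.\<close>
      then have c\<alpha>: "c \<le> 1 / (2 * \<alpha>)" using c \<alpha> by (simp add: field_simps)
      define L where "L = 2 / \<alpha> + K / \<alpha> powr q'"
      define C where "C = (2 / \<beta> + 4 * \<alpha>) * L"
      have L: "L > 0" using \<alpha> K by (simp add: L_def add_pos_pos)
      have C: "C > 0" using L \<alpha> assms(6) by (simp add: C_def add_pos_pos)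
      show "\<exists>C>0. \<exists>t0>0. \<forall>\<epsilon> \<eta> \<xi> fh.
           \<epsilon> > 0 \<and> \<eta> > 0 \<and> max \<epsilon> \<eta> \<le> t0 \<and> impulsive_noise M \<epsilon> \<eta> \<xi> \<and>
           tikhonov_minimizer M DF F R \<alpha> (\<lambda>x. gd x + \<xi> x) fh \<longrightarrow>
           bregman R fs fh fd + ereal (Lp_norm M 1 (\<lambda>x. F fh x - gd x))
             \<le> ereal (C * (\<epsilon> + \<eta> powr \<gamma>))"
      proof (rule exI[of _ C], rule conjI[OF C], rule exI[of _ t0], rule conjI[OF t0], intro allI impI, elim conjE)
        fix \<epsilon> \<eta> \<xi> fh
        define \<tau> where "\<tau> = Lp_norm M 1 (\<lambda>x. F fh x - gd x)"
        assume \<epsilon>: "\<epsilon> > 0" and "\<eta> > 0" "max \<epsilon> \<eta> \<le> t0" "impulsive_noise M \<epsilon> \<eta> \<xi>"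
          "tikhonov_minimizer M DF F R \<alpha> (\<lambda>x. gd x + \<xi> x) fh"
        then have \<tau>0: "0 \<le> \<tau>" and ex: "\<exists>D\<ge>0. bregman R fs fh fd = ereal D \<and>
            \<beta> / 2 * D \<le> \<phi> \<tau> - 3 / 4 * (\<tau> / \<alpha>) + 2 * \<epsilon> / \<alpha> + K * (\<eta> powr \<gamma> / \<alpha> powr q')"
          using err \<alpha> unfolding \<tau>_def by blast+
        from ex obtain D where D: "D \<ge> 0" "bregman R fs fh fd = ereal D"
          "\<beta> / 2 * D \<le> \<phi> \<tau> - 3 / 4 * (\<tau> / \<alpha>) + 2 * \<epsilon> / \<alpha> + K * (\<eta> powr \<gamma> / \<alpha> powr q')"
          by blast
        have "\<phi> \<tau> \<le> 1 / (2 * \<alpha>) * \<tau>"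
          using lin \<tau>0 c\<alpha> by (simp only: mult_right_mono)
        moreover have "\<tau> / (4 * \<alpha>) = 3 / 4 * (\<tau> / \<alpha>) - 1 / (2 * \<alpha>) * \<tau>"
          using \<alpha> by (simp add: field_simps)
        ultimately have "\<beta> / 2 * D + \<tau> / (4 * \<alpha>) \<le> 2 * \<epsilon> / \<alpha> + K * (\<eta> powr \<gamma> / \<alpha> powr q')"
          using D(3) by linarith
        also have "\<dots> = 2 / \<alpha> * \<epsilon> + K / \<alpha> powr q' * \<eta> powr \<gamma>" by simp
        also have "\<dots> \<le> L * \<epsilon> + L * \<eta> powr \<gamma>"
          using \<epsilon> \<alpha> K by (intro add_mono mult_right_mono) (auto simp: L_def)
        finally have key: "\<beta> / 2 * D + \<tau> / (4 * \<alpha>) \<le> L * (\<epsilon> + \<eta> powr \<gamma>)" by (simp add: distrib_left)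
        have n1: "0 \<le> \<beta> / 2 * D" and n2: "0 \<le> \<tau> / (4 * \<alpha>)" using D(1) assms(6) \<tau>0 \<alpha> by auto
        have "\<beta> / 2 * D \<le> L * (\<epsilon> + \<eta> powr \<gamma>)" using key n2 by linarith
        then have "D \<le> 2 / \<beta> * (L * (\<epsilon> + \<eta> powr \<gamma>))" using assms(6) by (simp add: field_simps)
        moreover have "\<tau> / (4 * \<alpha>) \<le> L * (\<epsilon> + \<eta> powr \<gamma>)" using key n1 by linarith
        then have "\<tau> \<le> 4 * \<alpha> * (L * (\<epsilon> + \<eta> powr \<gamma>))" using \<alpha> by (simp add: field_simps)
        ultimately have "D + \<tau> \<le> (2 / \<beta> + 4 * \<alpha>) * (L * (\<epsilon> + \<eta> powr \<gamma>))"
          unfolding distrib_right by (rule add_mono)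
        then show "bregman R fs fh fd + ereal (Lp_norm M 1 (\<lambda>x. F fh x - gd x)) \<le> ereal (C * (\<epsilon> + \<eta> powr \<gamma>))"
          by (simp add: D(2) \<tau>_def C_def mult.assoc)
      qed
    qed
  qed
qed

end
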